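(* Let $x_0,x_1\in\mathbb{R}^n$, $u_0,u_1\in\mathbb{S}^{n-1}$, $r_0>0$ and $r_1\ge0$. Assume $K_V(x,y)=\rho\left(\frac{|x-y|^2}{\sigma^2}\right)\mathrm{Id}_{n \times n}$ with $\sigma>0$, $\rho$ of class $C^1$, $\rho(0)=1$ and $\rho'(0)<0$. Then the LDDMM-Fisher-Rao distance between the Dirac $1$-varifolds $r_0\delta_{(x_0,u_0)}$ and $r_1\delta_{(x_1,u_1)}$ satisfies $$d_{V-\mathcal{FR}}(r_0\delta_{(x_0,u_0)},r_1\delta_{(x_1,u_1)})^2=\frac{|x_1-x_0|^2}{2}+\frac\tau2\arccos(u_0^Tu_1)^2+2\tau\nu^2,$$ where $\tau=-\sigma^2/(2\rho'(0))>0$ and $\nu$ is given by $$\nu=\begin{cases}-\frac12\ln\left(\frac{\chi-1}{\chi+1}\right), & \text{if } r_1=0,\\[4pt] \ln\left[-\sqrt{\frac{r_1}{r_0}}\ \frac{1-\sqrt{1+\frac{r_0}{r_1}(\chi^2-1)}}{\chi-1}\right], & \text{if } 0<r_1\le r_0,\\[4pt] \ln\left[\sqrt{\frac{r_1}{r_0}}\ \frac{1+\sqrt{1+\frac{r_0}{r_1}(\chi^2-1)}}{\chi+1}\right], & \text{if } 0<r_0\le r_1,\end{cases}$$ with $\chi=\sqrt{1+\frac{\tau}{\gamma r_0}}$. Whenever $u_1\ne-u_0$, the geodesic is unique and of the form $r(t)\delta_{(x(t),u(t))}$, $t\in[0,1]$, where $x(t)=(1-t)x_0+tx_1$; with $\theta=\arccos(u_0^Tu_1)$,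 $u(t)=\frac{\sin((1-t)\theta)u_0+\sin(t\theta)u_1}{\sin\theta}$ if $\theta\neq0$ and $u(t)=u_0$ otherwise; and $$r(t)=\left(\frac{\sqrt{r_0}\sinh((1-t)\nu)+\sqrt{r_1}\sinh(\nu t)}{\sinh(\nu)}\right)^2$$ (understood as its limit for $\nu\to0$ when $\nu=0$).
   Context: Let $n\ge2$. The oriented Grassmannian $\widetilde{G}^n_1$ of oriented lines in $\mathbb{R}^n$ is identified with the unit sphere $\mathbb{S}^{n-1}$. A $1$-varifold is a nonnegative finite Radon measure on $\mathbb{R}^n\times\mathbb{S}^{n-1}$; $\delta_{(x,u)}$ is the Dirac mass at $(x,u)$. A diffeomorphism $\varphi$ acts on Diracs by $\varphi_\#(r\delta_{(x,u)})=r|d_x\varphi(u)|\,\delta_{(\varphi(x),\,d_x\varphi(u)/|d_x\varphi(u)|)}$, where $|\cdot|$ is the Euclidean norm. $V$ is a Hilbert space of vector fields $\mathbb{R}^n\to\mathbb{R}^n$ continuously embedded in $C_0^2(\mathbb{R}^n,\mathbb{R}^n)$ ($C^2$ vector fields vanishing at infinity together with their first and second order derivatives), which is the reproducing kernel Hilbert space with matrix-valued kernel $K_V$. For $v\in L^2([0,1],V)$, $\varphi_t^v$ is the flow: $\varphi_0^v=\mathrm{Id}$, $\partial_t\varphi_t^v=v_t\circ\varphi_t^v$. Fix $\gamma>0$. For a source varifold $\mu_0=r_0\delta_{(x_0,u_0)}$, a weight control is a function in $L^2([0,1],L^2(|\mu_0|))$ with $|\mu_0|=r_0\delta_{x_0}$,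 that is, a function $\eta\in L^2([0,1],\mathbb{R})$; set $\tilde\alpha_t=1+\frac12\int_0^t\eta_s\,ds$. The pair $(v,\eta)$ produces the path of varifolds $\mu_t=\tilde\alpha_t^2\,(\varphi_t^v)_\#(r_0\delta_{(x_0,u_0)})$. The squared LDDMM-Fisher-Rao distance $d_{V-\mathcal{FR}}(r_0\delta_{(x_0,u_0)},r_1\delta_{(x_1,u_1)})^2$ is the infimum of $$\frac12\int_0^1\|v_t\|_V^2\,dt+\frac\gamma2\int_0^1\eta_t^2\,|d_{x_0}\varphi_t^v(u_0)|\,r_0\,dt$$ over $(v,\eta)\in L^2([0,1],V\times\mathbb{R})$ such that $\tilde\alpha_t\ge0$ for all $t\in[0,1]$ and the transformed varifold at time $1$ equals the target, i.e. $\tilde\alpha_1^2\,(\varphi_1^v)_\#(r_0\delta_{(x_0,u_0)})=r_1\delta_{(x_1,u_1)}$ as measures. A geodesic is a path $t\mapsto\mu_t$ associated to a minimizer $(v,\eta)$.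
   Formalization: For r1 = 0 the target is the zero measure, so the distance cannot depend on (x1,u1) and the printed formulas fail unless (x1,u1) = (x0,u0); in that case x1, u1 are replaced by x0, u0 in the distance and geodesic formulas. *)

theory Defs
  imports "HOL-Probability.Giry_Monad"
begin

section \<open>Reproducing kernel Hilbert spaces of vector fields\<close>

definition deriv_blinfun ::
    "('a::euclidean_space \<Rightarrow> 'b::real_normed_vector) \<Rightarrow> 'a \<Rightarrow> 'a \<Rightarrow>\<^sub>L 'b"
  where "deriv_blinfun f x = Blinfun (frechet_derivative f (at x))"

definition C2_vanishing :: "('a::euclidean_space \<Rightarrow> 'a) set"
  where "C2_vanishing = {f.
     (\<forall>x. f differentiable (at x)) \<and>
     (\<forall>x. deriv_blinfun f differentiable (at x)) \<and>
     continuous_on UNIV (deriv_blinfun (deriv_blinfun f)) \<and>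
     (f \<longlongrightarrow> 0) at_infinity \<and>
     (deriv_blinfun f \<longlongrightarrow> 0) at_infinity \<and>
     (deriv_blinfun (deriv_blinfun f) \<longlongrightarrow> 0) at_infinity}"

definition C2_norm :: "('a::euclidean_space \<Rightarrow> 'a) \<Rightarrow> real"
  where "C2_norm f =
     (SUP x. norm (f x) + norm (deriv_blinfun f x) + norm (deriv_blinfun (deriv_blinfun f) x))"

text \<open>The Hilbert space \<open>V\<close> of vector fields is an arbitrary Hilbert space type \<open>'v\<close> together
  with a linear injection \<open>ev\<close> which sends an element of \<open>V\<close> to the vector field that it is.\<close>

definition vector_field_space ::
    "('v::{real_inner,complete_space} \<Rightarrow> real^'n \<Rightarrow> real^'n) \<Rightarrow> bool"
  where "vector_field_space ev \<longleftrightarrow>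
     (\<forall>a b v w x. ev (a *\<^sub>R v + b *\<^sub>R w) x = a *\<^sub>R ev v x + b *\<^sub>R ev w x) \<and>
     inj ev \<and>
     range ev \<subseteq> C2_vanishing \<and>
     (\<exists>C. \<forall>v. C2_norm (ev v) \<le> C * norm v)"

definition reproducing_kernel ::
    "('v::{real_inner,complete_space} \<Rightarrow> real^'n \<Rightarrow> real^'n) \<Rightarrow>
     (real^'n \<Rightarrow> real^'n \<Rightarrow> real^'n^'n) \<Rightarrow> bool"
  where "reproducing_kernel ev K \<longleftrightarrow>
     (\<forall>x a. \<exists>k. (\<forall>y. ev k y = K y x *v a) \<and> (\<forall>v. v \<bullet> k = ev v x \<bullet> a))"

section \<open>Controls and flows\<close>

text \<open>A Hilbert space that is continuously embedded in the \<open>C\<^sup>2\<close> fields vanishing at infinity is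
  separable (its point evaluations at a countable dense set of points separate its elements), so
  that Borel measurability of a \<open>V\<close>-valued control coincides with Bochner measurability.\<close>

definition L2_unit_interval :: "(real \<Rightarrow> 'b::real_normed_vector) set"
  where "L2_unit_interval = {f \<in> borel_measurable (lebesgue_on {0..1}).
     integrable (lebesgue_on {0..1}) (\<lambda>t. (norm (f t))\<^sup>2)}"

text \<open>As \<open>v\<close> is only square integrable in time, the flow equation is understood for absolutely
  continuous curves, that is, in integrated form.\<close>

definition is_flow ::
    "('v \<Rightarrow> real^'n \<Rightarrow> real^'n) \<Rightarrow> (real \<Rightarrow> 'v) \<Rightarrow> (real \<Rightarrow> real^'n \<Rightarrow> real^'n) \<Rightarrow> bool"
  where "is_flow ev v \<phi> \<longleftrightarrow>
     (\<forall>x. \<forall>t\<in>{0..1}. integrable (lebesgue_on {0..t}) (\<lambda>s. ev (v s) (\<phi> s x)) \<and>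
        \<phi> t x = x + integral\<^sup>L (lebesgue_on {0..t}) (\<lambda>s. ev (v s) (\<phi> s x)))"

definition weight :: "(real \<Rightarrow> real) \<Rightarrow> real \<Rightarrow> real"
  where "weight \<eta> t = 1 + 1/2 * integral\<^sup>L (lebesgue_on {0..t}) \<eta>"

section \<open>Dirac varifolds\<close>

definition varifold_space :: "((real^'n) \<times> (real^'n)) measure"
  where "varifold_space = restrict_space borel (UNIV \<times> sphere 0 1)"

text \<open>For \<open>r = 0\<close> this is the zero varifold, whatever \<open>x\<close> and \<open>u\<close> are.\<close>

definition dirac_varifold :: "real \<Rightarrow> real^'n \<Rightarrow> real^'n \<Rightarrow> ((real^'n) \<times> (real^'n)) measure"
  where "dirac_varifold r x u = scale_measure (ennreal r) (return varifold_space (x, u))"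

definition push_dirac ::
    "(real^'n \<Rightarrow> real^'n) \<Rightarrow> real \<Rightarrow> real^'n \<Rightarrow> real^'n \<Rightarrow> ((real^'n) \<times> (real^'n)) measure"
  where "push_dirac f r x u =
     (let w = frechet_derivative f (at x) u
      in dirac_varifold (r * norm w) (f x) (w /\<^sub>R norm w))"

section \<open>The LDDMM-Fisher-Rao distance from a Dirac varifold\<close>

definition varifold_path ::
    "real \<Rightarrow> real^'n \<Rightarrow> real^'n \<Rightarrow> (real \<Rightarrow> real) \<Rightarrow> (real \<Rightarrow> real^'n \<Rightarrow> real^'n) \<Rightarrow>
     real \<Rightarrow> ((real^'n) \<times> (real^'n)) measure"
  where "varifold_path r0 x0 u0 \<eta> \<phi> t =
     scale_measure (ennreal ((weight \<eta> t)\<^sup>2)) (push_dirac (\<phi> t) r0 x0 u0)"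

text \<open>A control \<open>(v, \<eta>)\<close> is carried together with its flow \<open>\<phi>\<close>, which \<open>v\<close> determines uniquely on
  the time interval \<open>[0,1]\<close>.\<close>

definition admissible ::
    "('v::{real_inner,complete_space} \<Rightarrow> real^'n \<Rightarrow> real^'n) \<Rightarrow>
     real \<Rightarrow> real^'n \<Rightarrow> real^'n \<Rightarrow> ((real^'n) \<times> (real^'n)) measure \<Rightarrow>
     ((real \<Rightarrow> 'v) \<times> (real \<Rightarrow> real) \<times> (real \<Rightarrow> real^'n \<Rightarrow> real^'n)) set"
  where "admissible ev r0 x0 u0 \<mu>1 = {(v, \<eta>, \<phi>).
     v \<in> L2_unit_interval \<and> \<eta> \<in> L2_unit_interval \<and> is_flow ev v \<phi> \<and>
     (\<forall>t\<in>{0..1}. 0 \<le> weight \<eta> t) \<and>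
     varifold_path r0 x0 u0 \<eta> \<phi> 1 = \<mu>1}"

definition energy ::
    "real \<Rightarrow> real \<Rightarrow> real^'n \<Rightarrow> real^'n \<Rightarrow>
     (real \<Rightarrow> 'v::real_normed_vector) \<times> (real \<Rightarrow> real) \<times> (real \<Rightarrow> real^'n \<Rightarrow> real^'n) \<Rightarrow> real"
  where "energy \<gamma> r0 x0 u0 = (\<lambda>(v, \<eta>, \<phi>).
     1/2 * (\<integral>t. (norm (v t))\<^sup>2 \<partial>lebesgue_on {0..1}) +
     \<gamma>/2 * (\<integral>t. (\<eta> t)\<^sup>2 * norm (frechet_derivative (\<phi> t) (at x0) u0) * r0 \<partial>lebesgue_on {0..1}))"

definition lddmm_fr_sqdist ::
    "('v::{real_inner,complete_space} \<Rightarrow> real^'n \<Rightarrow> real^'n) \<Rightarrow> real \<Rightarrow>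
     real \<Rightarrow> real^'n \<Rightarrow> real^'n \<Rightarrow> ((real^'n) \<times> (real^'n)) measure \<Rightarrow> ereal"
  where "lddmm_fr_sqdist ev \<gamma> r0 x0 u0 \<mu>1 =
     (INF c \<in> admissible ev r0 x0 u0 \<mu>1. ereal (energy \<gamma> r0 x0 u0 c))"

definition lddmm_fr_geodesic ::
    "('v::{real_inner,complete_space} \<Rightarrow> real^'n \<Rightarrow> real^'n) \<Rightarrow> real \<Rightarrow>
     real \<Rightarrow> real^'n \<Rightarrow> real^'n \<Rightarrow> ((real^'n) \<times> (real^'n)) measure \<Rightarrow>
     (real \<Rightarrow> ((real^'n) \<times> (real^'n)) measure) \<Rightarrow> bool"
  where "lddmm_fr_geodesic ev \<gamma> r0 x0 u0 \<mu>1 \<mu> \<longleftrightarrow>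
     (\<exists>v \<eta> \<phi>. (v, \<eta>, \<phi>) \<in> admissible ev r0 x0 u0 \<mu>1 \<and>
        (\<forall>c \<in> admissible ev r0 x0 u0 \<mu>1. energy \<gamma> r0 x0 u0 (v, \<eta>, \<phi>) \<le> energy \<gamma> r0 x0 u0 c) \<and>
        (\<forall>t\<in>{0..1}. \<mu> t = varifold_path r0 x0 u0 \<eta> \<phi> t))"

end

theory Submission
  imports Defs
begin

text \<open>A field \<open>v\<close> with \<open>v(x) = a\<close> and \<open>dv(x)u = b\<close>, \<open>\<bar>u\<bar> = 1\<close>, has squared norm at least
  \<open>\<bar>a\<bar>\<^sup>2 + \<tau> \<bar>b\<bar>\<^sup>2\<close>, because the representers of the two functionals are orthogonal in \<open>V\<close>. Hence the
  energy is bounded below by that of a curve in the product of Euclidean space (the point), the sphere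
  (the direction) and a hyperbolic half-plane (weight and length of the transported vector). Admissible
  end points are known only up to a ray in the half-plane, and the distance to a ray is the increment of
  a single coordinate, \<open>arsinh\<close> of a multiple of the square root of the mass. The fields of
  minimal norm turn the geodesics of the product into controls that attain the bound. Applying the
  bound on \<open>[0,t]\<close> and on \<open>[t,1]\<close> determines a minimizer at time \<open>t\<close>.\<close>

section \<open>Absolutely continuous curves\<close>

text \<open>Origin of the half-plane: let z be the weight, \<open>y = 1 / sqrt |w|\<close> for the
  transported vector w, and p the logarithmic derivative of |w|. Then
  \<open>y' / y = - p / 2\<close> and \<open>z' = \<eta> / 2\<close>. With
  \<open>\<tau> * c\<^sup>2 = \<gamma> * r0\<close>, the cost
  \<open>\<gamma> * r0 * |w| * \<eta>\<^sup>2 + \<tau> * p\<^sup>2\<close> equals 4 \<tau> times the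
  squared hyperbolic speed of (c z, y), which starts at (c, 1). The mass
  \<open>r0 * z\<^sup>2 * |w|\<close> is a function of z / y alone; this is why the target is a ray
  and why arsinh (c z / y), whose hyperbolic gradient has length one, measures the distance to it.
  For the same reason the weight and the length of a minimizer need not be determined separately.
  The mass gives only the square of z / y, and the constraint of a nonnegative weight selects the
  sign. The shape of the analytic part comes from controls that are merely square integrable in
  time: curves have no derivative at a given time, so everything is stated with integrals, and the
  spatial derivative of the flow must be obtained from bounds that are integrable in time.\<close>

lemma integrable_on_Icc_subset:
  fixes f :: "real \<Rightarrow> 'a::banach"
  assumes "f integrable_on {a..b}" "a \<le> s" "t \<le> b"
  shows "f integrable_on {s..t}"
  by (rule integrable_subinterval_real[OF assms(1)]) (use assms in auto)

text \<open>Absolute continuity in integrated form. The derivative \<open>g'\<close> is carried as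
  data and enters through its integrals, so that no statement about differentiability at almost
  every time is required.\<close>

definition primitive_on :: "(real \<Rightarrow> 'a::euclidean_space) \<Rightarrow> (real \<Rightarrow> 'a) \<Rightarrow> real \<Rightarrow> real \<Rightarrow> bool"
  where "primitive_on g g' a b \<longleftrightarrow>
    g' absolutely_integrable_on {a..b} \<and> (\<forall>t\<in>{a..b}. g t = g a + integral {a..t} g')"

lemma primitive_on_absolutely_integrable:
  "primitive_on g g' a b \<Longrightarrow> g' absolutely_integrable_on {a..b}"
  unfolding primitive_on_def by blast

lemma primitive_on_integrable:
  assumes "primitive_on g g' a b"
  shows "g' integrable_on {a..b}" "(\<lambda>s. norm (g' s)) integrable_on {a..b}"
  using primitive_on_absolutely_integrable[OF assms] by (auto simp: absolutely_integrable_on_def)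

lemma primitive_on_eq:
  "primitive_on g g' a b \<Longrightarrow> t \<in> {a..b} \<Longrightarrow> g t = g a + integral {a..t} g'"
  unfolding primitive_on_def by blast

lemma primitive_onI:
  assumes "g' absolutely_integrable_on {a..b}"
    and "\<And>t. t \<in> {a..b} \<Longrightarrow> g t = g a + integral {a..t} g'"
  shows "primitive_on g g' a b"
  using assms unfolding primitive_on_def by blast

lemma primitive_on_cong:
  assumes P: "primitive_on g g' a b"
    and "\<And>t. t \<in> {a..b} \<Longrightarrow> h t = g t" "\<And>t. t \<in> {a..b} \<Longrightarrow> h' t = g' t"
  shows "primitive_on h h' a b"
proof (rule primitive_onI)
  show "h' absolutely_integrable_on {a..b}"
    by (rule absolutely_integrable_spike[OF primitive_on_absolutely_integrable[OF P] negligible_empty])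
      (use assms in auto)
  show "h t = h a + integral {a..t} h'" if t: "t \<in> {a..b}" for t
  proof -
    have "integral {a..t} h' = integral {a..t} g'"
      by (rule integral_cong) (use assms t in auto)
    then show ?thesis
      using primitive_on_eq[OF P t] assms(2)[OF t] assms(2)[of a] t by simp
  qed
qed

lemma primitive_on_increment:
  assumes "primitive_on g g' a b" "a \<le> s" "s \<le> t" "t \<le> b"
  shows "integral {s..t} g' = g t - g s"
proof -
  have "g' integrable_on {a..t}"
    by (rule integrable_on_Icc_subset[OF primitive_on_integrable(1)[OF assms(1)]]) (use assms in auto)
  then have "integral {a..s} g' + integral {s..t} g' = integral {a..t} g'"
    using assms by (intro Henstock_Kurzweil_Integration.integral_combine) auto
  then have "integral {s..t} g' = integral {a..t} g' - integral {a..s} g'"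
    by (simp add: eq_diff_eq add.commute)
  moreover have "g s = g a + integral {a..s} g'" "g t = g a + integral {a..t} g'"
    using assms by (auto intro!: primitive_on_eq[OF assms(1)])
  ultimately show ?thesis by simp
qed

lemma primitive_on_continuous:
  assumes "primitive_on g g' a b"
  shows "continuous_on {a..b} g"
proof -
  have "continuous_on {a..b} (\<lambda>t. g a + integral {a..t} g')"
    by (rule continuous_on_add[OF continuous_on_const
          indefinite_integral_continuous_1[OF primitive_on_integrable(1)[OF assms]]])
  moreover have "continuous_on {a..b} (\<lambda>t. g a + integral {a..t} g') = continuous_on {a..b} g"
    by (rule continuous_on_cong[OF refl primitive_on_eq[OF assms, symmetric]])
  ultimately show ?thesis by (rule rev_iffD1)
qed

lemma primitive_on_norm_increment:
  assumes "primitive_on g g' a b" "a \<le> s" "s \<le> t" "t \<le> b"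
  shows "norm (g t - g s) \<le> integral {s..t} (\<lambda>r. norm (g' r))"
proof -
  have "g' integrable_on {s..t}" "(\<lambda>r. norm (g' r)) integrable_on {s..t}"
    by (rule integrable_on_Icc_subset[OF primitive_on_integrable(1)[OF assms(1)] assms(2,4)],
        rule integrable_on_Icc_subset[OF primitive_on_integrable(2)[OF assms(1)] assms(2,4)])
  then have "norm (integral {s..t} g') \<le> integral {s..t} (\<lambda>r. norm (g' r))"
    by (intro integral_norm_bound_integral) auto
  then show ?thesis
    using primitive_on_increment[OF assms] by simp
qed

lemma primitive_on_C1:
  fixes g :: "real \<Rightarrow> 'a::euclidean_space"
  assumes "\<And>t. (g has_vector_derivative g' t) (at t)" "continuous_on {a..b} g'"
  shows "primitive_on g g' a b"
proof (rule primitive_onI)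
  show "g' absolutely_integrable_on {a..b}"
    using assms(2) by (rule absolutely_integrable_continuous_real)
  show "g t = g a + integral {a..t} g'" if t: "t \<in> {a..b}" for t
  proof -
    have "(g' has_integral (g t - g a)) {a..t}"
      using t assms(1) by (intro fundamental_theorem_of_calculus) (auto intro: has_vector_derivative_at_within)
    then show ?thesis by (simp add: integral_unique)
  qed
qed

lemma primitive_on_Pair:
  fixes g :: "real \<Rightarrow> 'a::euclidean_space" and h :: "real \<Rightarrow> 'b::euclidean_space"
  assumes "primitive_on g g' a b" "primitive_on h h' a b"
  shows "primitive_on (\<lambda>t. (g t, h t)) (\<lambda>t. (g' t, h' t)) a b"
proof -
  have "bounded_linear (\<lambda>x::'a. (x, 0::'b))" "bounded_linear (\<lambda>y::'b. (0::'a, y))"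
    by (auto intro!: bounded_linear_Pair bounded_linear_ident bounded_linear_zero)
  note lin = this
  have ai: "(\<lambda>t. (g' t, 0::'b)) absolutely_integrable_on {a..b}"
      "(\<lambda>t. (0::'a, h' t)) absolutely_integrable_on {a..b}"
    by (rule absolutely_integrable_linear[unfolded o_def,
            OF primitive_on_absolutely_integrable[OF assms(1)] lin(1)],
        rule absolutely_integrable_linear[unfolded o_def,
            OF primitive_on_absolutely_integrable[OF assms(2)] lin(2)])
  have "(\<lambda>t. (g' t, h' t)) absolutely_integrable_on {a..b}"
    using set_integral_add(1)[OF ai] by simp
  moreover have "(g t, h t) = (g a, h a) + integral {a..t} (\<lambda>t. (g' t, h' t))" if t: "t \<in> {a..b}" for t
  proof -
    have "g' integrable_on {a..t}" "h' integrable_on {a..t}"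
      by (rule integrable_on_Icc_subset[OF primitive_on_integrable(1)[OF assms(1)]],
          use t in simp_all, rule integrable_on_Icc_subset[OF primitive_on_integrable(1)[OF assms(2)]],
          use t in simp_all)
    then have "((\<lambda>t. (g' t, h' t)) has_integral (integral {a..t} g', integral {a..t} h')) {a..t}"
      using has_integral_add[OF has_integral_linear[OF integrable_integral lin(1)]
          has_integral_linear[OF integrable_integral lin(2)]] by (simp add: o_def)
    then show ?thesis
      using primitive_on_eq[OF assms(1) t] primitive_on_eq[OF assms(2) t] by (simp add: integral_unique)
  qed
  ultimately show ?thesis
    by (rule primitive_onI)
qed

lemma absolutely_integrable_continuous_scaleR:
  fixes f :: "real \<Rightarrow> 'b::euclidean_space" and l :: "real \<Rightarrow> real"
  assumes "continuous_on {a..b} f" "l absolutely_integrable_on {a..b}"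
  shows "(\<lambda>s. l s *\<^sub>R f s) absolutely_integrable_on {a..b}"
proof -
  have "bilinear (\<lambda>(x::'b) (c::real). c *\<^sub>R x)"
    by (auto simp: bilinear_def linear_iff algebra_simps)
  moreover have "f \<in> borel_measurable (lebesgue_on {a..b})"
    by (intro continuous_imp_measurable_on_sets_lebesgue assms) auto
  moreover have "bounded (f ` {a..b})"
    by (intro compact_imp_bounded compact_continuous_image assms) auto
  ultimately show ?thesis
    using absolutely_integrable_bounded_measurable_product[of "\<lambda>x c. c *\<^sub>R x" f "{a..b}" l] assms by auto
qed

text \<open>A bisection argument replaces differentiation almost everywhere: the defect of the chain rule
  is additive over adjacent intervals and, near each point, at most \<open>e\<close> times the length.\<close>

theorem primitive_on_chain:
  fixes g :: "real \<Rightarrow> 'a::euclidean_space" and F :: "'a \<Rightarrow> 'b::euclidean_space"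
  assumes g: "primitive_on g g' a b" and ab: "a \<le> b"
    and U: "open U" "g ` {a..b} \<subseteq> U"
    and F: "\<And>y. y \<in> U \<Longrightarrow> (F has_derivative F' y) (at y)"
    and F': "\<And>h. h \<in> Basis \<Longrightarrow> continuous_on U (\<lambda>y. F' y h)"
  shows "primitive_on (\<lambda>t. F (g t)) (\<lambda>t. F' (g t) (g' t)) a b"
proof -
  have lin: "bounded_linear (F' y)" if "y \<in> U" for y
    using F[OF that] by (rule has_derivative_bounded_linear)
  \<comment> \<open>As a bounded linear function the derivative is continuous in operator norm,
    which in finite dimension follows from continuity of its values on the basis.\<close>
  define Fb where "Fb y = Blinfun (F' y)" for y
  have Fb: "blinfun_apply (Fb y) = F' y" if "y \<in> U" for y
    using lin[OF that] by (simp add: Fb_def bounded_linear_Blinfun_apply)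
  have Fb_cont: "continuous_on U Fb"
    using F' by (intro continuous_on_blinfun_componentwise) (simp add: Fb)
  have gU: "g s \<in> U" if "s \<in> {a..b}" for s
    using U(2) that by auto
  have gc: "continuous_on {a..b} g"
    using g by (rule primitive_on_continuous)
  have g'_ai: "g' absolutely_integrable_on {a..b}"
    using g by (rule primitive_on_absolutely_integrable)
  \<comment> \<open>In coordinates the integrand is a sum of integrable functions times continuous
    ones; this yields its measurability and integrability.\<close>
  have sum_ai: "(\<lambda>s. \<Sum>i\<in>Basis. (g' s \<bullet> i) *\<^sub>R F' (g s) i) absolutely_integrable_on {a..b}"
  proof (intro absolutely_integrable_sum finite_Basis absolutely_integrable_continuous_scaleR)
    fix i :: 'a assume i: "i \<in> Basis"
    show "continuous_on {a..b} (\<lambda>s. F' (g s) i)"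
      using continuous_on_compose2[OF F'[OF i] gc] U(2) by auto
    show "(\<lambda>s. g' s \<bullet> i) absolutely_integrable_on {a..b}"
      using g'_ai i by (simp add: absolutely_integrable_component)
  qed
  have sum_eq: "F' (g s) (g' s) = (\<Sum>i\<in>Basis. (g' s \<bullet> i) *\<^sub>R F' (g s) i)" if "s \<in> {a..b} - {}" for s
  proof -
    have "F' (g s) (\<Sum>i\<in>Basis. (g' s \<bullet> i) *\<^sub>R i) = (\<Sum>i\<in>Basis. (g' s \<bullet> i) *\<^sub>R F' (g s) i)"
      using lin[OF gU] that by (simp add: linear_sum linear_scale bounded_linear.linear)
    then show ?thesis by (simp only: euclidean_representation)
  qed
  have ai: "(\<lambda>s. F' (g s) (g' s)) absolutely_integrable_on {a..b}"
    by (rule absolutely_integrable_spike[OF sum_ai negligible_empty sum_eq])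
  note int = primitive_on_integrable[OF g]
  have intF: "(\<lambda>s. F' (g s) (g' s)) integrable_on {a..b}"
    using ai by (simp add: absolutely_integrable_on_def)
  define D where "D s t = F (g t) - F (g s) - integral {s..t} (\<lambda>r. F' (g r) (g' r))" for s t
  have D_small: "norm (D s t) \<le> e * integral {s..t} (\<lambda>r. norm (g' r))"
    if e: "e > 0" and "a \<le> s" "s \<le> t" "t \<le> b" for e s t
  proof -
    define P where "P s t \<longleftrightarrow> (a \<le> s \<and> s \<le> t \<and> t \<le> b \<longrightarrow>
      norm (D s t) \<le> e * integral {s..t} (\<lambda>r. norm (g' r)))" for s t
    have "s \<le> t" by fact
    then have "P s t"
    proof (induction s t rule: Bolzano)
      case (trans s q t)
      show ?case
        unfolding P_def
      proof safe
        assume st: "a \<le> s" "s \<le> t" "t \<le> b"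
        have "D s t = D s q + D q t"
          unfolding D_def
          using Henstock_Kurzweil_Integration.integral_combine[OF trans(3,4) integrable_on_Icc_subset[OF intF]] st by (auto simp: algebra_simps)
        then have "norm (D s t) \<le> norm (D s q) + norm (D q t)"
          by (simp add: norm_triangle_ineq)
        also have "\<dots> \<le> e * (integral {s..q} (\<lambda>r. norm (g' r)) + integral {q..t} (\<lambda>r. norm (g' r)))"
          using trans st by (auto simp: P_def algebra_simps)
        also have "\<dots> = e * integral {s..t} (\<lambda>r. norm (g' r))"
          using Henstock_Kurzweil_Integration.integral_combine[OF trans(3,4) integrable_on_Icc_subset[OF int(2)]] st by auto
        finally show "norm (D s t) \<le> e * integral {s..t} (\<lambda>r. norm (g' r))" .
      qed
    next
      case (local x)
      then have x: "x \<in> {a..b}" using that by auto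
      obtain r1 where r1: "r1 > 0" "ball (g x) r1 \<subseteq> U"
        using U(1) gU[OF x] by (auto simp: open_contains_ball)
      \<comment> \<open>Half of \<open>e\<close> pays for the linearization of \<open>F\<close> at
        \<open>g x\<close>, the other half for replacing \<open>F' (g r)\<close> by
        \<open>F' (g x)\<close> under the integral.\<close>
      obtain r2 where r2: "r2 > 0" "\<And>y. y \<in> U \<Longrightarrow> dist y (g x) < r2 \<Longrightarrow> dist (Fb y) (Fb (g x)) < e / 2"
        using Fb_cont gU[OF x] e unfolding continuous_on_iff by (metis half_gt_zero)
      define r where "r = min r1 r2"
      have r: "r > 0" "ball (g x) r \<subseteq> U" using r1 r2 by (auto simp: r_def)
      have Fr: "norm (Fb y - Fb (g x)) \<le> e / 2" if "y \<in> ball (g x) r" for y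
      proof -
        have "dist (Fb y) (Fb (g x)) < e / 2"
          by (rule r2(2)) (use that r in \<open>auto simp: r_def dist_commute\<close>)
        then show ?thesis by (simp add: dist_norm)
      qed
      obtain d where d: "d > 0" "\<And>s. s \<in> {a..b} \<Longrightarrow> dist s x < d \<Longrightarrow> dist (g s) (g x) < r"
        using gc x r(1) unfolding continuous_on_iff by metis
      have "P s t" if st: "s \<le> x" "x \<le> t" "t - s < d" for s t
        unfolding P_def
      proof safe
        assume ab': "a \<le> s" "s \<le> t" "t \<le> b"
        have near: "g q \<in> ball (g x) r" if "q \<in> {s..t}" for q
          using d(2)[of q] that st ab' by (auto simp: dist_real_def dist_commute)
        have "norm (F (g t) - F (g s) - F' (g x) (g t - g s)) \<le> norm (g t - g s) * (e / 2)"
        proof (rule differentiable_bound_linearization[where S = "ball (g x) r" and f' = F'])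
          show "g s + q *\<^sub>R (g t - g s) \<in> ball (g x) r" if "q \<in> {0..1}" for q
            using convexD_alt[OF convex_ball near near, of s t q] that st
            by (auto simp: algebra_simps)
          show "(F has_derivative F' y) (at y within ball (g x) r)" if "y \<in> ball (g x) r" for y
            using F r that by (meson has_derivative_at_withinI subsetD)
          show "onorm (F' y - F' (g x)) \<le> e / 2" if "y \<in> ball (g x) r" for y
          proof -
            have "norm (Fb y - Fb (g x)) = onorm (\<lambda>v. F' y v - F' (g x) v)"
              using Fb r(2) that gU[OF x] by (simp add: norm_blinfun.rep_eq minus_blinfun.rep_eq subset_iff)
            then show ?thesis using Fr[OF that] by (simp add: fun_diff_def)
          qed
          show "g x \<in> ball (g x) r" using r by simp
        qed
        also have "\<dots> \<le> e / 2 * integral {s..t} (\<lambda>r. norm (g' r))"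
          using primitive_on_norm_increment[OF g ab'] e by (simp add: mult.commute)
        finally have 1: "norm (F (g t) - F (g s) - F' (g x) (g t - g s)) \<le> e / 2 * integral {s..t} (\<lambda>r. norm (g' r))" .
        have lin_int: "((\<lambda>r. F' (g x) (g' r)) has_integral F' (g x) (g t - g s)) {s..t}"
          using has_integral_linear[OF integrable_integral[OF integrable_on_Icc_subset[OF int(1) ab'(1,3)]] lin[OF gU[OF x]]]
            primitive_on_increment[OF g ab'] by (simp add: o_def)
        then have "((\<lambda>r. F' (g x) (g' r) - F' (g r) (g' r)) has_integral
            F' (g x) (g t - g s) - integral {s..t} (\<lambda>r. F' (g r) (g' r))) {s..t}"
          by (intro has_integral_diff integrable_integral integrable_on_Icc_subset[OF intF]) (use ab' in auto)
        then have "norm (F' (g x) (g t - g s) - integral {s..t} (\<lambda>r. F' (g r) (g' r)))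
            \<le> integral {s..t} (\<lambda>r. e / 2 * norm (g' r))"
        proof (subst integral_unique[symmetric], assumption, intro integral_norm_bound_integral)
          show "(\<lambda>r. e / 2 * norm (g' r)) integrable_on {s..t}"
            using integrable_on_Icc_subset[OF int(2) ab'(1,3)] by (rule integrable_on_mult_right)
          show "norm (F' (g x) (g' r) - F' (g r) (g' r)) \<le> e / 2 * norm (g' r)" if "r \<in> {s..t}" for r
          proof -
            have "norm (blinfun_apply (Fb (g r) - Fb (g x)) (g' r)) \<le> norm (Fb (g r) - Fb (g x)) * norm (g' r)"
              by (rule norm_blinfun)
            also have "\<dots> \<le> e / 2 * norm (g' r)"
              using Fr[OF near[OF that]] by (intro mult_right_mono) auto
            finally show ?thesis
              using Fb[OF gU[OF x]] Fb[OF gU[of r]] that ab'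
              by (simp add: minus_blinfun.rep_eq norm_minus_commute)
          qed
        qed auto
        then have 2: "norm (F' (g x) (g t - g s) - integral {s..t} (\<lambda>r. F' (g r) (g' r)))
            \<le> e / 2 * integral {s..t} (\<lambda>r. norm (g' r))"
          by simp
        have D_eq: "D s t = (F (g t) - F (g s) - F' (g x) (g t - g s)) +
            (F' (g x) (g t - g s) - integral {s..t} (\<lambda>r. F' (g r) (g' r)))"
          by (simp add: D_def)
        have "norm (D s t) \<le> e / 2 * integral {s..t} (\<lambda>r. norm (g' r)) + e / 2 * integral {s..t} (\<lambda>r. norm (g' r))"
          unfolding D_eq by (rule norm_triangle_le[OF add_mono[OF 1 2]])
        then show "norm (D s t) \<le> e * integral {s..t} (\<lambda>r. norm (g' r))"
          by simp
      qed
      then show ?case using d(1) by blast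
    qed
    then show ?thesis using that by (simp add: P_def)
  qed
  have D_0: "D a t = 0" if "t \<in> {a..b}" for t
  proof -
    let ?N = "integral {a..t} (\<lambda>r. norm (g' r))"
    have "?N \<ge> 0"
      by (rule integral_nonneg, rule integrable_on_Icc_subset[OF int(2)]) (use that in auto)
    have "norm (D a t) \<le> 0"
    proof (rule field_le_epsilon)
      fix e :: real assume "e > 0"
      then have "norm (D a t) \<le> e / (?N + 1) * ?N"
        using \<open>?N \<ge> 0\<close> that by (intro D_small) auto
      also have "\<dots> \<le> e"
        using \<open>?N \<ge> 0\<close> \<open>e > 0\<close> by (simp add: field_simps)
      finally show "norm (D a t) \<le> 0 + e" by simp
    qed
    then show ?thesis by simp
  qed
  have "F (g t) = F (g a) + integral {a..t} (\<lambda>s. F' (g s) (g' s))" if "t \<in> {a..b}" for t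
    using D_0[OF that] unfolding D_def by (metis diff_diff_eq eq_iff_diff_eq_0)
  with ai show ?thesis by (rule primitive_onI)
qed

text \<open>The right-hand side, as a function of time, has a logarithmic derivative of at most
  \<open>l\<close>. The additional \<open>e\<close> keeps it positive when \<open>A = 0\<close>, so
  that the logarithm is available.\<close>

lemma gronwall:
  fixes f l :: "real \<Rightarrow> real"
  assumes f: "continuous_on {a..b} f" "\<And>t. t \<in> {a..b} \<Longrightarrow> 0 \<le> f t"
    and l: "l integrable_on {a..b}" "\<And>t. t \<in> {a..b} \<Longrightarrow> 0 \<le> l t"
    and le: "\<And>t. t \<in> {a..b} \<Longrightarrow> f t \<le> A + integral {a..t} (\<lambda>s. l s * f s)"
    and A: "0 \<le> A" and t: "t \<in> {a..b}"
  shows "f t \<le> A * exp (integral {a..t} l)"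
proof -
  have l_ai: "l absolutely_integrable_on {a..b}"
    using l by (rule nonnegative_absolutely_integrable_1)
  have ai: "(\<lambda>s. l s * f s) absolutely_integrable_on {a..b}"
    using absolutely_integrable_continuous_scaleR[OF f(1) l_ai] by simp
  have lt: "l integrable_on {a..t}"
    by (rule integrable_on_Icc_subset[OF l(1)]) (use t in auto)
  have bound: "f t \<le> (A + e) * exp (integral {a..t} l)" if e: "e > 0" for e
  proof -
    define G where "G t = A + e + integral {a..t} (\<lambda>s. l s * f s)" for t
    have G: "primitive_on G (\<lambda>s. l s * f s) a b"
      using ai by (rule primitive_onI) (simp add: G_def)
    have "0 \<le> integral {a..t} (\<lambda>s. l s * f s)" if "t \<in> {a..b}" for t
    proof (rule integral_nonneg)
      show "(\<lambda>s. l s * f s) integrable_on {a..t}"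
        by (rule integrable_on_Icc_subset[OF primitive_on_integrable(1)[OF G]]) (use that in auto)
    qed (use that f(2) l(2) in auto)
    then have G_pos: "G t > 0" if "t \<in> {a..b}" for t
      using that A e by (fastforce simp: G_def)
    have fG: "f t \<le> G t" if "t \<in> {a..b}" for t
      using le[OF that] e by (simp add: G_def)
    have chain: "primitive_on (\<lambda>t. ln (G t)) (\<lambda>t. (l t * f t) / G t) a b"
    proof (rule primitive_on_chain[OF G _ open_greaterThan[of 0], where F' = "\<lambda>y h. h / y"])
      show "(ln has_derivative (\<lambda>h. h / y)) (at y)" if "y \<in> {0<..}" for y :: real
        using that by (auto intro!: derivative_eq_intros simp: divide_inverse)
      show "continuous_on {0<..} (\<lambda>y. h / y)" for h :: real
        by (intro continuous_intros) auto
    qed (use t G_pos in auto)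
    have "ln (G t) - ln (G a) = integral {a..t} (\<lambda>t. (l t * f t) / G t)"
      using primitive_on_increment[OF chain, of a t] t by auto
    also have "\<dots> \<le> integral {a..t} l"
    proof (rule integral_le)
      show "(\<lambda>t. (l t * f t) / G t) integrable_on {a..t}"
        by (rule integrable_on_Icc_subset[OF primitive_on_integrable(1)[OF chain]]) (use t in auto)
      show "l s * f s / G s \<le> l s" if "s \<in> {a..t}" for s
        using that t fG[of s] G_pos[of s] l(2)[of s] by (auto simp: divide_le_eq mult_left_mono)
    qed fact
    finally have "ln (G t) \<le> ln (A + e) + integral {a..t} l" by (simp add: G_def)
    then have "exp (ln (G t)) \<le> exp (ln (A + e) + integral {a..t} l)" by simp
    then have "G t \<le> (A + e) * exp (integral {a..t} l)"
      using G_pos[OF t] A e by (simp add: exp_add)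
    then show ?thesis using fG[OF t] by simp
  qed
  show ?thesis
  proof (rule field_le_epsilon)
    fix e :: real assume "e > 0"
    then show "f t \<le> A * exp (integral {a..t} l) + e"
      using bound[of "e / exp (integral {a..t} l)"] by (simp add: distrib_right)
  qed
qed

lemma primitive_on_linear:
  fixes g :: "real \<Rightarrow> 'a::euclidean_space" and F :: "'a \<Rightarrow> 'b::euclidean_space"
  assumes "primitive_on g g' a b" "a \<le> b" "bounded_linear F"
  shows "primitive_on (\<lambda>t. F (g t)) (\<lambda>t. F (g' t)) a b"
  by (rule primitive_on_chain[OF assms(1,2) open_UNIV, where F' = "\<lambda>_. F"])
    (auto intro: bounded_linear_imp_has_derivative[OF assms(3)])

lemma primitive_on_diff:
  fixes g :: "real \<Rightarrow> 'a::euclidean_space"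
  assumes "primitive_on g g' a b" "primitive_on h h' a b" "a \<le> b"
  shows "primitive_on (\<lambda>t. g t - h t) (\<lambda>t. g' t - h' t) a b"
proof -
  have "bounded_linear (\<lambda>p::'a \<times> 'a. fst p - snd p)"
    by (intro bounded_linear_sub bounded_linear_fst bounded_linear_snd)
  from primitive_on_linear[OF primitive_on_Pair[OF assms(1,2)] assms(3) this]
  show ?thesis by simp
qed

lemma primitive_on_add:
  fixes g :: "real \<Rightarrow> 'a::euclidean_space"
  assumes "primitive_on g g' a b" "primitive_on h h' a b" "a \<le> b"
  shows "primitive_on (\<lambda>t. g t + h t) (\<lambda>t. g' t + h' t) a b"
proof -
  have "bounded_linear (\<lambda>p::'a \<times> 'a. fst p + snd p)"
    by (intro bounded_linear_add bounded_linear_fst bounded_linear_snd)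
  from primitive_on_linear[OF primitive_on_Pair[OF assms(1,2)] assms(3) this]
  show ?thesis by simp
qed

text \<open>The common form of the comparisons of curves below. With \<open>c = 0\<close> it gives
  uniqueness and Lipschitz dependence; otherwise \<open>c\<close> carries the size of a remainder,
  which for the linearization is of second order.\<close>

lemma gronwall_difference:
  fixes X Y :: "real \<Rightarrow> 'a::euclidean_space" and l :: "real \<Rightarrow> real"
  assumes X: "primitive_on X p 0 1" and Y: "primitive_on Y q 0 1"
    and l: "l integrable_on {0..1}" "\<And>s. 0 \<le> l s" and c: "0 \<le> c"
    and le: "\<And>s. s \<in> {0..1} \<Longrightarrow> norm (p s - q s) \<le> l s * norm (X s - Y s) + l s * c"
    and t: "t \<in> {0..1}"
  shows "norm (X t - Y t) \<le> (norm (X 0 - Y 0) + integral {0..1} l * c) * exp (integral {0..1} l)"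
proof -
  let ?L = "integral {0..1} l"
  have Z: "primitive_on (\<lambda>t. X t - Y t) (\<lambda>t. p t - q t) 0 1"
    by (rule primitive_on_diff[OF X Y]) simp
  have l_ai: "l absolutely_integrable_on {0..1}"
    using l by (intro nonnegative_absolutely_integrable_1)
  have cont: "continuous_on {0..1} (\<lambda>t. norm (X t - Y t))"
    by (rule continuous_on_norm[OF primitive_on_continuous[OF Z]])
  have lf: "(\<lambda>s. l s * norm (X s - Y s)) integrable_on {0..1}"
    using absolutely_integrable_continuous_scaleR[OF cont l_ai]
    by (simp add: absolutely_integrable_on_def)
  have lc: "(\<lambda>s. l s * c) integrable_on {0..1}"
    using l(1) by (rule integrable_on_mult_left)
  have l_mono: "integral {0..s} l \<le> ?L" if "s \<in> {0..1}" for s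
    by (rule integral_subset_le[OF _ integrable_on_Icc_subset[OF l(1)] l(1)]) (use that l(2) in auto)
  have "norm (X t - Y t) \<le> (norm (X 0 - Y 0) + ?L * c) * exp (integral {0..t} l)"
  proof (rule gronwall[OF cont _ l(1) _ _ _ t])
    fix s :: real assume s: "s \<in> {0..1}"
    have "norm (X s - Y s) \<le> norm (X 0 - Y 0) + norm ((X s - Y s) - (X 0 - Y 0))"
      by (rule norm_triangle_sub)
    also have "\<dots> \<le> norm (X 0 - Y 0) + integral {0..s} (\<lambda>s. norm (p s - q s))"
      using primitive_on_norm_increment[OF Z, of 0 s] s by auto
    also have "integral {0..s} (\<lambda>s. norm (p s - q s)) \<le> integral {0..s} (\<lambda>s. l s * norm (X s - Y s) + l s * c)"
      using s le by (intro integral_le integrable_add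
        integrable_on_Icc_subset[OF primitive_on_integrable(2)[OF Z]]
        integrable_on_Icc_subset[OF lf] integrable_on_Icc_subset[OF lc]) auto
    also have "\<dots> = integral {0..s} (\<lambda>s. l s * norm (X s - Y s)) + integral {0..s} l * c"
      using s by (subst integral_add) (auto intro: integrable_on_Icc_subset[OF lf] integrable_on_Icc_subset[OF lc])
    also have "integral {0..s} l * c \<le> ?L * c"
      using l_mono[OF s] c by (intro mult_right_mono)
    finally show "norm (X s - Y s) \<le> norm (X 0 - Y 0) + ?L * c + integral {0..s} (\<lambda>s. l s * norm (X s - Y s))"
      by simp
  qed (use l c in \<open>auto intro!: add_nonneg_nonneg mult_nonneg_nonneg integral_nonneg\<close>)
  also have "\<dots> \<le> (norm (X 0 - Y 0) + ?L * c) * exp ?L"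
    using l_mono[OF t] l c
    by (intro mult_left_mono add_nonneg_nonneg mult_nonneg_nonneg integral_nonneg) auto
  finally show ?thesis .
qed

section \<open>Differentiability of flows\<close>

text \<open>A single function \<open>l\<close>, integrable in time, controls all the bounds; for a
  control it will be a multiple of \<open>norm (v s)\<close>. The quadratic remainder in
  \<open>taylor\<close> is where the second derivatives of the fields enter.\<close>

locale regular_flow =
  fixes f :: "real \<Rightarrow> 'a::euclidean_space \<Rightarrow> 'a" and f' :: "real \<Rightarrow> 'a \<Rightarrow> 'a \<Rightarrow> 'a"
    and l :: "real \<Rightarrow> real" and \<phi> :: "real \<Rightarrow> 'a \<Rightarrow> 'a"
  assumes l_int: "l integrable_on {0..1}" and l_nonneg: "\<And>s. 0 \<le> l s"
    and lip: "\<And>s y z. norm (f s y - f s z) \<le> l s * norm (y - z)"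
    and f'_linear: "\<And>s y. linear (f' s y)"
    and f'_bound: "\<And>s y h. norm (f' s y h) \<le> l s * norm h"
    and taylor: "\<And>s y z. norm (f s z - f s y - f' s y (z - y)) \<le> l s * (norm (z - y))\<^sup>2"
    and flow: "\<And>x. primitive_on (\<lambda>t. \<phi> t x) (\<lambda>s. f s (\<phi> s x)) 0 1"
    and start: "\<And>x. \<phi> 0 x = x"
begin

abbreviation "\<Lambda> \<equiv> integral {0..1} l"
abbreviation "M \<equiv> exp \<Lambda>"

lemma \<Lambda>_nonneg: "0 \<le> \<Lambda>"
  using l_int l_nonneg by (intro integral_nonneg) auto

lemma flow_unique:
  assumes X: "primitive_on X (\<lambda>s. f s (X s)) 0 1" and t: "t \<in> {0..1}"
  shows "\<phi> t (X 0) = X t"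
proof -
  have "norm (\<phi> t (X 0) - X t) \<le> (norm (\<phi> 0 (X 0) - X 0) + \<Lambda> * 0) * M"
    by (rule gronwall_difference[OF flow X l_int l_nonneg _ _ t]) (use lip in auto)
  then show ?thesis by (simp add: start)
qed

lemma flow_lipschitz:
  assumes "t \<in> {0..1}"
  shows "norm (\<phi> t x - \<phi> t y) \<le> norm (x - y) * M"
proof -
  have "norm (\<phi> t x - \<phi> t y) \<le> (norm (\<phi> 0 x - \<phi> 0 y) + \<Lambda> * 0) * M"
    by (rule gronwall_difference[OF flow flow l_int l_nonneg _ _ assms]) (use lip in auto)
  then show ?thesis by (simp add: start)
qed

lemma linearized_unique:
  assumes "primitive_on w (\<lambda>s. f' s (\<phi> s x) (w s)) 0 1" "primitive_on z (\<lambda>s. f' s (\<phi> s x) (z s)) 0 1"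
    and "w 0 = z 0" "t \<in> {0..1}"
  shows "w t = z t"
proof -
  have "norm (w t - z t) \<le> (norm (w 0 - z 0) + \<Lambda> * 0) * M"
  proof (rule gronwall_difference[OF assms(1,2) l_int l_nonneg _ _ assms(4)])
    show "norm (f' s (\<phi> s x) (w s) - f' s (\<phi> s x) (z s)) \<le> l s * norm (w s - z s) + l s * 0" for s
      using f'_bound[of s "\<phi> s x" "w s - z s"] linear_diff[OF f'_linear] by simp
  qed simp
  then show ?thesis using assms(3) by simp
qed

text \<open>The increment of the flow solves the linearized equation up to a Taylor remainder, which
  is quadratic in \<open>k\<close> because the flow is Lipschitz; the comparison preserves the
  order.\<close>

lemma linearized_error:
  assumes w: "primitive_on w (\<lambda>s. f' s (\<phi> s x) (w s)) 0 1" and w0: "w 0 = k" and t: "t \<in> {0..1}"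
  shows "norm (\<phi> t (x + k) - \<phi> t x - w t) \<le> \<Lambda> * (norm k * M)\<^sup>2 * M"
proof -
  have "primitive_on (\<lambda>s. \<phi> s (x + k) - \<phi> s x) (\<lambda>s. f s (\<phi> s (x + k)) - f s (\<phi> s x)) 0 1"
    by (rule primitive_on_diff[OF flow flow]) simp
  then have "norm ((\<phi> t (x + k) - \<phi> t x) - w t)
      \<le> (norm ((\<phi> 0 (x + k) - \<phi> 0 x) - w 0) + \<Lambda> * (norm k * M)\<^sup>2) * M"
  proof (rule gronwall_difference[OF _ w l_int l_nonneg _ _ t])
    fix s :: real assume s: "s \<in> {0..1}"
    let ?y = "\<phi> s (x + k)" and ?x = "\<phi> s x"
    have "norm (?y - ?x) \<le> norm k * M"
      using flow_lipschitz[OF s, of "x + k" x] by simp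
    then have "(norm (?y - ?x))\<^sup>2 \<le> (norm k * M)\<^sup>2"
      by (rule power_mono) simp
    then have 1: "l s * (norm (?y - ?x))\<^sup>2 \<le> l s * (norm k * M)\<^sup>2"
      using l_nonneg by (rule mult_left_mono)
    have "f s ?y - f s ?x - f' s ?x (w s) = f' s ?x (?y - ?x - w s) + (f s ?y - f s ?x - f' s ?x (?y - ?x))"
      by (simp add: linear_diff[OF f'_linear])
    also have "norm \<dots> \<le> l s * norm (?y - ?x - w s) + l s * (norm (?y - ?x))\<^sup>2"
      by (rule norm_triangle_le[OF add_mono[OF f'_bound taylor]])
    finally show "norm (f s ?y - f s ?x - f' s ?x (w s))
        \<le> l s * norm (?y - ?x - w s) + l s * (norm k * M)\<^sup>2"
      using 1 by simp
  qed simp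
  then show ?thesis by (simp add: start w0)
qed

text \<open>The solution of the linearized equation is the limit of the difference quotients of the flow.
  This takes the place of an existence theorem for linear equations, and it provides the
  measurability of the right-hand side, which is a limit of integrable functions.\<close>

lemma linearized_exists:
  "\<exists>w. w 0 = k \<and> primitive_on w (\<lambda>s. f' s (\<phi> s x) (w s)) 0 1"
proof -
  define h where "h n = inverse (real (Suc n))" for n
  have h_pos: "h n > 0" for n by (simp add: h_def)
  have h_lim: "h \<longlonglongrightarrow> 0" unfolding h_def by (rule LIMSEQ_inverse_real_of_nat)
  define D where "D n t = (\<phi> t (x + h n *\<^sub>R k) - \<phi> t x) /\<^sub>R h n" for n t
  define G where "G n s = (f s (\<phi> s (x + h n *\<^sub>R k)) - f s (\<phi> s x)) /\<^sub>R h n" for n s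
  let ?c = "(norm k * M)\<^sup>2"
  have D: "primitive_on (D n) (G n) 0 1" for n
    unfolding D_def G_def
    by (rule primitive_on_linear[OF primitive_on_diff[OF flow flow] _ bounded_linear_scaleR_right]) auto
  have D_0: "D n 0 = k" for n
    using h_pos[of n] by (simp add: D_def start)
  have D_norm: "norm (\<phi> t (x + h n *\<^sub>R k) - \<phi> t x) = h n * norm (D n t)" for n t
    using h_pos[of n] by (simp add: D_def)
  have G_norm: "norm (f s (\<phi> s (x + h n *\<^sub>R k)) - f s (\<phi> s x)) = h n * norm (G n s)" for n s
    using h_pos[of n] by (simp add: G_def)
  have D_bound: "norm (D n t) \<le> norm k * M" if "t \<in> {0..1}" for n t
  proof -
    have "h n * norm (D n t) \<le> h n * (norm k * M)"
      using flow_lipschitz[OF that, of "x + h n *\<^sub>R k" x] h_pos[of n] by (simp add: D_norm mult_ac)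
    then show ?thesis using h_pos[of n] by simp
  qed
  have G_D: "norm (G n s - f' s (\<phi> s x) (D n s)) \<le> l s * (h n * ?c)" if s: "s \<in> {0..1}" for n s
  proof -
    let ?y = "\<phi> s (x + h n *\<^sub>R k)" and ?x = "\<phi> s x"
    have eq: "?y - ?x = h n *\<^sub>R D n s"
      using h_pos[of n] by (simp add: D_def)
    have "norm (?y - ?x) \<le> h n * (norm k * M)"
      unfolding eq using D_bound[OF s, of n] h_pos[of n] by simp
    then have "(norm (?y - ?x))\<^sup>2 \<le> (h n * (norm k * M))\<^sup>2"
      by (rule power_mono) simp
    then have 1: "l s * (norm (?y - ?x))\<^sup>2 \<le> l s * ((h n)\<^sup>2 * ?c)"
      using l_nonneg[of s] by (simp add: mult_left_mono power_mult_distrib)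
    have "G n s - f' s ?x (D n s) = (f s ?y - f s ?x - f' s ?x (?y - ?x)) /\<^sub>R h n"
      unfolding eq using h_pos[of n]
      by (simp add: G_def linear_scale[OF f'_linear] scaleR_diff_right)
    then have "norm (G n s - f' s ?x (D n s)) = norm (f s ?y - f s ?x - f' s ?x (?y - ?x)) / h n"
      using h_pos[of n] by (simp add: divide_inverse mult.commute)
    also have "\<dots> \<le> (l s * ((h n)\<^sup>2 * ?c)) / h n"
      using order_trans[OF taylor 1] h_pos[of n] by (intro divide_right_mono) auto
    also have "\<dots> = l s * (h n * ?c)"
      using h_pos[of n] by (simp add: power2_eq_square)
    finally show ?thesis .
  qed
  \<comment> \<open>By \<open>G_D\<close> the difference quotients solve one and the same linear
    equation up to errors of order \<open>h n\<close> and \<open>h m\<close>, so they are Cauchy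
    uniformly in time.\<close>
  have D_diff: "norm (D n t - D m t) \<le> (\<Lambda> * ?c * M) * (h n + h m)" if t: "t \<in> {0..1}" for n m t
  proof -
    have "norm (D n t - D m t) \<le> (norm (D n 0 - D m 0) + \<Lambda> * ((h n + h m) * ?c)) * M"
    proof (rule gronwall_difference[OF D D l_int l_nonneg _ _ t])
      fix s :: real assume s: "s \<in> {0..1}"
      have "G n s - G m s = f' s (\<phi> s x) (D n s - D m s) +
          ((G n s - f' s (\<phi> s x) (D n s)) - (G m s - f' s (\<phi> s x) (D m s)))"
        by (simp add: linear_diff[OF f'_linear])
      also have "norm \<dots> \<le> l s * norm (D n s - D m s) + (l s * (h n * ?c) + l s * (h m * ?c))"
        by (intro norm_triangle_le add_mono f'_bound order_trans[OF norm_triangle_ineq4] G_D[OF s])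
      finally show "norm (G n s - G m s) \<le> l s * norm (D n s - D m s) + l s * ((h n + h m) * ?c)"
        by (simp add: algebra_simps)
    qed (use h_pos[of n] h_pos[of m] in auto)
    then show ?thesis by (simp add: D_0 algebra_simps)
  qed
  have "Cauchy (\<lambda>n. D n t)" if t: "t \<in> {0..1}" for t
  proof (rule metric_CauchyI)
    fix e :: real assume e: "e > 0"
    let ?K = "\<Lambda> * ?c * M"
    have K: "?K \<ge> 0" using \<Lambda>_nonneg by simp
    have "(\<lambda>n. ?K * h n) \<longlonglongrightarrow> ?K * 0" by (intro tendsto_intros h_lim)
    then have "eventually (\<lambda>n. ?K * h n < e / 2) sequentially"
      using e by (auto dest!: order_tendstoD(2)[of _ _ _ "e / 2"])
    then obtain N where N: "\<And>n. n \<ge> N \<Longrightarrow> ?K * h n < e / 2"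
      by (auto simp: eventually_sequentially)
    have "dist (D m t) (D n t) < e" if "m \<ge> N" "n \<ge> N" for m n
      using D_diff[OF t, of m n] N[OF that(1)] N[OF that(2)]
      by (simp add: dist_norm distrib_left)
    then show "\<exists>N. \<forall>m\<ge>N. \<forall>n\<ge>N. dist (D m t) (D n t) < e" by blast
  qed
  then have "\<exists>w. (\<lambda>n. D n t) \<longlonglongrightarrow> w" if "t \<in> {0..1}" for t
    using that by (simp add: Cauchy_convergent_iff convergent_def)
  then obtain w where w: "\<And>t. t \<in> {0..1} \<Longrightarrow> (\<lambda>n. D n t) \<longlonglongrightarrow> w t"
    by metis
  have w_0: "w 0 = k"
    using w[of 0] by (simp add: D_0 LIMSEQ_const_iff)
  have G_lim: "(\<lambda>n. G n s) \<longlonglongrightarrow> f' s (\<phi> s x) (w s)" if s: "s \<in> {0..1}" for s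
  proof -
    have "(\<lambda>n. l s * (h n * ?c)) \<longlonglongrightarrow> l s * (0 * ?c)"
      by (intro tendsto_intros h_lim)
    then have "(\<lambda>n. l s * (h n * ?c)) \<longlonglongrightarrow> 0"
      by (simp only: mult_zero_left mult_zero_right)
    then have "(\<lambda>n. G n s - f' s (\<phi> s x) (D n s)) \<longlonglongrightarrow> 0"
      by (rule Lim_null_comparison[OF always_eventually[OF allI[OF G_D[OF s]]]])
    moreover have "(\<lambda>n. f' s (\<phi> s x) (D n s)) \<longlonglongrightarrow> f' s (\<phi> s x) (w s)"
      by (rule bounded_linear.tendsto[OF linear_conv_bounded_linear[THEN iffD1, OF f'_linear] w[OF s]])
    ultimately have "(\<lambda>n. G n s - f' s (\<phi> s x) (D n s) + f' s (\<phi> s x) (D n s)) \<longlonglongrightarrow> 0 + f' s (\<phi> s x) (w s)"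
      by (rule tendsto_add)
    then show ?thesis by simp
  qed
  \<comment> \<open>The integrable majorant for dominated convergence.\<close>
  have G_bound: "norm (G n s) \<le> l s * (norm k * M)" if s: "s \<in> {0..1}" for n s
  proof -
    have "h n * norm (G n s) \<le> h n * (l s * norm (D n s))"
      using lip[of s "\<phi> s (x + h n *\<^sub>R k)" "\<phi> s x"] by (simp add: D_norm G_norm mult_ac)
    then have "norm (G n s) \<le> l s * norm (D n s)"
      using h_pos[of n] by simp
    also have "\<dots> \<le> l s * (norm k * M)"
      using D_bound[OF s] l_nonneg by (intro mult_left_mono)
    finally show ?thesis .
  qed
  have l_bound: "(\<lambda>s. l s * (norm k * M)) integrable_on {0..1}"
    using l_int by (rule integrable_on_mult_left)
  have dom: "(\<lambda>s. f' s (\<phi> s x) (w s)) integrable_on {0..t} \<and>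
      (\<lambda>n. integral {0..t} (G n)) \<longlonglongrightarrow> integral {0..t} (\<lambda>s. f' s (\<phi> s x) (w s))"
    if t: "t \<in> {0..1}" for t
  proof -
    have "G n integrable_on {0..t}" for n
      by (rule integrable_on_Icc_subset[OF primitive_on_integrable(1)[OF D]]) (use t in auto)
    moreover have "(\<lambda>s. l s * (norm k * M)) integrable_on {0..t}"
      by (rule integrable_on_Icc_subset[OF l_bound]) (use t in auto)
    ultimately show ?thesis
      using dominated_convergence[of G "{0..t}" "\<lambda>s. l s * (norm k * M)" "\<lambda>s. f' s (\<phi> s x) (w s)"]
        G_bound G_lim t by auto
  qed
  have "primitive_on w (\<lambda>s. f' s (\<phi> s x) (w s)) 0 1"
  proof (rule primitive_onI)
    have "norm (w s) \<le> norm k * M" if s: "s \<in> {0..1}" for s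
      using Lim_norm_ubound[OF _ w[OF s], of "norm k * M"] D_bound[OF s] by simp
    then have "norm (f' s (\<phi> s x) (w s)) \<le> l s * (norm k * M)" if s: "s \<in> {0..1}" for s
      using order_trans[OF f'_bound mult_left_mono[OF _ l_nonneg]] s by blast
    then show "(\<lambda>s. f' s (\<phi> s x) (w s)) absolutely_integrable_on {0..1}"
      using dom[of 1] l_bound by (intro absolutely_integrable_integrable_bound) auto
    show "w t = w 0 + integral {0..t} (\<lambda>s. f' s (\<phi> s x) (w s))" if t: "t \<in> {0..1}" for t
    proof -
      have "D n t = k + integral {0..t} (G n)" for n
        using primitive_on_eq[OF D t, of n] by (simp add: D_0)
      then have "(\<lambda>n. k + integral {0..t} (G n)) \<longlonglongrightarrow> w t"
        using w[OF t] by simp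
      moreover have "(\<lambda>n. k + integral {0..t} (G n)) \<longlonglongrightarrow> k + integral {0..t} (\<lambda>s. f' s (\<phi> s x) (w s))"
        using dom[OF t] by (intro tendsto_intros) auto
      ultimately show ?thesis
        using w_0 LIMSEQ_unique by blast
    qed
  qed
  then show ?thesis using w_0 by blast
qed

text \<open>Uniqueness for the linearized equation makes its solution linear in the initial vector,
  and the quadratic bound of \<open>linearized_error\<close> makes this linear map the
  derivative.\<close>

theorem flow_derivative:
  obtains W where "\<And>t. t \<in> {0..1} \<Longrightarrow> (\<phi> t has_derivative W t) (at x)"
    "\<And>k. W 0 k = k" "\<And>k. primitive_on (\<lambda>t. W t k) (\<lambda>s. f' s (\<phi> s x) (W s k)) 0 1"
proof -
  obtain V where V: "\<And>k. V k 0 = k" "\<And>k. primitive_on (V k) (\<lambda>s. f' s (\<phi> s x) (V k s)) 0 1"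
    using linearized_exists[of _ x] by metis
  have "linear (\<lambda>k. V k t)" if t: "t \<in> {0..1}" for t
  proof (rule linearI)
    fix a b
    have "primitive_on (\<lambda>s. V a s + V b s) (\<lambda>s. f' s (\<phi> s x) (V a s + V b s)) 0 1"
      using primitive_on_add[OF V(2)[of a] V(2)[of b]] by (simp add: linear_add[OF f'_linear])
    then show "V (a + b) t = V a t + V b t"
      by (rule linearized_unique[OF V(2)]) (use V t in auto)
  next
    fix c :: real and a
    have "primitive_on (\<lambda>s. c *\<^sub>R V a s) (\<lambda>s. f' s (\<phi> s x) (c *\<^sub>R V a s)) 0 1"
      using primitive_on_linear[OF V(2)[of a] _ bounded_linear_scaleR_right[of c]]
      by (simp add: linear_scale[OF f'_linear])
    then show "V (c *\<^sub>R a) t = c *\<^sub>R V a t"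
      by (rule linearized_unique[OF V(2)]) (use V t in auto)
  qed
  then have lin: "bounded_linear (\<lambda>k. V k t)" if "t \<in> {0..1}" for t
    using that by (simp add: linear_conv_bounded_linear)
  have "(\<phi> t has_derivative (\<lambda>k. V k t)) (at x)" if t: "t \<in> {0..1}" for t
    unfolding has_derivative_at
  proof
    show "bounded_linear (\<lambda>k. V k t)" using lin[OF t] .
    let ?K = "\<Lambda> * M\<^sup>2 * M"
    have quot: "norm (\<phi> t (x + k) - \<phi> t x - V k t) / norm k \<le> ?K * norm k" for k
    proof (cases "k = 0")
      case False
      have "norm (\<phi> t (x + k) - \<phi> t x - V k t) \<le> \<Lambda> * (norm k * M)\<^sup>2 * M"
        by (rule linearized_error[OF V(2) V(1) t])
      also have "\<dots> = (?K * norm k) * norm k"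
        by (simp add: power2_eq_square)
      finally show ?thesis using False by (simp add: pos_divide_le_eq)
    qed simp
    have "((\<lambda>k::'a. ?K * norm k) \<longlongrightarrow> ?K * norm (0::'a)) (at 0)"
      by (intro tendsto_intros)
    then have lim: "((\<lambda>k::'a. ?K * norm k) \<longlongrightarrow> 0) (at 0)"
      by (simp only: norm_zero mult_zero_right)
    have "norm (norm (\<phi> t (x + k) - \<phi> t x - V k t) / norm k) \<le> ?K * norm k" for k
      using quot[of k] by simp
    then show "(\<lambda>k. norm (\<phi> t (x + k) - \<phi> t x - V k t) / norm k) \<midarrow>0\<rightarrow> 0"
      by (rule Lim_null_comparison[OF always_eventually[OF allI] lim])
  qed
  then show ?thesis
    by (rule that) (simp_all add: V)
qed

text \<open>The logarithm of the squared norm of a solution changes at a rate of at most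
  \<open>2 * l\<close>, so it cannot reach minus infinity. Adding \<open>e\<close> under the
  logarithm gives it a meaning at the zero that is to be refuted.\<close>

lemma linearized_nonzero:
  assumes w: "primitive_on w (\<lambda>s. f' s (\<phi> s x) (w s)) 0 1" and "w 0 \<noteq> 0" and t: "t \<in> {0..1}"
  shows "w t \<noteq> 0"
proof
  assume "w t = 0"
  have bound: "norm (w 0) \<le> sqrt e * M" if e: "e > 0" for e :: real
  proof -
    have pos: "w \<bullet> w + e > 0" for w :: 'a using e by (simp add: add_nonneg_pos)
    have chain: "primitive_on (\<lambda>s. ln (w s \<bullet> w s + e))
        (\<lambda>s. 2 * (w s \<bullet> f' s (\<phi> s x) (w s)) / (w s \<bullet> w s + e)) 0 1"
    proof (rule primitive_on_chain[OF w _ open_UNIV, where F' = "\<lambda>w h. 2 * (w \<bullet> h) / (w \<bullet> w + e)"])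
      show "((\<lambda>w. ln (w \<bullet> w + e)) has_derivative (\<lambda>h. 2 * (y \<bullet> h) / (y \<bullet> y + e))) (at y)" for y :: 'a
        using pos[of y] by (auto intro!: derivative_eq_intros simp: inner_commute divide_inverse)
      show "continuous_on UNIV (\<lambda>y. 2 * (y \<bullet> h) / (y \<bullet> y + e))" for h :: 'a
        using pos by (intro continuous_intros) (auto simp: less_imp_neq[symmetric])
    qed auto
    have le: "norm (2 * (w s \<bullet> f' s (\<phi> s x) (w s)) / (w s \<bullet> w s + e)) \<le> 2 * l s" for s
    proof -
      have "\<bar>w s \<bullet> f' s (\<phi> s x) (w s)\<bar> \<le> norm (w s) * (l s * norm (w s))"
        by (rule order_trans[OF Cauchy_Schwarz_ineq2]) (simp add: f'_bound mult_left_mono)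
      also have "\<dots> = l s * (w s \<bullet> w s)"
        by (simp add: power2_norm_eq_inner[symmetric] power2_eq_square)
      also have "\<dots> \<le> l s * (w s \<bullet> w s + e)"
        using e l_nonneg by (intro mult_left_mono) auto
      finally show ?thesis
        using pos[of "w s"] by (simp add: abs_mult pos_divide_le_eq)
    qed
    have "norm (ln (w t \<bullet> w t + e) - ln (w 0 \<bullet> w 0 + e)) \<le> integral {0..t} (\<lambda>s. 2 * l s)"
    proof (rule order_trans[OF primitive_on_norm_increment[OF chain]])
      show "integral {0..t} (\<lambda>s. norm (2 * (w s \<bullet> f' s (\<phi> s x) (w s)) / (w s \<bullet> w s + e))) \<le> integral {0..t} (\<lambda>s. 2 * l s)"
        by (intro integral_le integrable_on_Icc_subset[OF primitive_on_integrable(2)[OF chain]]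
          integrable_on_mult_right integrable_on_Icc_subset[OF l_int] le) (use t in auto)
    qed (use t in auto)
    also have "\<dots> \<le> 2 * \<Lambda>"
      using integral_subset_le[OF _ integrable_on_Icc_subset[OF l_int, of 0 t] l_int] t l_nonneg by auto
    finally have "ln (w 0 \<bullet> w 0 + e) \<le> ln e + 2 * \<Lambda>"
      using \<open>w t = 0\<close> by simp
    then have "exp (ln (w 0 \<bullet> w 0 + e)) \<le> exp (ln e + 2 * \<Lambda>)" by simp
    then have "w 0 \<bullet> w 0 + e \<le> e * M\<^sup>2"
      using pos[of "w 0"] e by (simp add: exp_add exp_double)
    then have "(norm (w 0))\<^sup>2 \<le> (sqrt e * M)\<^sup>2"
      using e by (simp add: power2_norm_eq_inner power_mult_distrib)
    then show ?thesis
      using e by (rule_tac power2_le_imp_le) auto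
  qed
  \<comment> \<open>With the square of this number as \<open>e\<close>, the bound reads
    \<open>norm (w 0) \<le> norm (w 0) / 2\<close>.\<close>
  have "norm (w 0) / (2 * M) > 0" using assms(2) by simp
  from bound[of "(norm (w 0) / (2 * M))\<^sup>2"] this assms(2) show False
    by (simp add: real_sqrt_abs)
qed

end

section \<open>Minimal fields with prescribed jet\<close>

lemma bounded_range_vanishing_at_infinity:
  fixes f :: "'a::euclidean_space \<Rightarrow> 'b::real_normed_vector"
  assumes "continuous_on UNIV f" "(f \<longlongrightarrow> 0) at_infinity"
  shows "bounded (range f)"
proof -
  have "eventually (\<lambda>x. dist (f x) 0 < 1) at_infinity"
    using tendstoD[OF assms(2), of 1] by simp
  then obtain b where b: "\<And>x. b \<le> norm x \<Longrightarrow> norm (f x) < 1"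
    by (auto simp: eventually_at_infinity)
  have "compact (f ` cball 0 b)"
    by (rule compact_continuous_image[OF continuous_on_subset[OF assms(1)]]) auto
  then obtain B where B: "\<And>x. x \<in> cball 0 b \<Longrightarrow> norm (f x) \<le> B"
    using compact_imp_bounded bounded_iff by (metis imageI)
  have "norm (f x) \<le> max B 1" for x
    using b[of x] B[of x] by (cases "norm x \<le> b") (auto simp: le_max_iff_disj intro: less_imp_le)
  then show ?thesis by (auto simp: bounded_iff)
qed

lemma C2_vanishing_derivatives:
  fixes f :: "'a::euclidean_space \<Rightarrow> 'a"
  assumes "f \<in> C2_vanishing"
  shows "(f has_derivative frechet_derivative f (at x)) (at x)"
    "blinfun_apply (deriv_blinfun f x) = frechet_derivative f (at x)"
    "(deriv_blinfun f has_derivative blinfun_apply (deriv_blinfun (deriv_blinfun f) x)) (at x)"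
proof -
  show d1: "(f has_derivative frechet_derivative f (at x)) (at x)"
    using assms by (simp add: C2_vanishing_def frechet_derivative_works)
  show "blinfun_apply (deriv_blinfun f x) = frechet_derivative f (at x)"
    unfolding deriv_blinfun_def using has_derivative_bounded_linear[OF d1]
    by (rule bounded_linear_Blinfun_apply)
  have d2: "(deriv_blinfun f has_derivative frechet_derivative (deriv_blinfun f) (at x)) (at x)"
    using assms by (simp add: C2_vanishing_def frechet_derivative_works)
  then show "(deriv_blinfun f has_derivative blinfun_apply (deriv_blinfun (deriv_blinfun f) x)) (at x)"
    using bounded_linear_Blinfun_apply[OF has_derivative_bounded_linear[OF d2]]
    by (simp add: deriv_blinfun_def[of "deriv_blinfun f"])
qed

text \<open>The supremum dominates the values only if these are bounded, which continuity and
  vanishing at infinity ensure.\<close>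

lemma C2_norm_upper:
  fixes f :: "'a::euclidean_space \<Rightarrow> 'a"
  assumes f: "f \<in> C2_vanishing"
  shows "norm (f x) + norm (deriv_blinfun f x) + norm (deriv_blinfun (deriv_blinfun f) x) \<le> C2_norm f"
proof -
  note der = C2_vanishing_derivatives[OF f]
  have "continuous_on UNIV f" "continuous_on UNIV (deriv_blinfun f)"
    using der(1,3) has_derivative_continuous by (blast intro: continuous_at_imp_continuous_on)+
  then have "bounded (range f)" "bounded (range (deriv_blinfun f))"
      "bounded (range (deriv_blinfun (deriv_blinfun f)))"
    using f by (auto simp: C2_vanishing_def intro!: bounded_range_vanishing_at_infinity)
  then obtain A B C where "\<And>x. norm (f x) \<le> A" "\<And>x. norm (deriv_blinfun f x) \<le> B"
      "\<And>x. norm (deriv_blinfun (deriv_blinfun f) x) \<le> C"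
    unfolding bounded_iff by blast
  then have "norm (f x) + norm (deriv_blinfun f x) + norm (deriv_blinfun (deriv_blinfun f) x) \<le> A + B + C" for x
    by (intro add_mono)
  then show ?thesis
    unfolding C2_norm_def by (intro cSUP_upper bdd_aboveI2) auto
qed

locale radial_rkhs =
  fixes ev :: "'v::{real_inner,complete_space} \<Rightarrow> real^'n \<Rightarrow> real^'n"
    and K :: "real^'n \<Rightarrow> real^'n \<Rightarrow> real^'n^'n"
    and \<rho> :: "real \<Rightarrow> real" and d \<sigma> \<tau> :: real
  assumes space: "vector_field_space ev" and kernel: "reproducing_kernel ev K"
    and radial: "\<And>x y. K x y = \<rho> ((norm (x - y))\<^sup>2 / \<sigma>\<^sup>2) *\<^sub>R mat 1"
    and \<sigma>_pos: "0 < \<sigma>"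
    and \<rho>_deriv: "(\<rho> has_real_derivative d) (at 0 within {0..})"
    and \<rho>_0: "\<rho> 0 = 1" and d_neg: "d < 0"
    and \<tau>_eq: "\<tau> = - \<sigma>\<^sup>2 / (2 * d)"
begin

lemma \<tau>_pos: "0 < \<tau>"
  unfolding \<tau>_eq using \<sigma>_pos d_neg by (intro divide_neg_neg) auto

definition dev :: "'v \<Rightarrow> real^'n \<Rightarrow> real^'n \<Rightarrow> real^'n"
  where "dev v x = frechet_derivative (ev v) (at x)"

definition C :: real
  where "C = (SOME C. 0 \<le> C \<and> (\<forall>v. C2_norm (ev v) \<le> C * norm v))"

lemma C: "0 \<le> C" "C2_norm (ev v) \<le> C * norm v"
proof -
  obtain C0 where C0: "\<And>v. C2_norm (ev v) \<le> C0 * norm v"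
    using space by (auto simp: vector_field_space_def)
  have "C2_norm (ev v) \<le> \<bar>C0\<bar> * norm v" for v
    by (rule order_trans[OF C0 mult_right_mono]) auto
  then have "\<exists>C. 0 \<le> C \<and> (\<forall>v. C2_norm (ev v) \<le> C * norm v)"
    by (intro exI[of _ "\<bar>C0\<bar>"]) auto
  from someI_ex[OF this] show "0 \<le> C" "C2_norm (ev v) \<le> C * norm v"
    unfolding C_def by auto
qed

lemma ev_C2: "ev v \<in> C2_vanishing"
  using space by (auto simp: vector_field_space_def)

lemma ev_derivative: "(ev v has_derivative dev v x) (at x)"
  unfolding dev_def by (rule C2_vanishing_derivatives(1)[OF ev_C2])

lemma dev_linear: "linear (dev v x)"
  using has_derivative_bounded_linear[OF ev_derivative] by (rule bounded_linear.linear)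

lemma ev_linear: "linear (\<lambda>v. ev v x)"
proof -
  have "ev (a *\<^sub>R v + b *\<^sub>R w) x = a *\<^sub>R ev v x + b *\<^sub>R ev w x" for a b v w
    using space by (auto simp: vector_field_space_def)
  from this[of 1 _ 1] this[of _ _ 0] show ?thesis by (intro linearI) auto
qed

lemma
  shows ev_bound: "norm (ev v x) \<le> C * norm v"
    and blinfun_bound: "norm (deriv_blinfun (ev v) x) \<le> C * norm v"
    and blinfun2_bound: "norm (deriv_blinfun (deriv_blinfun (ev v)) x) \<le> C * norm v"
proof -
  have "norm (ev v x) + norm (deriv_blinfun (ev v) x) + norm (deriv_blinfun (deriv_blinfun (ev v)) x) \<le> C * norm v"
    using C2_norm_upper[OF ev_C2] C(2) by (rule order_trans)
  moreover have "0 \<le> norm (ev v x)" "0 \<le> norm (deriv_blinfun (ev v) x)"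
      "0 \<le> norm (deriv_blinfun (deriv_blinfun (ev v)) x)"
    by (rule norm_ge_zero)+
  ultimately show "norm (ev v x) \<le> C * norm v" "norm (deriv_blinfun (ev v) x) \<le> C * norm v"
      "norm (deriv_blinfun (deriv_blinfun (ev v)) x) \<le> C * norm v"
    by linarith+
qed

lemma dev_blinfun: "dev v x = blinfun_apply (deriv_blinfun (ev v) x)"
  unfolding dev_def by (rule C2_vanishing_derivatives(2)[OF ev_C2, symmetric])

lemma dev_bound: "norm (dev v x h) \<le> C * norm v * norm h"
  unfolding dev_blinfun
  by (rule order_trans[OF norm_blinfun mult_right_mono[OF blinfun_bound]]) simp

lemma ev_lipschitz: "norm (ev v x - ev v y) \<le> C * norm v * norm (x - y)"
proof (rule differentiable_bound[OF convex_UNIV])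
  show "(ev v has_derivative dev v x) (at x within UNIV)" for x
    using ev_derivative by simp
  show "onorm (dev v x) \<le> C * norm v" for x
    using blinfun_bound by (simp add: dev_blinfun norm_blinfun.rep_eq)
qed auto

lemma blinfun_lipschitz:
  "norm (deriv_blinfun (ev v) x - deriv_blinfun (ev v) y) \<le> C * norm v * norm (x - y)"
proof (rule differentiable_bound[OF convex_UNIV])
  show "(deriv_blinfun (ev v) has_derivative blinfun_apply (deriv_blinfun (deriv_blinfun (ev v)) x)) (at x within UNIV)" for x
    using C2_vanishing_derivatives(3)[OF ev_C2] by simp
  show "onorm (blinfun_apply (deriv_blinfun (deriv_blinfun (ev v)) x)) \<le> C * norm v" for x
    using blinfun2_bound by (simp add: norm_blinfun.rep_eq)
qed auto

lemma dev_lipschitz: "norm (dev v x h - dev v y h) \<le> C * norm v * norm (x - y) * norm h"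
proof -
  have "norm (blinfun_apply (deriv_blinfun (ev v) x - deriv_blinfun (ev v) y) h) \<le> C * norm v * norm (x - y) * norm h"
    by (rule order_trans[OF norm_blinfun mult_right_mono[OF blinfun_lipschitz]]) simp
  then show ?thesis by (simp add: dev_blinfun minus_blinfun.rep_eq)
qed

lemma ev_taylor: "norm (ev v z - ev v y - dev v y (z - y)) \<le> C * norm v * (norm (z - y))\<^sup>2"
proof -
  have "norm (ev v z - ev v y - dev v y (z - y)) \<le> norm (z - y) * (C * norm v * norm (z - y))"
  proof (rule differentiable_bound_linearization[where S = "closed_segment y z" and f' = "dev v"])
    show "y + t *\<^sub>R (z - y) \<in> closed_segment y z" if "t \<in> {0..1}" for t
      using that by (auto simp: closed_segment_def algebra_simps intro!: exI[of _ t])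
    show "(ev v has_derivative dev v x) (at x within closed_segment y z)" for x
      using ev_derivative by (rule has_derivative_at_withinI)
    show "onorm (dev v x - dev v y) \<le> C * norm v * norm (z - y)" if "x \<in> closed_segment y z" for x
    proof -
      have "onorm (dev v x - dev v y) = norm (deriv_blinfun (ev v) x - deriv_blinfun (ev v) y)"
        by (simp add: dev_blinfun norm_blinfun.rep_eq minus_blinfun.rep_eq fun_diff_def)
      also have "\<dots> \<le> C * norm v * norm (x - y)" by (rule blinfun_lipschitz)
      also have "\<dots> \<le> C * norm v * norm (z - y)"
        using segment_bound(1)[OF that] C(1) by (intro mult_left_mono) auto
      finally show ?thesis .
    qed
  qed simp
  then show ?thesis by (simp add: power2_eq_square mult_ac)
qed

section \<open>Representers of values and of directional derivatives\<close>

definition point_rep :: "real^'n \<Rightarrow> real^'n \<Rightarrow> 'v"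
  where "point_rep x a = (SOME k. (\<forall>y. ev k y = K y x *v a) \<and> (\<forall>v. v \<bullet> k = ev v x \<bullet> a))"

lemma point_rep:
  shows ev_point_rep: "ev (point_rep x a) y = \<rho> ((norm (y - x))\<^sup>2 / \<sigma>\<^sup>2) *\<^sub>R a"
    and inner_point_rep: "v \<bullet> point_rep x a = ev v x \<bullet> a"
proof -
  have "\<exists>k. (\<forall>y. ev k y = K y x *v a) \<and> (\<forall>v. v \<bullet> k = ev v x \<bullet> a)"
    using kernel by (auto simp: reproducing_kernel_def)
  from someI_ex[OF this]
  have "ev (point_rep x a) y = K y x *v a" "v \<bullet> point_rep x a = ev v x \<bullet> a"
    unfolding point_rep_def by auto
  then show "ev (point_rep x a) y = \<rho> ((norm (y - x))\<^sup>2 / \<sigma>\<^sup>2) *\<^sub>R a"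
      "v \<bullet> point_rep x a = ev v x \<bullet> a"
    by (simp_all add: radial flip: scaleR_matrix_vector_assoc)
qed

lemma inner_point_rep_same: "point_rep x a \<bullet> point_rep x b = a \<bullet> b"
  by (simp add: inner_point_rep ev_point_rep \<rho>_0)

text \<open>Difference quotients of the point representers in direction \<open>u\<close>. Their
  limit in \<open>V\<close> represents the directional derivative, and its inner products become
  limits of explicit kernel values.\<close>

definition quot_rep :: "real^'n \<Rightarrow> real^'n \<Rightarrow> real^'n \<Rightarrow> nat \<Rightarrow> 'v"
  where "quot_rep x u b n =
    (point_rep (x + inverse (real (Suc n)) *\<^sub>R u) b - point_rep x b) /\<^sub>R inverse (real (Suc n))"

lemma inner_quot_rep:
  "v \<bullet> quot_rep x u b n = ((ev v (x + inverse (real (Suc n)) *\<^sub>R u) - ev v x) \<bullet> b) / inverse (real (Suc n))"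
  by (simp add: quot_rep_def inner_diff_right inner_point_rep inner_diff_left divide_inverse mult.commute)

lemma quot_rep_error:
  "\<bar>v \<bullet> quot_rep x u b n - dev v x u \<bullet> b\<bar> \<le> norm v * (C * (norm u)\<^sup>2 * norm b) * inverse (real (Suc n))"
proof -
  define h where "h = inverse (real (Suc n))"
  have h: "h > 0" by (simp add: h_def)
  let ?e = "ev v (x + h *\<^sub>R u) - ev v x - dev v x (h *\<^sub>R u)"
  have "v \<bullet> quot_rep x u b n - dev v x u \<bullet> b = (?e \<bullet> b) / h"
    using h unfolding inner_quot_rep h_def[symmetric]
    by (simp add: linear_scale[OF dev_linear] inner_diff_left diff_divide_distrib)
  then have "\<bar>v \<bullet> quot_rep x u b n - dev v x u \<bullet> b\<bar> = \<bar>?e \<bullet> b\<bar> / h"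
    using h by simp
  also have "\<dots> \<le> (C * norm v * (norm (h *\<^sub>R u))\<^sup>2 * norm b) / h"
    using ev_taylor[of v "x + h *\<^sub>R u" x] h
    by (intro divide_right_mono order_trans[OF Cauchy_Schwarz_ineq2] mult_right_mono) auto
  also have "\<dots> = norm v * (C * (norm u)\<^sup>2 * norm b) * h"
    using h by (simp add: power_mult_distrib power2_eq_square)
  finally show ?thesis by (simp only: h_def)
qed

text \<open>As functionals the quotients converge with an error proportional to
  \<open>norm v\<close>. Tested on the difference of two quotients, this makes them Cauchy in norm,
  and completeness of \<open>V\<close> gives the limit.\<close>

lemma dir_rep_exists: "\<exists>D. quot_rep x u b \<longlonglongrightarrow> D \<and> (\<forall>v. v \<bullet> D = dev v x u \<bullet> b)"
proof -
  define h where "h n = inverse (real (Suc n))" for n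
  let ?K = "C * (norm u)\<^sup>2 * norm b"
  let ?q = "quot_rep x u b"
  have K: "0 \<le> ?K" using C(1) by simp
  have diff: "norm (?q n - ?q m) \<le> ?K * h n + ?K * h m" for n m
  proof -
    let ?v = "?q n - ?q m"
    have "(norm ?v)\<^sup>2 = (?v \<bullet> ?q n - dev ?v x u \<bullet> b) - (?v \<bullet> ?q m - dev ?v x u \<bullet> b)"
      by (simp add: power2_norm_eq_inner inner_diff_right)
    also have "\<dots> \<le> norm ?v * ?K * h n + norm ?v * ?K * h m"
      using quot_rep_error[of ?v x u b n] quot_rep_error[of ?v x u b m]
      unfolding h_def by linarith
    finally have "norm ?v * norm ?v \<le> norm ?v * (?K * h n + ?K * h m)"
      by (simp add: power2_eq_square algebra_simps)
    moreover have "0 \<le> ?K * h n + ?K * h m"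
      using K by (simp add: h_def)
    ultimately show ?thesis
      by (cases "norm ?v = 0") auto
  qed
  have h_lim: "h \<longlonglongrightarrow> 0" unfolding h_def by (rule LIMSEQ_inverse_real_of_nat)
  then have "(\<lambda>n. ?K * h n) \<longlonglongrightarrow> ?K * 0" by (intro tendsto_intros)
  then have Kh: "(\<lambda>n. ?K * h n) \<longlonglongrightarrow> 0" by (simp only: mult_zero_right)
  have "Cauchy ?q"
  proof (rule metric_CauchyI)
    fix e :: real assume e: "e > 0"
    have "eventually (\<lambda>n. ?K * h n < e / 2) sequentially"
      using order_tendstoD(2)[OF Kh, of "e / 2"] e by simp
    then obtain N where N: "\<And>n. n \<ge> N \<Longrightarrow> ?K * h n < e / 2"
      unfolding eventually_sequentially by blast
    have "dist (?q m) (?q n) < e" if "m \<ge> N" "n \<ge> N" for m n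
      using diff[of m n] N[OF that(1)] N[OF that(2)] unfolding dist_norm by linarith
    then show "\<exists>N. \<forall>m\<ge>N. \<forall>n\<ge>N. dist (?q m) (?q n) < e" by blast
  qed
  then obtain D where D: "?q \<longlonglongrightarrow> D"
    using Cauchy_convergent_iff convergent_def by blast
  have "v \<bullet> D = dev v x u \<bullet> b" for v
  proof (rule LIMSEQ_unique)
    show "(\<lambda>n. v \<bullet> ?q n) \<longlonglongrightarrow> v \<bullet> D" by (intro tendsto_intros D)
    have "(\<lambda>n. norm v * ?K * h n) \<longlonglongrightarrow> norm v * ?K * 0" by (intro tendsto_intros h_lim)
    then have "(\<lambda>n. norm v * ?K * h n) \<longlonglongrightarrow> 0" by (simp only: mult_zero_right)
    then have "(\<lambda>n. v \<bullet> ?q n - dev v x u \<bullet> b) \<longlonglongrightarrow> 0"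
      by (rule Lim_null_comparison[rotated])
        (use quot_rep_error[of v x u b] in \<open>auto simp: h_def intro!: always_eventually\<close>)
    then show "(\<lambda>n. v \<bullet> ?q n) \<longlonglongrightarrow> dev v x u \<bullet> b" by (rule LIM_zero_cancel)
  qed
  with D show ?thesis by blast
qed

definition dir_rep :: "real^'n \<Rightarrow> real^'n \<Rightarrow> real^'n \<Rightarrow> 'v"
  where "dir_rep x u b = (SOME D. quot_rep x u b \<longlonglongrightarrow> D \<and> (\<forall>v. v \<bullet> D = dev v x u \<bullet> b))"

lemma
  shows quot_rep_tendsto: "quot_rep x u b \<longlonglongrightarrow> dir_rep x u b"
    and inner_dir_rep: "v \<bullet> dir_rep x u b = dev v x u \<bullet> b"
  using someI_ex[OF dir_rep_exists[of x u b]] unfolding dir_rep_def by auto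

lemma \<rho>_quotient:
  "(\<lambda>n. (\<rho> ((inverse (real (Suc n)))\<^sup>2 / \<sigma>\<^sup>2) - 1) / ((inverse (real (Suc n)))\<^sup>2 / \<sigma>\<^sup>2)) \<longlonglongrightarrow> d"
proof -
  have lim: "((\<lambda>y. (\<rho> y - 1) / y) \<longlongrightarrow> d) (at 0 within {0..})"
    using \<rho>_deriv by (simp add: has_field_derivative_iff \<rho>_0)
  have "(\<lambda>n. (inverse (real (Suc n)))\<^sup>2 / \<sigma>\<^sup>2) \<longlonglongrightarrow> 0\<^sup>2 / \<sigma>\<^sup>2"
    using \<sigma>_pos by (intro tendsto_intros LIMSEQ_inverse_real_of_nat) auto
  then have "filterlim (\<lambda>n. (inverse (real (Suc n)))\<^sup>2 / \<sigma>\<^sup>2) (at 0 within {0..}) sequentially"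
    using \<sigma>_pos by (simp add: filterlim_at del: of_nat_Suc)
  from filterlim_compose[OF lim this] show ?thesis .
qed

text \<open>A radial kernel is stationary on the diagonal: a step of length h changes it by order
  \<open>h\<^sup>2\<close>, and division by h leaves nothing in the limit.\<close>

lemma point_rep_orthogonal_dir_rep:
  assumes "norm u = 1"
  shows "point_rep x a \<bullet> dir_rep x u b = 0"
proof (rule LIMSEQ_unique)
  show "(\<lambda>n. point_rep x a \<bullet> quot_rep x u b n) \<longlonglongrightarrow> point_rep x a \<bullet> dir_rep x u b"
    by (intro tendsto_intros quot_rep_tendsto)
  let ?h = "\<lambda>n. inverse (real (Suc n))"
  have "(\<lambda>n. (\<rho> ((?h n)\<^sup>2 / \<sigma>\<^sup>2) - 1) / ((?h n)\<^sup>2 / \<sigma>\<^sup>2) * (?h n * ((a \<bullet> b) / \<sigma>\<^sup>2))) \<longlonglongrightarrow> d * (0 * ((a \<bullet> b) / \<sigma>\<^sup>2))"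
    by (intro tendsto_mult \<rho>_quotient LIMSEQ_inverse_real_of_nat tendsto_const)
  moreover have "point_rep x a \<bullet> quot_rep x u b n =
      (\<rho> ((?h n)\<^sup>2 / \<sigma>\<^sup>2) - 1) / ((?h n)\<^sup>2 / \<sigma>\<^sup>2) * (?h n * ((a \<bullet> b) / \<sigma>\<^sup>2))" for n
  proof -
    have "?h n > 0" by simp
    moreover have "norm (?h n *\<^sub>R u) = ?h n" using assms by simp
    ultimately show ?thesis
      unfolding inner_quot_rep ev_point_rep using \<sigma>_pos
      by (simp add: \<rho>_0 inner_diff_left power2_eq_square divide_simps algebra_simps del: of_nat_Suc)
  qed
  ultimately show "(\<lambda>n. point_rep x a \<bullet> quot_rep x u b n) \<longlonglongrightarrow> 0"
    by (simp only: mult_zero_left mult_zero_right)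
qed

text \<open>The origin of \<tau>. The kernel values at distances 0 and h combine to a second
  difference across the diagonal, and its limit \<open>- 2 * d / \<sigma>\<^sup>2\<close> is
  \<open>1 / \<tau>\<close>.\<close>

lemma norm_dir_rep:
  assumes "norm u = 1"
  shows "dir_rep x u b \<bullet> dir_rep x u b = (b \<bullet> b) / \<tau>"
proof (rule LIMSEQ_unique)
  show "(\<lambda>n. quot_rep x u b n \<bullet> quot_rep x u b n) \<longlonglongrightarrow> dir_rep x u b \<bullet> dir_rep x u b"
    by (intro tendsto_intros quot_rep_tendsto)
  let ?h = "\<lambda>n. inverse (real (Suc n))"
  have "(\<lambda>n. (\<rho> ((?h n)\<^sup>2 / \<sigma>\<^sup>2) - 1) / ((?h n)\<^sup>2 / \<sigma>\<^sup>2) * (- 2 * (b \<bullet> b) / \<sigma>\<^sup>2)) \<longlonglongrightarrow> d * (- 2 * (b \<bullet> b) / \<sigma>\<^sup>2)"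
    by (intro tendsto_mult \<rho>_quotient tendsto_const)
  moreover have "d * (- 2 * (b \<bullet> b) / \<sigma>\<^sup>2) = (b \<bullet> b) / \<tau>"
    using d_neg by (simp add: \<tau>_eq)
  moreover have "quot_rep x u b n \<bullet> quot_rep x u b n =
      (\<rho> ((?h n)\<^sup>2 / \<sigma>\<^sup>2) - 1) / ((?h n)\<^sup>2 / \<sigma>\<^sup>2) * (- 2 * (b \<bullet> b) / \<sigma>\<^sup>2)" for n
  proof -
    have h: "?h n > 0" by simp
    have nrm: "norm (?h n *\<^sub>R u) = ?h n" using assms by simp
    have "ev (quot_rep x u b n) y =
        ((\<rho> ((norm (y - (x + ?h n *\<^sub>R u)))\<^sup>2 / \<sigma>\<^sup>2) - \<rho> ((norm (y - x))\<^sup>2 / \<sigma>\<^sup>2)) / ?h n) *\<^sub>R b" for y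
      unfolding quot_rep_def linear_scale[OF ev_linear] linear_diff[OF ev_linear] ev_point_rep
      by (simp add: divide_inverse algebra_simps del: of_nat_Suc)
    then have "ev (quot_rep x u b n) (x + ?h n *\<^sub>R u) = ((1 - \<rho> ((?h n)\<^sup>2 / \<sigma>\<^sup>2)) / ?h n) *\<^sub>R b"
        "ev (quot_rep x u b n) x = ((\<rho> ((?h n)\<^sup>2 / \<sigma>\<^sup>2) - 1) / ?h n) *\<^sub>R b"
      using nrm by (simp_all add: \<rho>_0 del: of_nat_Suc)
    then have "quot_rep x u b n \<bullet> quot_rep x u b n =
        ((1 - \<rho> ((?h n)\<^sup>2 / \<sigma>\<^sup>2)) / ?h n * (b \<bullet> b) - (\<rho> ((?h n)\<^sup>2 / \<sigma>\<^sup>2) - 1) / ?h n * (b \<bullet> b)) / ?h n"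
      by (simp only: inner_quot_rep inner_diff_left inner_scaleR_left)
    moreover have "((1 - P) / h * B - (P - 1) / h * B) / h = (P - 1) / (h\<^sup>2 / s\<^sup>2) * (- 2 * B / s\<^sup>2)"
      if "h \<noteq> 0" "s \<noteq> 0" for P h B s :: real
      using that by (simp add: power2_eq_square field_simps)
    ultimately show ?thesis
      using h \<sigma>_pos by (simp only: less_imp_neq[symmetric] not_False_eq_True)
  qed
  ultimately show "(\<lambda>n. quot_rep x u b n \<bullet> quot_rep x u b n) \<longlonglongrightarrow> (b \<bullet> b) / \<tau>"
    by simp
qed

lemma dir_rep_add: "dir_rep x u (a + b) = dir_rep x u a + dir_rep x u b"
  by (rule vector_eq_ldot[THEN iffD1]) (simp add: inner_dir_rep inner_add_right)

text \<open>Polarization of \<open>norm_dir_rep\<close>.\<close>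

lemma inner_dir_rep_same:
  assumes "norm u = 1"
  shows "dir_rep x u a \<bullet> dir_rep x u b = (a \<bullet> b) / \<tau>"
proof -
  have "(dir_rep x u a + dir_rep x u b) \<bullet> (dir_rep x u a + dir_rep x u b) = ((a + b) \<bullet> (a + b)) / \<tau>"
    unfolding dir_rep_add[symmetric] by (rule norm_dir_rep[OF assms])
  then show ?thesis
    using norm_dir_rep[OF assms, of x a] norm_dir_rep[OF assms, of x b]
    by (simp add: inner_add_left inner_add_right inner_commute add_divide_distrib)
qed

text \<open>For a unit vector \<open>u\<close>, the field of least norm with value \<open>a\<close>
  at \<open>x\<close> and derivative \<open>b\<close> along \<open>u\<close>. It lies in the span of
  the representers, and the factor \<tau> inverts the Gram matrix of the directional ones.\<close>

definition min_field :: "real^'n \<Rightarrow> real^'n \<Rightarrow> real^'n \<Rightarrow> real^'n \<Rightarrow> 'v"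
  where "min_field x u a b = point_rep x a + \<tau> *\<^sub>R dir_rep x u b"

lemma inner_min_field: "v \<bullet> min_field x u a b = ev v x \<bullet> a + \<tau> * (dev v x u \<bullet> b)"
  by (simp add: min_field_def inner_add_right inner_point_rep inner_dir_rep)

lemma
  assumes "norm u = 1"
  shows ev_min_field: "ev (min_field x u a b) x = a"
    and dev_min_field: "dev (min_field x u a b) x u = b"
    and norm_min_field: "(norm (min_field x u a b))\<^sup>2 = (norm a)\<^sup>2 + \<tau> * (norm b)\<^sup>2"
proof -
  have "ev (min_field x u a b) x \<bullet> c = a \<bullet> c" for c
    unfolding inner_point_rep[symmetric] min_field_def
    using point_rep_orthogonal_dir_rep[OF assms]
    by (simp add: inner_add_left inner_commute[of "dir_rep x u b"] inner_point_rep_same)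
  then show ev: "ev (min_field x u a b) x = a"
    using vector_eq_rdot by blast
  have "dev (min_field x u a b) x u \<bullet> c = b \<bullet> c" for c
    unfolding inner_dir_rep[symmetric] min_field_def
    using point_rep_orthogonal_dir_rep[OF assms] inner_dir_rep_same[OF assms] \<tau>_pos
    by (simp add: inner_add_left)
  then show dev: "dev (min_field x u a b) x u = b"
    using vector_eq_rdot by blast
  show "(norm (min_field x u a b))\<^sup>2 = (norm a)\<^sup>2 + \<tau> * (norm b)\<^sup>2"
    by (simp add: power2_norm_eq_inner inner_min_field ev dev)
qed

text \<open>The minimal field with the jet of \<open>v\<close> is the orthogonal projection of
  \<open>v\<close> onto the representers at \<open>x\<close>, and projections do not increase the
  norm.\<close>

theorem norm_ge_jet:
  assumes "norm u = 1"
  shows "(norm (ev v x))\<^sup>2 + \<tau> * (norm (dev v x u))\<^sup>2 \<le> (norm v)\<^sup>2"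
proof -
  let ?p = "min_field x u (ev v x) (dev v x u)"
  have "v \<bullet> ?p = (norm ?p)\<^sup>2"
    unfolding norm_min_field[OF assms] inner_min_field by (simp add: power2_norm_eq_inner)
  moreover have "v \<bullet> ?p \<le> norm v * norm ?p"
    by (rule norm_cauchy_schwarz)
  ultimately have "norm ?p \<le> norm v"
    by (cases "norm ?p = 0") (auto simp: power2_eq_square)
  then have "(norm ?p)\<^sup>2 \<le> (norm v)\<^sup>2"
    by (intro power_mono) auto
  then show ?thesis by (simp add: norm_min_field[OF assms])
qed

section \<open>Continuous dependence of the minimal fields on their data\<close>

lemma norm_le_if_inner_le:
  fixes w :: 'v
  assumes "\<And>v. v \<bullet> w \<le> norm v * c" "0 \<le> c"
  shows "norm w \<le> c"
  using assms(1)[of w] assms(2) by (cases "norm w = 0") (auto simp: dot_square_norm power2_eq_square)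

lemma point_rep_diff:
  "norm (point_rep x a - point_rep y b) \<le> C * (norm (x - y) * norm a + norm (a - b))"
proof (rule norm_le_if_inner_le)
  fix v
  have "v \<bullet> (point_rep x a - point_rep y b) = (ev v x - ev v y) \<bullet> a + ev v y \<bullet> (a - b)"
    by (simp add: inner_point_rep inner_diff_right inner_diff_left)
  also have "\<dots> \<le> C * norm v * norm (x - y) * norm a + C * norm v * norm (a - b)"
    by (intro add_mono order_trans[OF norm_cauchy_schwarz] mult_right_mono ev_lipschitz ev_bound) auto
  finally show "v \<bullet> (point_rep x a - point_rep y b) \<le> norm v * (C * (norm (x - y) * norm a + norm (a - b)))"
    by (simp add: algebra_simps)
qed (use C in auto)

lemma dir_rep_diff:
  "norm (dir_rep x u a - dir_rep y w b) \<le>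
    C * (norm (x - y) * norm u * norm a + norm (u - w) * norm a + norm w * norm (a - b))"
proof (rule norm_le_if_inner_le)
  fix v
  have "v \<bullet> (dir_rep x u a - dir_rep y w b) =
      (dev v x u - dev v y u) \<bullet> a + dev v y (u - w) \<bullet> a + dev v y w \<bullet> (a - b)"
    by (simp add: inner_dir_rep inner_diff_right inner_diff_left linear_diff[OF dev_linear])
  also have "\<dots> \<le> C * norm v * norm (x - y) * norm u * norm a + C * norm v * norm (u - w) * norm a
      + C * norm v * norm w * norm (a - b)"
    by (intro add_mono order_trans[OF norm_cauchy_schwarz] mult_right_mono dev_lipschitz dev_bound) auto
  finally show "v \<bullet> (dir_rep x u a - dir_rep y w b) \<le>
      norm v * (C * (norm (x - y) * norm u * norm a + norm (u - w) * norm a + norm w * norm (a - b)))"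
    by (simp add: algebra_simps)
qed (use C in auto)

text \<open>By duality the Lipschitz bounds for fields become norm bounds for representers. The
  result makes the optimal control continuous in time, hence square integrable and accessible to
  Picard iteration.\<close>

lemma min_field_continuous:
  assumes X: "continuous_on S X" and U: "continuous_on S U" and A: "continuous_on S A" and B: "continuous_on S B"
  shows "continuous_on S (\<lambda>t. min_field (X t) (U t) (A t) (B t))"
proof -
  have "continuous_on S (\<lambda>t. point_rep (X t) (A t))"
    unfolding continuous_on_def
  proof safe
    fix t assume t: "t \<in> S"
    have "((\<lambda>s. C * (norm (X s - X t) * norm (A s) + norm (A s - A t))) \<longlongrightarrow>
        C * (norm (X t - X t) * norm (A t) + norm (A t - A t))) (at t within S)"
      using X A t unfolding continuous_on_def by (intro tendsto_intros) auto
    then have "((\<lambda>s. C * (norm (X s - X t) * norm (A s) + norm (A s - A t))) \<longlongrightarrow> 0) (at t within S)"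
      by (simp only: diff_self norm_zero mult_zero_left mult_zero_right add_0)
    then have "((\<lambda>s. point_rep (X s) (A s) - point_rep (X t) (A t)) \<longlongrightarrow> 0) (at t within S)"
      by (rule Lim_null_comparison[OF always_eventually[OF allI[OF point_rep_diff]]])
    then show "((\<lambda>s. point_rep (X s) (A s)) \<longlongrightarrow> point_rep (X t) (A t)) (at t within S)"
      by (rule LIM_zero_cancel)
  qed
  moreover have "continuous_on S (\<lambda>t. dir_rep (X t) (U t) (B t))"
    unfolding continuous_on_def
  proof safe
    fix t assume t: "t \<in> S"
    have "((\<lambda>s. C * (norm (X s - X t) * norm (U s) * norm (B s) + norm (U s - U t) * norm (B s) + norm (U t) * norm (B s - B t))) \<longlongrightarrow>
        C * (norm (X t - X t) * norm (U t) * norm (B t) + norm (U t - U t) * norm (B t) + norm (U t) * norm (B t - B t))) (at t within S)"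
      using X U B t unfolding continuous_on_def by (intro tendsto_intros) auto
    then have "((\<lambda>s. C * (norm (X s - X t) * norm (U s) * norm (B s) + norm (U s - U t) * norm (B s) + norm (U t) * norm (B s - B t))) \<longlongrightarrow> 0) (at t within S)"
      by (simp only: diff_self norm_zero mult_zero_left mult_zero_right add_0)
    then have "((\<lambda>s. dir_rep (X s) (U s) (B s) - dir_rep (X t) (U t) (B t)) \<longlongrightarrow> 0) (at t within S)"
      by (rule Lim_null_comparison[OF always_eventually[OF allI[OF dir_rep_diff]]])
    then show "((\<lambda>s. dir_rep (X s) (U s) (B s)) \<longlongrightarrow> dir_rep (X t) (U t) (B t)) (at t within S)"
      by (rule LIM_zero_cancel)
  qed
  ultimately show ?thesis
    unfolding min_field_def by (intro continuous_on_add continuous_on_scaleR continuous_on_const)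
qed

end

section \<open>Angles and arc length\<close>

lemma abs_inner_unit_le:
  fixes x y :: "'a::real_inner"
  assumes "norm x = 1" "norm y = 1"
  shows "\<bar>x \<bullet> y\<bar> \<le> 1"
  using Cauchy_Schwarz_ineq2[of x y] assms by simp

lemma arccos_inner_eq_0D:
  fixes x y :: "'a::real_inner"
  assumes "norm x = 1" "norm y = 1" "arccos (x \<bullet> y) = 0"
  shows "x = y"
proof -
  have "x \<bullet> y = 1"
    using cos_arccos_abs[OF abs_inner_unit_le[OF assms(1,2)]] assms(3) by simp
  then have "(x - y) \<bullet> (x - y) = 0"
    using assms(1,2)[unfolded norm_eq_1] by (simp add: inner_diff_left inner_diff_right inner_commute)
  then show ?thesis by simp
qed

text \<open>Split \<open>x\<close> and \<open>z\<close> into components along \<open>y\<close> and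
  orthogonal to it. Cauchy-Schwarz for the orthogonal components compares
  \<open>x \<bullet> z\<close> with the cosine of the sum of the two angles; if that sum exceeds
  \<open>pi\<close>, nothing is left to prove.\<close>

lemma arccos_triangle:
  fixes x y z :: "'a::real_inner"
  assumes "norm x = 1" "norm y = 1" "norm z = 1"
  shows "arccos (x \<bullet> z) \<le> arccos (x \<bullet> y) + arccos (y \<bullet> z)"
proof -
  note le = abs_inner_unit_le[OF assms(1,2)] abs_inner_unit_le[OF assms(2,3)] abs_inner_unit_le[OF assms(1,3)]
  have y: "y \<bullet> y = 1" using assms by (simp add: dot_square_norm)
  have sin: "sin (arccos (w \<bullet> y)) = norm (w - (w \<bullet> y) *\<^sub>R y)" if "norm w = 1" for w :: 'a
  proof -
    have "w \<bullet> w = 1" using that by (simp add: dot_square_norm)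
    then have "(norm (w - (w \<bullet> y) *\<^sub>R y))\<^sup>2 = 1 - (w \<bullet> y)\<^sup>2"
      using y unfolding power2_norm_eq_inner
      by (simp add: inner_diff_left inner_diff_right inner_commute[of y w] power2_eq_square)
    then have "norm (w - (w \<bullet> y) *\<^sub>R y) = sqrt (1 - (w \<bullet> y)\<^sup>2)"
      by (metis norm_ge_zero real_sqrt_unique)
    then show ?thesis
      using abs_inner_unit_le[OF that assms(2)] by (simp add: sin_arccos_abs)
  qed
  show ?thesis
  proof (cases "arccos (x \<bullet> y) + arccos (y \<bullet> z) \<le> pi")
    case True
    have "- ((x - (x \<bullet> y) *\<^sub>R y) \<bullet> (z - (z \<bullet> y) *\<^sub>R y)) \<le>
        norm (x - (x \<bullet> y) *\<^sub>R y) * norm (z - (z \<bullet> y) *\<^sub>R y)"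
      using Cauchy_Schwarz_ineq2[of "x - (x \<bullet> y) *\<^sub>R y" "z - (z \<bullet> y) *\<^sub>R y"] by linarith
    then have "cos (arccos (x \<bullet> y) + arccos (y \<bullet> z)) \<le> x \<bullet> z"
      using le y sin[OF assms(1)] sin[OF assms(3)]
      by (simp add: cos_add inner_commute[of y z] cos_arccos_abs inner_diff_left inner_diff_right)
    then have "arccos (x \<bullet> z) \<le> arccos (cos (arccos (x \<bullet> y) + arccos (y \<bullet> z)))"
      using le by (intro arccos_le_arccos) auto
    also have "\<dots> = arccos (x \<bullet> y) + arccos (y \<bullet> z)"
      using True le by (intro arccos_cos add_nonneg_nonneg arccos_lbound) auto
    finally show ?thesis .
  next
    case False
    then show ?thesis
      using arccos_ubound[of "x \<bullet> z"] le by linarith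
  qed
qed

text \<open>Nearby unit vectors have inner product near 1, where \<open>arccos\<close> is not
  differentiable. The half-angle formula moves the question to \<open>arcsin\<close> at 0, where the
  derivative is 1.\<close>

lemma arccos_inner_eq_arcsin:
  fixes x y :: "'a::real_inner"
  assumes "norm x = 1" "norm y = 1"
  shows "arccos (x \<bullet> y) = 2 * arcsin (norm (x - y) / 2)"
proof -
  let ?d = "norm (x - y) / 2"
  have d: "0 \<le> ?d" "?d \<le> 1"
    using norm_triangle_ineq4[of x y] assms by auto
  have "(norm (x - y))\<^sup>2 = 2 - 2 * (x \<bullet> y)"
    using assms[unfolded norm_eq_1]
    by (simp add: power2_norm_eq_inner inner_diff_left inner_diff_right inner_commute[of y x])
  moreover have sin: "sin (arcsin ?d) = ?d"
    using d by (intro sin_arcsin) linarith+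
  ultimately have "cos (2 * arcsin ?d) = x \<bullet> y"
    unfolding cos_double_sin sin by (simp add: power_divide field_simps)
  moreover have "arccos (cos (2 * arcsin ?d)) = 2 * arcsin ?d"
  proof (rule arccos_cos)
    show "0 \<le> 2 * arcsin ?d"
      using d arcsin_le_arcsin[of 0 ?d] by simp
    have "arcsin ?d \<le> pi / 2"
      using d by (intro arcsin_ubound) linarith+
    then show "2 * arcsin ?d \<le> pi" by simp
  qed
  ultimately show ?thesis by simp
qed

text \<open>Angle and chord agree to first order, uniformly on the sphere, because the angle is a
  function of the length of the chord.\<close>

lemma arccos_le_chord:
  assumes "e > 0"
  obtains \<delta> where "\<delta> > 0"
    "\<And>x y :: 'a::real_inner. norm x = 1 \<Longrightarrow> norm y = 1 \<Longrightarrow> norm (x - y) < \<delta> \<Longrightarrow>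
      arccos (x \<bullet> y) \<le> (1 + e) * norm (x - y)"
proof -
  have "(arcsin has_real_derivative inverse (sqrt (1 - 0\<^sup>2))) (at 0)"
    by (rule DERIV_arcsin) auto
  then have "((\<lambda>h. arcsin h / h) \<longlongrightarrow> 1) (at 0)"
    by (simp add: DERIV_def)
  from tendstoD[OF this assms] obtain d where d: "d > 0"
      "\<And>h. h \<noteq> 0 \<Longrightarrow> dist h 0 < d \<Longrightarrow> dist (arcsin h / h) 1 < e"
    unfolding eventually_at by auto
  show ?thesis
  proof (rule that[of "2 * d"])
    fix x y :: 'a
    assume xy: "norm x = 1" "norm y = 1" "norm (x - y) < 2 * d"
    let ?h = "norm (x - y) / 2"
    have "arcsin ?h \<le> (1 + e) * ?h"
    proof (cases "?h = 0")
      case False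
      then have "arcsin ?h / ?h < 1 + e"
        using d(2)[of ?h] xy by (simp add: dist_real_def abs_less_iff)
      then show ?thesis
        using False by (simp add: pos_divide_less_eq split: if_splits)
    qed simp
    then show "arccos (x \<bullet> y) \<le> (1 + e) * norm (x - y)"
      unfolding arccos_inner_eq_arcsin[OF xy(1,2)] by (simp add: field_simps)
  qed (use d in auto)
qed

text \<open>Bisection as for the chain rule: angles are subadditive, and over short intervals they
  hardly exceed the chord, which the integral of the speed bounds.\<close>

lemma arccos_le_arc_length:
  fixes U :: "real \<Rightarrow> 'a::euclidean_space"
  assumes U: "primitive_on U U' a b" and unit: "\<And>t. t \<in> {a..b} \<Longrightarrow> norm (U t) = 1" and "a \<le> b"
  shows "arccos (U a \<bullet> U b) \<le> integral {a..b} (\<lambda>s. norm (U' s))"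
proof -
  note int = primitive_on_integrable(2)[OF U]
  have bound: "arccos (U a \<bullet> U b) \<le> (1 + e) * integral {a..b} (\<lambda>s. norm (U' s))" if e: "e > 0" for e
  proof -
    obtain \<delta> where \<delta>: "\<delta> > 0" "\<And>x y :: 'a. norm x = 1 \<Longrightarrow> norm y = 1 \<Longrightarrow> norm (x - y) < \<delta> \<Longrightarrow>
        arccos (x \<bullet> y) \<le> (1 + e) * norm (x - y)"
      using arccos_le_chord[OF e] by metis
    define P where "P s t \<longleftrightarrow> (a \<le> s \<and> s \<le> t \<and> t \<le> b \<longrightarrow>
      arccos (U s \<bullet> U t) \<le> (1 + e) * integral {s..t} (\<lambda>s. norm (U' s)))" for s t
    have "a \<le> b" by fact
    then have "P a b"
    proof (induction a b rule: Bolzano)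
      case (trans s q t)
      show ?case
        unfolding P_def
      proof safe
        assume st: "a \<le> s" "s \<le> t" "t \<le> b"
        have "arccos (U s \<bullet> U t) \<le> arccos (U s \<bullet> U q) + arccos (U q \<bullet> U t)"
          using st trans(3,4) by (intro arccos_triangle unit) auto
        also have "\<dots> \<le> (1 + e) * (integral {s..q} (\<lambda>s. norm (U' s)) + integral {q..t} (\<lambda>s. norm (U' s)))"
          using trans st by (auto simp: P_def algebra_simps)
        also have "integral {s..q} (\<lambda>s. norm (U' s)) + integral {q..t} (\<lambda>s. norm (U' s)) = integral {s..t} (\<lambda>s. norm (U' s))"
          using st trans(3,4)
          by (intro Henstock_Kurzweil_Integration.integral_combine integrable_on_Icc_subset[OF int]) auto
        finally show "arccos (U s \<bullet> U t) \<le> (1 + e) * integral {s..t} (\<lambda>s. norm (U' s))" .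
      qed
    next
      case (local x)
      obtain d where d: "d > 0" "\<And>s. s \<in> {a..b} \<Longrightarrow> dist s x < d \<Longrightarrow> dist (U s) (U x) < \<delta> / 2"
        using primitive_on_continuous[OF U] local \<delta>(1) unfolding continuous_on_iff
        by (metis atLeastAtMost_iff half_gt_zero)
      have "P s t" if st: "s \<le> x" "x \<le> t" "t - s < d" for s t
        unfolding P_def
      proof safe
        assume ab: "a \<le> s" "s \<le> t" "t \<le> b"
        have "dist (U s) (U x) < \<delta> / 2" "dist (U t) (U x) < \<delta> / 2"
          by (rule d(2); use st ab in \<open>simp add: dist_real_def\<close>)+
        then have "norm (U s - U t) < \<delta>"
          using dist_triangle_half_l[of "U s" "U x" \<delta> "U t"] by (simp add: dist_norm dist_commute)
        then have "arccos (U s \<bullet> U t) \<le> (1 + e) * norm (U s - U t)"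
          using st ab by (intro \<delta>(2) unit) auto
        also have "\<dots> \<le> (1 + e) * integral {s..t} (\<lambda>s. norm (U' s))"
          using primitive_on_norm_increment[OF U ab] e by (simp add: norm_minus_commute)
        finally show "arccos (U s \<bullet> U t) \<le> (1 + e) * integral {s..t} (\<lambda>s. norm (U' s))" .
      qed
      then show ?case using d(1) by blast
    qed
    then show ?thesis using \<open>a \<le> b\<close> by (simp add: P_def)
  qed
  let ?N = "integral {a..b} (\<lambda>s. norm (U' s))"
  have N: "?N \<ge> 0" by (rule integral_nonneg[OF int]) auto
  show ?thesis
  proof (rule field_le_epsilon)
    fix e :: real assume e: "e > 0"
    have "arccos (U a \<bullet> U b) \<le> (1 + e / (?N + 1)) * ?N"
      using N e by (intro bound) auto
    also have "\<dots> = ?N + e * (?N / (?N + 1))"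
      by (simp add: distrib_right)
    also have "\<dots> \<le> ?N + e * 1"
      using N e by (intro add_left_mono mult_left_mono) (auto simp: divide_le_eq)
    finally show "arccos (U a \<bullet> U b) \<le> ?N + e" by simp
  qed
qed

section \<open>The energy bound\<close>

lemma lebesgue_on_Icc_integral:
  fixes f :: "real \<Rightarrow> 'b::euclidean_space"
  assumes "integrable (lebesgue_on {a..b}) f"
  shows "f absolutely_integrable_on {a..b}" "integral\<^sup>L (lebesgue_on {a..b}) f = integral {a..b} f"
proof -
  show "f absolutely_integrable_on {a..b}"
    unfolding set_integrable_def
    by (subst integrable_restrict_space[symmetric]) (simp, rule assms)
  show "integral\<^sup>L (lebesgue_on {a..b}) f = integral {a..b} f"
    by (rule lebesgue_integral_eq_integral[OF assms]) simp
qed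

lemma absolutely_integrable_imp_lebesgue_on:
  fixes f :: "real \<Rightarrow> 'b::euclidean_space"
  assumes "f absolutely_integrable_on {a..b}"
  shows "integrable (lebesgue_on {a..b}) f"
  by (subst integrable_restrict_space) (simp, rule assms[unfolded set_integrable_def])

lemma primitive_on_of_lebesgue:
  fixes X p :: "real \<Rightarrow> 'b::euclidean_space"
  assumes "\<And>t. t \<in> {0..1} \<Longrightarrow> integrable (lebesgue_on {0..t}) p"
    and eq: "\<And>t. t \<in> {0..1} \<Longrightarrow> X t = X0 + integral\<^sup>L (lebesgue_on {0..t}) p"
  shows "primitive_on X p 0 1" "X 0 = X0"
proof -
  have eq': "X t = X0 + integral {0..t} p" if "t \<in> {0..1}" for t
    using eq[OF that] lebesgue_on_Icc_integral(2)[OF assms(1)[OF that]] by simp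
  show X0: "X 0 = X0" using eq'[of 0] by simp
  show "primitive_on X p 0 1"
    by (rule primitive_onI) (use lebesgue_on_Icc_integral(1)[OF assms(1)[of 1]] eq' X0 in auto)
qed

lemma L2_integrable:
  fixes f :: "real \<Rightarrow> 'b::real_normed_vector"
  assumes "f \<in> L2_unit_interval"
  shows "(\<lambda>t. (norm (f t))\<^sup>2) absolutely_integrable_on {0..1}"
    "integrable (lebesgue_on {0..1}) (\<lambda>t. norm (f t))"
    "(\<lambda>t. norm (f t)) integrable_on {0..1}"
proof -
  have m: "f \<in> borel_measurable (lebesgue_on {0..1})"
      and i: "integrable (lebesgue_on {0..1}) (\<lambda>t. (norm (f t))\<^sup>2)"
    using assms by (auto simp: L2_unit_interval_def)
  show "(\<lambda>t. (norm (f t))\<^sup>2) absolutely_integrable_on {0..1}"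
    by (rule lebesgue_on_Icc_integral(1)[OF i])
  have "finite_measure (lebesgue_on {0..1::real})"
    by (rule finite_measure_lebesgue_on) simp
  then have c: "integrable (lebesgue_on {0..1}) (\<lambda>t::real. 1 + (norm (f t))\<^sup>2)"
    by (intro Bochner_Integration.integrable_add i finite_measure.integrable_const)
  show n: "integrable (lebesgue_on {0..1}) (\<lambda>t. norm (f t))"
  proof (rule Bochner_Integration.integrable_bound[OF c])
    show "(\<lambda>t. norm (f t)) \<in> borel_measurable (lebesgue_on {0..1})" using m by measurable
    have "norm (norm (f t)) \<le> norm (1 + (norm (f t))\<^sup>2)" for t
    proof -
      have "0 \<le> (norm (f t) - 1)\<^sup>2" by simp
      then have "norm (f t) * 2 \<le> 1 + (norm (f t))\<^sup>2"
        by (simp add: power2_eq_square algebra_simps)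
      then have "norm (f t) \<le> 1 + (norm (f t))\<^sup>2"
        using norm_ge_zero[of "f t"] by linarith
      then show ?thesis by simp
    qed
    then show "AE t in lebesgue_on {0..1}. norm (norm (f t)) \<le> norm (1 + (norm (f t))\<^sup>2)"
      by simp
  qed
  show "(\<lambda>t. norm (f t)) integrable_on {0..1}"
    using lebesgue_on_Icc_integral(1)[OF n] by (simp add: absolutely_integrable_on_def)
qed

text \<open>No condition at time 1 is included, so that the locale also applies to a control whose
  end point is still to be computed.\<close>

locale dirac_control = radial_rkhs ev K \<rho> d \<sigma> \<tau>
  for ev :: "'v::{real_inner,complete_space} \<Rightarrow> real^'n \<Rightarrow> real^'n" and K \<rho> d \<sigma> \<tau> +
  fixes \<gamma> r0 :: real and x0 u0 :: "real^'n"
    and v :: "real \<Rightarrow> 'v" and \<eta> :: "real \<Rightarrow> real" and \<phi> :: "real \<Rightarrow> real^'n \<Rightarrow> real^'n"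
  assumes \<gamma>_pos: "0 < \<gamma>" and r0_pos: "0 < r0" and u0: "norm u0 = 1"
    and v_L2: "v \<in> L2_unit_interval" and \<eta>_L2: "\<eta> \<in> L2_unit_interval"
    and is_flow: "is_flow ev v \<phi>"
begin

sublocale regular_flow "\<lambda>s. ev (v s)" "\<lambda>s. dev (v s)" "\<lambda>s. C * norm (v s)" \<phi>
proof (rule regular_flow.intro)
  show "(\<lambda>s. C * norm (v s)) integrable_on {0..1}"
    using L2_integrable(3)[OF v_L2] by (rule integrable_on_mult_right)
  have flow: "integrable (lebesgue_on {0..t}) (\<lambda>s. ev (v s) (\<phi> s x))"
      "\<phi> t x = x + integral\<^sup>L (lebesgue_on {0..t}) (\<lambda>s. ev (v s) (\<phi> s x))" if "t \<in> {0..1}" for t x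
    using is_flow that unfolding is_flow_def by blast+
  show "primitive_on (\<lambda>t. \<phi> t x) (\<lambda>s. ev (v s) (\<phi> s x)) 0 1" for x
    by (rule primitive_on_of_lebesgue(1)[OF flow])
  show "\<phi> 0 x = x" for x
    by (rule primitive_on_of_lebesgue(2)[OF flow])
  show "linear (dev (v s) y)" for s y
    by (rule dev_linear)
qed (use C(1) ev_lipschitz dev_bound ev_taylor in auto)

definition c :: real where "c = sqrt (\<gamma> * r0 / \<tau>)"

definition w :: "real \<Rightarrow> real^'n" where "w t = frechet_derivative (\<phi> t) (at x0) u0"

abbreviation "b t \<equiv> dev (v t) (\<phi> t x0) (sgn (w t))"

lemma c_pos: "0 < c"
  using \<gamma>_pos r0_pos \<tau>_pos by (simp add: c_def)

lemma c_squared: "\<tau> * c\<^sup>2 = \<gamma> * r0"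
  using \<gamma>_pos r0_pos \<tau>_pos by (simp add: c_def)

section \<open>Evolution of the transported vector, the weight and the coordinate of the
  half-plane\<close>

lemma w_primitive: "primitive_on w (\<lambda>s. dev (v s) (\<phi> s x0) (w s)) 0 1"
  and w_0: "w 0 = u0"
proof -
  obtain W where W: "\<And>t. t \<in> {0..1} \<Longrightarrow> (\<phi> t has_derivative W t) (at x0)"
      "\<And>k. W 0 k = k" "\<And>k. primitive_on (\<lambda>t. W t k) (\<lambda>s. dev (v s) (\<phi> s x0) (W s k)) 0 1"
    by (rule flow_derivative[of x0]) (rule that)
  have w: "w t = W t u0" if "t \<in> {0..1}" for t
    unfolding w_def frechet_derivative_at[OF W(1)[OF that], symmetric] ..
  show "w 0 = u0" using w[of 0] W(2)[of u0] by simp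
  show "primitive_on w (\<lambda>s. dev (v s) (\<phi> s x0) (w s)) 0 1"
    by (rule primitive_on_cong[OF W(3)[of u0]]) (auto simp: w)
qed

lemma w_nonzero: "t \<in> {0..1} \<Longrightarrow> w t \<noteq> 0"
  using linearized_nonzero[OF w_primitive] w_0 u0 by fastforce

lemma norm_sgn_w: "t \<in> {0..1} \<Longrightarrow> norm (sgn (w t)) = 1"
  by (simp add: norm_sgn w_nonzero)

lemma w_eq: "w t = norm (w t) *\<^sub>R sgn (w t)"
  by (cases "w t = 0") (simp_all add: sgn_div_norm)

lemma dev_w: "dev (v t) (\<phi> t x0) (w t) = norm (w t) *\<^sub>R b t"
  by (subst w_eq) (rule linear_scale[OF dev_linear])

lemma weight_primitive: "primitive_on (weight \<eta>) (\<lambda>s. \<eta> s / 2) 0 1"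
  and weight_0: "weight \<eta> 0 = 1"
proof -
  have m: "\<eta> \<in> borel_measurable (lebesgue_on {0..1})"
    using \<eta>_L2 by (auto simp: L2_unit_interval_def)
  have "integrable (lebesgue_on {0..1}) \<eta>"
    by (rule integrable_norm_cancel[OF L2_integrable(2)[OF \<eta>_L2] m])
  then have ai: "\<eta> absolutely_integrable_on {0..1}"
    by (rule lebesgue_on_Icc_integral)
  have int: "integrable (lebesgue_on {0..t}) \<eta>" if "t \<in> {0..1}" for t
    by (rule absolutely_integrable_imp_lebesgue_on[OF absolutely_integrable_on_subinterval[OF ai]])
      (use that in auto)
  have P: "primitive_on (\<lambda>t. 2 * weight \<eta> t) \<eta> 0 1"
    by (rule primitive_on_of_lebesgue(1)[of _ _ 2]) (use int in \<open>auto simp: weight_def\<close>)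
  show "primitive_on (weight \<eta>) (\<lambda>s. \<eta> s / 2) 0 1"
    using primitive_on_linear[OF P _ bounded_linear_mult_right[of "1 / 2"]] by simp
  show "weight \<eta> 0 = 1"
    using lebesgue_on_Icc_integral(2)[OF int[of 0]] by (simp add: weight_def)
qed

text \<open>The derivative of \<open>sgn\<close> projects onto the complement of the direction and
  divides by the length; by linearity of the field's derivative that length cancels.\<close>

lemma direction_primitive: "primitive_on (\<lambda>t. sgn (w t)) (\<lambda>t. b t - (sgn (w t) \<bullet> b t) *\<^sub>R sgn (w t)) 0 1"
proof -
  let ?F' = "\<lambda>(y::real^'n) h. inverse (norm y) *\<^sub>R (h - (sgn y \<bullet> h) *\<^sub>R sgn y)"
  have P: "primitive_on (\<lambda>t. sgn (w t)) (\<lambda>t. ?F' (w t) (dev (v t) (\<phi> t x0) (w t))) 0 1"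
  proof (rule primitive_on_chain[OF w_primitive _ open_delete[OF open_UNIV, of 0], where F' = ?F'])
    fix y :: "real^'n" assume "y \<in> UNIV - {0}"
    then have y: "y \<noteq> 0" by simp
    have "((\<lambda>y. inverse (norm y) *\<^sub>R y) has_derivative ?F' y) (at y)"
      using y by (auto intro!: derivative_eq_intros has_derivative_norm simp: sgn_div_norm algebra_simps inner_commute)
    then show "(sgn has_derivative ?F' y) (at y)"
      by (simp add: sgn_div_norm[abs_def])
  next
    fix h :: "real^'n"
    show "continuous_on (UNIV - {0}) (\<lambda>y. ?F' y h)"
      unfolding sgn_div_norm by (intro continuous_intros) auto
  qed (use w_nonzero in auto)
  show ?thesis
  proof (rule primitive_on_cong[OF P])
    show "b t - (sgn (w t) \<bullet> b t) *\<^sub>R sgn (w t) = ?F' (w t) (dev (v t) (\<phi> t x0) (w t))" if "t \<in> {0..1}" for t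
      unfolding dev_w using w_nonzero[OF that] by (simp add: algebra_simps)
  qed auto
qed

text \<open>With \<open>y = 1 / sqrt \<bar>w\<bar>\<close>, the pair \<open>(c * weight, y)\<close> moves in the hyperbolic half-plane, and the
  weight part of the energy is a multiple of its hyperbolic energy. The targets with a given mass
  form a ray through the origin; \<open>B\<close> is the signed hyperbolic distance from the vertical ray.\<close>

definition B :: "real \<Rightarrow> real"
  where "B t = arsinh (c * weight \<eta> t * sqrt (norm (w t)))"

text \<open>\<open>sgn (w t) \<bullet> b t\<close> is the logarithmic derivative of
  \<open>norm (w t)\<close>; its half belongs to the square root.\<close>

definition B' :: "real \<Rightarrow> real"
  where "B' t = c * sqrt (norm (w t)) * (\<eta> t / 2 + weight \<eta> t * (sgn (w t) \<bullet> b t) / 2) /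
    sqrt ((c * weight \<eta> t * sqrt (norm (w t)))\<^sup>2 + 1)"

lemma B_primitive: "primitive_on B B' 0 1"
proof -
  let ?D = "\<lambda>p::(real^'n) \<times> real. sqrt ((c * snd p * sqrt (norm (fst p)))\<^sup>2 + 1)"
  let ?F' = "\<lambda>(p::(real^'n) \<times> real) h. c * (snd h * sqrt (norm (fst p)) +
    snd p * ((sgn (fst p) \<bullet> fst h) / (2 * sqrt (norm (fst p))))) / ?D p"
  let ?F = "\<lambda>p::(real^'n) \<times> real. arsinh (c * snd p * sqrt (norm (fst p)))"
  let ?g' = "\<lambda>t. (dev (v t) (\<phi> t x0) (w t), \<eta> t / 2)"
  have D_pos: "?D p > 0" for p by (simp add: add_nonneg_pos)
  have P: "primitive_on (\<lambda>t. ?F (w t, weight \<eta> t)) (\<lambda>t. ?F' (w t, weight \<eta> t) (?g' t)) 0 1"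
  proof (rule primitive_on_chain[OF primitive_on_Pair[OF w_primitive weight_primitive], where F' = ?F'])
    show "open ((UNIV - {0::real^'n}) \<times> (UNIV :: real set))"
      by (intro open_Times open_delete open_UNIV)
    fix p assume p: "p \<in> (UNIV - {0::real^'n}) \<times> (UNIV :: real set)"
    then have p: "fst p \<noteq> 0" by auto
    have "((\<lambda>p. norm (fst p)) has_derivative (\<lambda>h. fst h \<bullet> sgn (fst p))) (at p)"
      by (rule has_derivative_compose[OF has_derivative_fst[OF has_derivative_ident] has_derivative_norm[OF p]])
    from DERIV_compose_FDERIV[OF DERIV_real_sqrt this] p
    have "((\<lambda>p. sqrt (norm (fst p))) has_derivative
        (\<lambda>h. (fst h \<bullet> sgn (fst p)) * (inverse (sqrt (norm (fst p))) / 2))) (at p)"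
      by simp
    from has_derivative_mult[OF has_derivative_mult_right[OF has_derivative_snd[OF has_derivative_ident], of c] this]
    have "((\<lambda>p. c * snd p * sqrt (norm (fst p))) has_derivative
        (\<lambda>h. c * snd p * ((fst h \<bullet> sgn (fst p)) * (inverse (sqrt (norm (fst p))) / 2)) +
          c * snd h * sqrt (norm (fst p)))) (at p)"
      by simp
    then have "(?F has_derivative (\<lambda>h. (c * snd p * ((fst h \<bullet> sgn (fst p)) * (inverse (sqrt (norm (fst p))) / 2)) +
          c * snd h * sqrt (norm (fst p))) * (1 / ?D p))) (at p)"
      by (rule DERIV_compose_FDERIV[rotated]) (rule arsinh_real_has_field_derivative)
    moreover have "(c * z * (i * (inverse q / 2)) + c * k * q) * (1 / D) = c * (k * q + z * (i / (2 * q))) / D"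
      for z i q k D :: real
      by (simp add: inverse_eq_divide add_divide_distrib distrib_left distrib_right mult_ac)
    ultimately show "(?F has_derivative ?F' p) (at p)"
      by (simp only: inner_commute[of "sgn (fst p)"])
  next
    fix h :: "(real^'n) \<times> real"
    show "continuous_on ((UNIV - {0::real^'n}) \<times> (UNIV :: real set)) (\<lambda>p. ?F' p h)"
      using D_pos unfolding sgn_div_norm
      by (intro continuous_intros) (auto simp: less_imp_neq[symmetric])
  qed (use w_nonzero in auto)
  show ?thesis
  proof (rule primitive_on_cong[OF P])
    show "B t = ?F (w t, weight \<eta> t)" for t by (simp add: B_def)
    show "B' t = ?F' (w t, weight \<eta> t) (?g' t)" if t: "t \<in> {0..1}" for t
    proof -
      have "norm (w t) * x / (2 * sqrt (norm (w t))) = sqrt (norm (w t)) * (x / 2)" for x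
        using w_nonzero[OF t] real_sqrt_mult_self[of "norm (w t)"] by (simp add: field_simps)
      then have "(sgn (w t) \<bullet> (norm (w t) *\<^sub>R b t)) / (2 * sqrt (norm (w t))) =
          sqrt (norm (w t)) * ((sgn (w t) \<bullet> b t) / 2)"
        by (simp only: inner_scaleR_right)
      then show ?thesis
        unfolding dev_w fst_conv snd_conv B'_def by (simp only:) (simp add: algebra_simps)
    qed
  qed
qed

section \<open>Energy density and lower bound\<close>

definition E :: "real \<Rightarrow> real"
  where "E t = (norm (v t))\<^sup>2 + \<gamma> * (\<eta> t)\<^sup>2 * norm (w t) * r0"

lemma weight_term_absolutely_integrable:
  "(\<lambda>t. (\<eta> t)\<^sup>2 * norm (w t) * r0) absolutely_integrable_on {0..1}"
proof -
  have "continuous_on {0..1} (\<lambda>t. norm (w t) * r0)"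
    by (intro continuous_intros primitive_on_continuous[OF w_primitive])
  from absolutely_integrable_continuous_scaleR[OF this L2_integrable(1)[OF \<eta>_L2]]
  show ?thesis by (simp add: mult.assoc)
qed

lemma E_integrable: "E integrable_on {0..1}"
proof -
  have "(\<lambda>t. (norm (v t))\<^sup>2 + \<gamma> * ((\<eta> t)\<^sup>2 * norm (w t) * r0)) integrable_on {0..1}"
    using L2_integrable(1)[OF v_L2] weight_term_absolutely_integrable
    by (intro integrable_add integrable_on_mult_right) (auto simp: absolutely_integrable_on_def)
  then show ?thesis by (simp add: E_def[abs_def] mult.assoc)
qed

lemma energy_eq: "energy \<gamma> r0 x0 u0 (v, \<eta>, \<phi>) = 1/2 * integral {0..1} E"
proof -
  note ai = L2_integrable(1)[OF v_L2] weight_term_absolutely_integrable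
  have "integral {0..1} E = integral {0..1} (\<lambda>t. (norm (v t))\<^sup>2 + \<gamma> * ((\<eta> t)\<^sup>2 * norm (w t) * r0))"
    by (simp add: E_def[abs_def] mult.assoc)
  also have "\<dots> = integral {0..1} (\<lambda>t. (norm (v t))\<^sup>2) + \<gamma> * integral {0..1} (\<lambda>t. (\<eta> t)\<^sup>2 * norm (w t) * r0)"
    using ai by (subst integral_add)
      (auto simp: absolutely_integrable_on_def intro: integrable_on_mult_right)
  finally show ?thesis
    unfolding energy_def w_def[symmetric] split
    using lebesgue_on_Icc_integral(2)[OF absolutely_integrable_imp_lebesgue_on[OF ai(1)]]
      lebesgue_on_Icc_integral(2)[OF absolutely_integrable_imp_lebesgue_on[OF ai(2)]]
    by (simp add: algebra_simps)
qed

abbreviation "U' t \<equiv> b t - (sgn (w t) \<bullet> b t) *\<^sub>R sgn (w t)"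

lemma energy_density_bound:
  assumes t: "t \<in> {0..1}"
  shows "(norm (ev (v t) (\<phi> t x0)))\<^sup>2 + \<tau> * (norm (U' t))\<^sup>2 + 4 * \<tau> * (B' t)\<^sup>2 \<le> E t"
proof -
  define p where "p = sgn (w t) \<bullet> b t"
  define q where "q = sqrt (norm (w t))"
  define z where "z = weight \<eta> t"
  have "sgn (w t) \<bullet> sgn (w t) = 1"
    using norm_sgn_w[OF t] by (simp add: dot_square_norm)
  then have split: "(norm (U' t))\<^sup>2 + p\<^sup>2 = (norm (b t))\<^sup>2"
    unfolding power2_norm_eq_inner p_def
    by (simp add: inner_diff_left inner_diff_right inner_commute[of "b t" "sgn (w t)"] power2_eq_square)
  \<comment> \<open>Cauchy-Schwarz for the plane vectors
    \<open>(c * q * \<eta> t / 2, p / 2)\<close> and \<open>(1, c * z * q)\<close>: the half-plane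
    coordinate has a hyperbolic gradient of length one. The optimal control will realize the case of
    equality.\<close>
  have "(c * q * (\<eta> t / 2 + z * p / 2))\<^sup>2 \<le> ((c * q * \<eta> t / 2)\<^sup>2 + (p / 2)\<^sup>2) * ((c * z * q)\<^sup>2 + 1)"
  proof -
    have "((c * q * \<eta> t / 2)\<^sup>2 + (p / 2)\<^sup>2) * ((c * z * q)\<^sup>2 + 1) - (c * q * (\<eta> t / 2 + z * p / 2))\<^sup>2 =
        (c * q * \<eta> t / 2 * (c * z * q) - p / 2)\<^sup>2"
      by (simp add: power2_eq_square field_simps)
    then show ?thesis using zero_le_power2[of "c * q * \<eta> t / 2 * (c * z * q) - p / 2"] by linarith
  qed
  moreover have "(c * z * q)\<^sup>2 + 1 > 0" by (simp add: add_nonneg_pos)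
  ultimately have "(B' t)\<^sup>2 \<le> (c * q * \<eta> t / 2)\<^sup>2 + (p / 2)\<^sup>2"
    unfolding B'_def p_def[symmetric] q_def[symmetric] z_def[symmetric]
    by (simp add: power_divide pos_divide_le_eq)
  then have "4 * \<tau> * (B' t)\<^sup>2 \<le> 4 * \<tau> * ((c * q * \<eta> t / 2)\<^sup>2 + (p / 2)\<^sup>2)"
    using \<tau>_pos by (intro mult_left_mono) auto
  also have "\<dots> = (\<tau> * c\<^sup>2) * q\<^sup>2 * (\<eta> t)\<^sup>2 + \<tau> * p\<^sup>2"
    by (simp add: power2_eq_square algebra_simps)
  also have "\<dots> = \<gamma> * (\<eta> t)\<^sup>2 * norm (w t) * r0 + \<tau> * p\<^sup>2"
    unfolding c_squared by (simp add: q_def)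
  finally have "4 * \<tau> * (B' t)\<^sup>2 \<le> \<gamma> * (\<eta> t)\<^sup>2 * norm (w t) * r0 + \<tau> * p\<^sup>2" .
  moreover have "\<tau> * (norm (U' t))\<^sup>2 + \<tau> * p\<^sup>2 = \<tau> * (norm (b t))\<^sup>2"
    unfolding split[symmetric] by (simp add: distrib_left)
  moreover have "(norm (ev (v t) (\<phi> t x0)))\<^sup>2 + \<tau> * (norm (b t))\<^sup>2 \<le> (norm (v t))\<^sup>2"
    by (rule norm_ge_jet[OF norm_sgn_w[OF t]])
  ultimately show ?thesis
    unfolding E_def by linarith
qed

text \<open>Each square is bounded below by its tangent at the mean velocity, and this is
  integrated. The tangent is linear in the derivatives, so their integrability is enough and their
  squares need not be shown integrable.\<close>

theorem energy_lower_bound: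
  assumes "0 \<le> s" "s < t" "t \<le> 1"
  shows "((norm (\<phi> t x0 - \<phi> s x0))\<^sup>2 + \<tau> * (arccos (sgn (w s) \<bullet> sgn (w t)))\<^sup>2 + 4 * \<tau> * (B t - B s)\<^sup>2) / (t - s)
    \<le> integral {s..t} E"
proof -
  define L where "L = t - s"
  have L: "L > 0" using assms by (simp add: L_def)
  define mx where "mx = (\<phi> t x0 - \<phi> s x0) /\<^sub>R L"
  define mu where "mu = arccos (sgn (w s) \<bullet> sgn (w t)) / L"
  define mb where "mb = (B t - B s) / L"
  define X' where "X' r = ev (v r) (\<phi> r x0)" for r
  have X: "primitive_on (\<lambda>t. \<phi> t x0) X' 0 1"
    unfolding X'_def by (rule flow)
  let ?A = "\<lambda>r. 2 * (mx \<bullet> X' r) + 2 * \<tau> * mu * norm (U' r) + 8 * \<tau> * mb * B' r"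
  let ?c = "(norm mx)\<^sup>2 + \<tau> * mu\<^sup>2 + 4 * \<tau> * mb\<^sup>2"
  have le: "?A r - ?c \<le> E r" if r: "r \<in> {s..t}" for r
  proof -
    have "0 \<le> (norm (X' r - mx))\<^sup>2" by simp
    then have 1: "2 * (mx \<bullet> X' r) - (norm mx)\<^sup>2 \<le> (norm (X' r))\<^sup>2"
      unfolding power2_norm_eq_inner by (simp add: inner_diff_left inner_diff_right inner_commute)
    have "0 \<le> \<tau> * (norm (U' r) - mu)\<^sup>2" using \<tau>_pos by simp
    then have 2: "2 * \<tau> * mu * norm (U' r) - \<tau> * mu\<^sup>2 \<le> \<tau> * (norm (U' r))\<^sup>2"
      by (simp add: power2_eq_square algebra_simps)
    have "0 \<le> 4 * \<tau> * (B' r - mb)\<^sup>2" using \<tau>_pos by simp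
    then have 3: "8 * \<tau> * mb * B' r - 4 * \<tau> * mb\<^sup>2 \<le> 4 * \<tau> * (B' r)\<^sup>2"
      by (simp add: power2_eq_square algebra_simps)
    have "r \<in> {0..1}" using r assms by auto
    from energy_density_bound[OF this] 1 2 3 show ?thesis
      unfolding X'_def by linarith
  qed
  have sub: "g integrable_on {s..t}" if "g integrable_on {0..1}" for g :: "real \<Rightarrow> 'z::banach"
    by (rule integrable_on_Icc_subset[OF that]) (use assms in auto)
  note iX = integrable_integral[OF sub[OF primitive_on_integrable(1)[OF X]]]
  have hX: "((\<lambda>r. mx \<bullet> X' r) has_integral mx \<bullet> (\<phi> t x0 - \<phi> s x0)) {s..t}"
    using has_integral_linear[OF iX bounded_linear_inner_right[of mx]] primitive_on_increment[OF X, of s t] assms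
    by (simp add: o_def)
  note hU = integrable_integral[OF sub[OF primitive_on_integrable(2)[OF direction_primitive]]]
  have hB: "(B' has_integral (B t - B s)) {s..t}"
    using integrable_integral[OF sub[OF primitive_on_integrable(1)[OF B_primitive]]]
      primitive_on_increment[OF B_primitive, of s t] assms by simp
  let ?N = "integral {s..t} (\<lambda>r. norm (U' r))"
  have "(?A has_integral 2 * (mx \<bullet> (\<phi> t x0 - \<phi> s x0)) + 2 * \<tau> * mu * ?N + 8 * \<tau> * mb * (B t - B s)) {s..t}"
    by (intro has_integral_add has_integral_mult_right hX hU hB)
  moreover have "((\<lambda>r. ?c) has_integral L *\<^sub>R ?c) {s..t}"
    using has_integral_const_real[of ?c s t] assms by (simp add: L_def)
  ultimately have "((\<lambda>r. ?A r - ?c) has_integral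
      2 * (mx \<bullet> (\<phi> t x0 - \<phi> s x0)) + 2 * \<tau> * mu * ?N + 8 * \<tau> * mb * (B t - B s) - L *\<^sub>R ?c) {s..t}"
    by (rule has_integral_diff)
  from has_integral_le[OF this integrable_integral[OF sub[OF E_integrable]] le]
  have "2 * (mx \<bullet> (\<phi> t x0 - \<phi> s x0)) + 2 * \<tau> * mu * ?N + 8 * \<tau> * mb * (B t - B s) - L * ?c \<le> integral {s..t} E"
    by simp
  \<comment> \<open>The direction enters through its speed, whose integral is only bounded below by
    the angle; the sign of \<open>mu\<close> makes this usable.\<close>
  moreover have "2 * \<tau> * mu * (L * mu) \<le> 2 * \<tau> * mu * ?N"
  proof (intro mult_left_mono)
    have "primitive_on (\<lambda>t. sgn (w t)) U' s t"
    proof (rule primitive_onI)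
      show "U' absolutely_integrable_on {s..t}"
        by (rule absolutely_integrable_on_subinterval[OF primitive_on_absolutely_integrable[OF direction_primitive]])
          (use assms in auto)
      show "sgn (w r) = sgn (w s) + integral {s..r} U'" if "r \<in> {s..t}" for r
        using primitive_on_increment[OF direction_primitive, of s r] that assms by simp
    qed
    from arccos_le_arc_length[OF this] norm_sgn_w assms
    show "L * mu \<le> ?N" using L by (simp add: mu_def)
    have "\<bar>sgn (w s) \<bullet> sgn (w t)\<bar> \<le> 1"
      using assms by (intro abs_inner_unit_le norm_sgn_w) auto
    then show "0 \<le> 2 * \<tau> * mu"
      using \<tau>_pos L by (auto simp: mu_def intro!: mult_nonneg_nonneg divide_nonneg_nonneg arccos_lbound)
  qed
  moreover have "mx \<bullet> (\<phi> t x0 - \<phi> s x0) = L * (norm mx)\<^sup>2"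
    unfolding power2_norm_eq_inner mx_def using L by simp
  moreover have "8 * \<tau> * mb * (B t - B s) = 2 * (L * (4 * \<tau> * mb\<^sup>2))"
    using L by (simp add: mb_def power2_eq_square)
  ultimately have "L * ?c \<le> integral {s..t} E"
    by (simp add: algebra_simps power2_eq_square)
  moreover have "L * ?c = ((norm (\<phi> t x0 - \<phi> s x0))\<^sup>2 + \<tau> * (arccos (sgn (w s) \<bullet> sgn (w t)))\<^sup>2 + 4 * \<tau> * (B t - B s)\<^sup>2) / L"
  proof -
    have "norm mx = norm (\<phi> t x0 - \<phi> s x0) / L"
      using L by (simp add: mx_def divide_inverse mult.commute)
    then show ?thesis
      using L by (simp add: mu_def mb_def power2_eq_square add_divide_distrib distrib_left)
  qed
  ultimately show ?thesis by (simp only: L_def)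
qed

text \<open>Weight and length of the transported vector enter the mass only through the coordinate
  \<open>B\<close>, which therefore determines the varifold together with position and
  direction.\<close>

lemma varifold_path_eq:
  assumes "t \<in> {0..1}"
  shows "varifold_path r0 x0 u0 \<eta> \<phi> t = dirac_varifold (r0 * (sinh (B t) / c)\<^sup>2) (\<phi> t x0) (sgn (w t))"
proof -
  have eq: "(weight \<eta> t)\<^sup>2 * (r0 * norm (w t)) = r0 * (sinh (B t) / c)\<^sup>2"
    using c_pos by (simp add: B_def power_mult_distrib)
  have "0 \<le> r0 * norm (w t)" using r0_pos by simp
  then have "ennreal ((weight \<eta> t)\<^sup>2) * ennreal (r0 * norm (w t)) = ennreal (r0 * (sinh (B t) / c)\<^sup>2)"
    by (simp only: ennreal_mult[symmetric] zero_le_power2 eq)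
  then show ?thesis
    unfolding varifold_path_def push_dirac_def Let_def w_def[symmetric] dirac_varifold_def
    by (simp only: scale_scale_measure sgn_div_norm)
qed

end

section \<open>Existence of flows\<close>

text \<open>The contraction factor \<open>1/2\<close> is reached with the weight \<open>exp (- K * t)\<close> in the supremum norm.\<close>

lemma picard:
  fixes F :: "real \<Rightarrow> 'a::euclidean_space \<Rightarrow> 'a"
  assumes cont: "\<And>g. continuous_on {0..1} g \<Longrightarrow> continuous_on {0..1} (\<lambda>s. F s (g s))"
    and lip: "\<And>s y z. s \<in> {0..1} \<Longrightarrow> norm (F s y - F s z) \<le> L * norm (y - z)" and L: "0 \<le> L"
  shows "\<exists>X. continuous_on {0..1} X \<and> (\<forall>t\<in>{0..1}. X t = x + integral {0..t} (\<lambda>s. F s (X s)))"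
proof -
  \<comment> \<open>Gives \<open>L / K \<le> 1 / 2\<close> and stays positive for
    \<open>L = 0\<close>.\<close>
  define K where "K = 2 * L + 1"
  have K: "K > 0" using L by (simp add: K_def)
  \<comment> \<open>The complete space used below consists of bounded continuous functions on the
    whole line, so curves on the unit interval are extended by clamping the time.\<close>
  define cl where "cl t = max 0 (min 1 t)" for t :: real
  have cl: "cl t \<in> {0..1}" "t \<in> {0..1} \<Longrightarrow> cl t = t" for t by (auto simp: cl_def)
  \<comment> \<open>The unknown \<open>g\<close> is the solution multiplied by
    \<open>exp (- K * s)\<close>, which turns the weighted norm into the plain supremum
    norm.\<close>
  define G where "G g s = F s (exp (K * s) *\<^sub>R g s)" for g s
  define H where "H g t = exp (- K * t) *\<^sub>R (x + integral {0..t} (G g))" for g t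
  have G_cont: "continuous_on {0..1} (G g)" if "continuous_on {0..1} g" for g
    unfolding G_def by (intro cont continuous_intros that)
  have G_int: "G g integrable_on {0..t}" if "continuous_on {0..1} g" "t \<in> {0..1}" for g t
    by (rule integrable_continuous_real, rule continuous_on_subset[OF G_cont]) (use that in auto)
  have H_cont: "continuous_on {0..1} (H g)" if "continuous_on {0..1} g" for g
    unfolding H_def
    by (intro continuous_intros indefinite_integral_continuous_1 G_int[OF that]) auto
  have H_bcont: "(\<lambda>t. H g (cl t)) \<in> bcontfun" if "continuous_on {0..1} g" for g
  proof -
    have "continuous_on UNIV (\<lambda>t. H g (cl t))"
    proof (rule continuous_on_compose2[OF H_cont[OF that]])
      show "continuous_on UNIV cl" unfolding cl_def by (intro continuous_intros)
    qed (use cl in auto)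
    moreover have "bounded (range (\<lambda>t. H g (cl t)))"
      by (rule bounded_subset[OF compact_imp_bounded[OF compact_continuous_image[OF H_cont[OF that]]]])
        (use cl in auto)
    ultimately show ?thesis by (simp add: bcontfun_def)
  qed
  define T where "T g = Bcontfun (\<lambda>t. H (apply_bcontfun g) (cl t))" for g :: "real \<Rightarrow>\<^sub>C 'a"
  have T: "apply_bcontfun (T g) t = H g (cl t)" for g t
    unfolding T_def by (subst Bcontfun_inverse[OF H_bcont]) auto
  have "dist (T g) (T h) \<le> 1/2 * dist g h" for g h
  proof (rule dist_bound)
    fix t'
    define t where "t = cl t'"
    have t: "t \<in> {0..1}" unfolding t_def by (rule cl)
    let ?D = "dist g h"
    \<comment> \<open>Integrating the growth \<open>exp (K * s)\<close> produces the denominator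
      \<open>K\<close> of the contraction factor.\<close>
    have "((\<lambda>s. L * exp (K * s) * ?D) has_integral (L * exp (K * t) / K * ?D - L * exp (K * 0) / K * ?D)) {0..t}"
      using t K by (intro fundamental_theorem_of_calculus)
        (auto intro!: derivative_eq_intros simp flip: has_real_derivative_iff_has_vector_derivative)
    moreover have "L * exp (K * t) / K * ?D - L * exp (K * 0) / K * ?D = L * ?D / K * (exp (K * t) - 1)"
      by (simp add: right_diff_distrib diff_divide_distrib mult_ac)
    ultimately have I: "((\<lambda>s. L * exp (K * s) * ?D) has_integral (L * ?D / K * (exp (K * t) - 1))) {0..t}"
      by (simp only:)
    have "norm (integral {0..t} (G g) - integral {0..t} (G h)) = norm (integral {0..t} (\<lambda>s. G g s - G h s))"
      using t by (subst Henstock_Kurzweil_Integration.integral_diff) (auto intro!: G_int)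
    also have "\<dots> \<le> integral {0..t} (\<lambda>s. L * exp (K * s) * ?D)"
    proof (rule integral_norm_bound_integral)
      show "(\<lambda>s. G g s - G h s) integrable_on {0..t}"
        using t by (intro integrable_diff G_int) auto
      show "(\<lambda>s. L * exp (K * s) * ?D) integrable_on {0..t}" using I by blast
      fix s assume s: "s \<in> {0..t}"
      have "norm (G g s - G h s) \<le> L * norm (exp (K * s) *\<^sub>R g s - exp (K * s) *\<^sub>R h s)"
        unfolding G_def by (rule lip) (use s t in auto)
      also have "norm (exp (K * s) *\<^sub>R g s - exp (K * s) *\<^sub>R h s) = exp (K * s) * dist (g s) (h s)"
        by (simp add: dist_norm flip: scaleR_diff_right)
      also have "L * \<dots> \<le> L * (exp (K * s) * ?D)"
        using L by (intro mult_left_mono dist_bounded) auto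
      finally show "norm (G g s - G h s) \<le> L * exp (K * s) * ?D" by (simp add: mult.assoc)
    qed
    also have "\<dots> = L * ?D / K * (exp (K * t) - 1)" using I by (rule integral_unique)
    also have "\<dots> \<le> L * ?D / K * exp (K * t)"
      using L K by (intro mult_left_mono) auto
    finally have 1: "norm (integral {0..t} (G g) - integral {0..t} (G h)) \<le> L * ?D / K * exp (K * t)" .
    have "dist (T g t') (T h t') = exp (- K * t) * norm (integral {0..t} (G g) - integral {0..t} (G h))"
      by (simp add: T H_def dist_norm t_def flip: scaleR_diff_right)
    also have "\<dots> \<le> exp (- K * t) * (L * ?D / K * exp (K * t))"
      using 1 by (intro mult_left_mono) auto
    also have "\<dots> = L * ?D / K"
      by (simp add: exp_minus)
    also have "\<dots> \<le> 1/2 * ?D"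
      using K L by (simp add: K_def divide_le_eq algebra_simps)
    finally show "dist (T g t') (T h t') \<le> 1/2 * ?D" .
  qed
  then obtain g where g: "T g = g"
    using banach_fix_type[of "1/2" T] by auto
  define X where "X t = exp (K * t) *\<^sub>R g t" for t
  have "X t = x + integral {0..t} (\<lambda>s. F s (X s))" if t: "t \<in> {0..1}" for t
  proof -
    have "g t = H g t" using T[of g t] cl(2)[OF t] by (simp add: g)
    then have "X t = exp (K * t) *\<^sub>R H g t" by (simp add: X_def)
    also have "\<dots> = x + integral {0..t} (G g)" by (simp add: H_def exp_minus)
    finally show ?thesis by (simp add: G_def[abs_def] X_def)
  qed
  moreover have "continuous_on {0..1} X"
    unfolding X_def by (intro continuous_intros) auto
  ultimately show ?thesis by blast
qed

context radial_rkhs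
begin

lemma ev_continuous:
  assumes "continuous_on S v" "continuous_on S g"
  shows "continuous_on S (\<lambda>t. ev (v t) (g t))"
  unfolding continuous_on_def
proof safe
  fix t assume t: "t \<in> S"
  have le: "norm (ev (v s) (g s) - ev (v t) (g t)) \<le> C * norm (v s - v t) + C * norm (v t) * norm (g s - g t)" for s
  proof -
    have "ev (v s) (g s) - ev (v t) (g t) = ev (v s - v t) (g s) + (ev (v t) (g s) - ev (v t) (g t))"
      using linear_diff[OF ev_linear, of "v s" "v t" "g s"] by simp
    also have "norm \<dots> \<le> C * norm (v s - v t) + C * norm (v t) * norm (g s - g t)"
      by (rule norm_triangle_le[OF add_mono[OF ev_bound ev_lipschitz]])
    finally show ?thesis .
  qed
  have "((\<lambda>s. C * norm (v s - v t) + C * norm (v t) * norm (g s - g t)) \<longlongrightarrow>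
      C * norm (v t - v t) + C * norm (v t) * norm (g t - g t)) (at t within S)"
    using assms t unfolding continuous_on_def by (intro tendsto_intros) auto
  then have "((\<lambda>s. C * norm (v s - v t) + C * norm (v t) * norm (g s - g t)) \<longlongrightarrow> 0) (at t within S)"
    by (simp only: diff_self norm_zero mult_zero_right add_0)
  then have "((\<lambda>s. ev (v s) (g s) - ev (v t) (g t)) \<longlongrightarrow> 0) (at t within S)"
    by (rule Lim_null_comparison[OF always_eventually[OF allI[OF le]]])
  then show "((\<lambda>s. ev (v s) (g s)) \<longlongrightarrow> ev (v t) (g t)) (at t within S)"
    by (rule LIM_zero_cancel)
qed

text \<open>Competing controls bring their own flow; one has to be constructed only for the optimal
  control, which is continuous in time and thus has a uniform Lipschitz constant.\<close>

lemma flow_exists: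
  assumes v: "continuous_on {0..1} v"
  shows "\<exists>\<phi>. is_flow ev v \<phi>"
proof -
  obtain R where "\<forall>t\<in>{0..1}. norm (v t) \<le> R"
    using compact_imp_bounded[OF compact_continuous_image[OF v]] by (auto simp: bounded_iff)
  then have R: "\<And>t. t \<in> {0..1} \<Longrightarrow> norm (v t) \<le> R" by blast
  have "0 \<le> R" using R[of 0] norm_ge_zero[of "v 0"] by (simp del: norm_ge_zero)
  have "norm (ev (v s) y - ev (v s) z) \<le> C * R * norm (y - z)" if "s \<in> {0..1}" for s y z
    by (rule order_trans[OF ev_lipschitz]) (use R[OF that] C(1) in \<open>simp add: mult_left_mono mult_right_mono\<close>)
  then have "\<exists>X. continuous_on {0..1} X \<and> (\<forall>t\<in>{0..1}. X t = x + integral {0..t} (\<lambda>s. ev (v s) (X s)))" for x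
    using ev_continuous[OF v] C(1) \<open>0 \<le> R\<close> by (intro picard[where L = "C * R"]) auto
  then obtain X where X: "\<And>x. continuous_on {0..1} (X x)"
      "\<And>x t. t \<in> {0..1} \<Longrightarrow> X x t = x + integral {0..t} (\<lambda>s. ev (v s) (X x s))"
    by metis
  have "integrable (lebesgue_on {0..t}) (\<lambda>s. ev (v s) (X x s)) \<and>
      X x t = x + integral\<^sup>L (lebesgue_on {0..t}) (\<lambda>s. ev (v s) (X x s))" if t: "t \<in> {0..1}" for x t
  proof
    have "continuous_on {0..t} (\<lambda>s. ev (v s) (X x s))"
      by (rule continuous_on_subset[OF ev_continuous[OF v X(1)]]) (use t in auto)
    then show i: "integrable (lebesgue_on {0..t}) (\<lambda>s. ev (v s) (X x s))"
      by (intro absolutely_integrable_imp_lebesgue_on absolutely_integrable_continuous_real)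
    show "X x t = x + integral\<^sup>L (lebesgue_on {0..t}) (\<lambda>s. ev (v s) (X x s))"
      unfolding lebesgue_on_Icc_integral(2)[OF i] by (rule X(2)[OF t])
  qed
  then have "is_flow ev v (\<lambda>t x. X x t)" by (simp add: is_flow_def)
  then show ?thesis by blast
qed

end

section \<open>A control that attains the bound\<close>

lemma continuous_L2_unit_interval:
  assumes "continuous_on {0..1} v"
  shows "v \<in> L2_unit_interval"
proof -
  have "v \<in> borel_measurable (lebesgue_on {0..1})"
    by (rule continuous_imp_measurable_on_sets_lebesgue[OF assms]) simp
  moreover have "integrable (lebesgue_on {0..1}) (\<lambda>t. (norm (v t))\<^sup>2)"
    by (intro absolutely_integrable_imp_lebesgue_on absolutely_integrable_continuous_real continuous_intros assms)
  ultimately show ?thesis by (simp add: L2_unit_interval_def)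
qed

text \<open>If \<open>w1\<close> is \<open>u0\<close> or \<open>- u0\<close>, the great circle is
  not determined, and a dimension of at least two supplies a direction orthogonal to
  \<open>u0\<close>. In the antipodal case this choice is the source of non-uniqueness.\<close>

lemma great_circle_direction:
  fixes u0 w1 :: "'a::euclidean_space"
  assumes "2 \<le> DIM('a)" "norm u0 = 1" "norm w1 = 1"
  obtains e where "norm e = 1" "u0 \<bullet> e = 0"
    "w1 = cos (arccos (u0 \<bullet> w1)) *\<^sub>R u0 + sin (arccos (u0 \<bullet> w1)) *\<^sub>R e"
proof -
  let ?r = "w1 - (u0 \<bullet> w1) *\<^sub>R u0"
  have uu: "u0 \<bullet> u0 = 1" "w1 \<bullet> w1 = 1" using assms by (simp_all add: dot_square_norm)
  have le: "\<bar>u0 \<bullet> w1\<bar> \<le> 1" using abs_inner_unit_le[OF assms(2,3)] .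
  have "(norm ?r)\<^sup>2 = 1 - (u0 \<bullet> w1)\<^sup>2"
    unfolding power2_norm_eq_inner
    by (simp add: inner_diff_left inner_diff_right inner_commute[of w1 u0] uu power2_eq_square)
  then have r: "norm ?r = sin (arccos (u0 \<bullet> w1))"
    using le by (metis norm_ge_zero real_sqrt_unique sin_arccos_abs)
  have ort: "u0 \<bullet> ?r = 0" by (simp add: inner_diff_right uu)
  have cs: "cos (arccos (u0 \<bullet> w1)) = u0 \<bullet> w1" using le by (rule cos_arccos_abs)
  show ?thesis
  proof (cases "?r = 0")
    case True
    obtain y where y: "y \<noteq> 0" "orthogonal u0 y"
      using orthogonal_to_vector_exists[OF assms(1)] by blast
    show ?thesis
      by (rule that[of "sgn y"]) (use y True r cs in \<open>auto simp: norm_sgn orthogonal_def sgn_div_norm\<close>)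
  next
    case False
    show ?thesis
      by (rule that[of "sgn ?r"]) (use False ort cs in \<open>auto simp: norm_sgn sgn_div_norm simp flip: r\<close>)
  qed
qed

context radial_rkhs
begin

theorem optimal_control_exists:
  fixes x0 u0 y1 w1 :: "real^'n" and \<gamma> r0 c \<beta>1 :: real
  assumes dim: "2 \<le> CARD('n)" and \<gamma>: "0 < \<gamma>" and r0: "0 < r0" and u0: "norm u0 = 1" and w1: "norm w1 = 1"
    and c: "c = sqrt (\<gamma> * r0 / \<tau>)" and \<beta>1: "0 \<le> \<beta>1"
  shows "\<exists>v \<eta> \<phi>. v \<in> L2_unit_interval \<and> \<eta> \<in> L2_unit_interval \<and> is_flow ev v \<phi> \<and>
    (\<forall>t\<in>{0..1}. 0 \<le> weight \<eta> t) \<and>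
    varifold_path r0 x0 u0 \<eta> \<phi> 1 = dirac_varifold (r0 * (sinh \<beta>1 / c)\<^sup>2) y1 w1 \<and>
    energy \<gamma> r0 x0 u0 (v, \<eta>, \<phi>) =
      1/2 * ((norm (y1 - x0))\<^sup>2 + \<tau> * (arccos (u0 \<bullet> w1))\<^sup>2 + 4 * \<tau> * (\<beta>1 - arsinh c)\<^sup>2)"
proof -
  have c_pos: "c > 0" using \<gamma> r0 \<tau>_pos by (simp add: c)
  define \<theta> where "\<theta> = arccos (u0 \<bullet> w1)"
  obtain e where e: "norm e = 1" "u0 \<bullet> e = 0" "w1 = cos \<theta> *\<^sub>R u0 + sin \<theta> *\<^sub>R e"
    using great_circle_direction[OF _ u0 w1] dim unfolding \<theta>_def by auto
  define \<beta>0 where "\<beta>0 = arsinh c"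
  define \<delta> where "\<delta> = \<beta>1 - \<beta>0"
  define \<beta> where "\<beta> t = \<beta>0 + t * \<delta>" for t
  have \<beta>0: "0 \<le> \<beta>0" "sinh \<beta>0 = c" using c_pos by (simp_all add: \<beta>0_def less_imp_le)
  have \<beta>_nonneg: "0 \<le> \<beta> t" if "t \<in> {0..1}" for t
  proof -
    have "\<beta> t = (1 - t) * \<beta>0 + t * \<beta>1" by (simp add: \<beta>_def \<delta>_def algebra_simps)
    then show ?thesis using that \<beta>0(1) \<beta>1 by simp
  qed
  have cosh_nz: "cosh s \<noteq> 0" for s :: real using cosh_real_pos[of s] by linarith
  have sech: "1 - (tanh s)\<^sup>2 = 1 / (cosh s)\<^sup>2" for s :: real
  proof -
    have "1 - (tanh s)\<^sup>2 = ((cosh s)\<^sup>2 - (sinh s)\<^sup>2) / (cosh s)\<^sup>2"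
      using cosh_nz[of s] by (simp add: tanh_def power_divide diff_divide_distrib)
    moreover have "(cosh s)\<^sup>2 - (sinh s)\<^sup>2 = 1" by (simp add: cosh_square_eq)
    ultimately show ?thesis by simp
  qed
  define X where "X t = x0 + t *\<^sub>R (y1 - x0)" for t :: real
  define u where "u t = cos (\<theta> * t) *\<^sub>R u0 + sin (\<theta> * t) *\<^sub>R e" for t
  define u' where "u' t = \<theta> *\<^sub>R (cos (\<theta> * t) *\<^sub>R e - sin (\<theta> * t) *\<^sub>R u0)" for t
  \<comment> \<open>With \<open>z\<close> below, \<open>(c * z t, 1 / sqrt (m t))\<close> moves on
    the circle of radius \<open>cosh \<beta>0\<close> about the origin. This is the hyperbolic
    geodesic through the start (c, 1) that is orthogonal to the vertical ray, and
    \<open>\<beta> t\<close> is the signed distance from that ray, run through at constant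
    speed.\<close>
  define m where "m t = (cosh (\<beta> t) / cosh \<beta>0)\<^sup>2" for t
  \<comment> \<open>The coefficient of \<open>u t\<close> is the logarithmic derivative of
    \<open>m\<close>, so that \<open>b\<close> is the derivative of \<open>m t *\<^sub>R u t\<close>
    divided by \<open>m t\<close>.\<close>
  define b where "b t = u' t + (2 * \<delta> * tanh (\<beta> t)) *\<^sub>R u t" for t
  define z where "z t = tanh (\<beta> t) * (cosh \<beta>0 / c)" for t
  define \<eta> where "\<eta> t = 2 * \<delta> * cosh \<beta>0 / (c * (cosh (\<beta> t))\<^sup>2)" for t
  define v where "v t = min_field (X t) (u t) (y1 - x0) (b t)" for t
  have dot: "u0 \<bullet> u0 = 1" "e \<bullet> e = 1" "u0 \<bullet> e = 0" "e \<bullet> u0 = 0"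
    using u0 e by (simp_all add: dot_square_norm inner_commute)
  have trig: "cos s * cos s + sin s * sin s = 1" for s :: real
    using sin_cos_squared_add2[of s] by (simp add: power2_eq_square)
  have uu: "u t \<bullet> u t = 1" for t
    by (simp add: u_def inner_add_left inner_add_right dot trig)
  then have u_unit: "norm (u t) = 1" for t by (simp add: norm_eq_1)
  have uu': "u t \<bullet> u' t = 0" for t
    by (simp add: u_def u'_def inner_add_left inner_diff_right dot)
  have u'u': "u' t \<bullet> u' t = \<theta>\<^sup>2" for t
  proof -
    have "(cos (\<theta> * t) *\<^sub>R e - sin (\<theta> * t) *\<^sub>R u0) \<bullet> (cos (\<theta> * t) *\<^sub>R e - sin (\<theta> * t) *\<^sub>R u0) = 1"
      by (simp add: inner_diff_left inner_diff_right dot trig)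
    then show ?thesis by (simp add: u'_def power2_eq_square)
  qed
  have norm_b: "(norm (b t))\<^sup>2 = \<theta>\<^sup>2 + (2 * \<delta> * tanh (\<beta> t))\<^sup>2" for t
    unfolding power2_norm_eq_inner b_def
    by (simp add: inner_add_left inner_add_right uu uu' u'u' inner_commute[of "u' t" "u t"] power2_eq_square)
  have \<beta>_cont: "continuous_on S \<beta>" for S unfolding \<beta>_def by (intro continuous_intros)
  have X_cont: "continuous_on S X" for S unfolding X_def by (intro continuous_intros)
  have u_cont: "continuous_on S u" for S unfolding u_def by (intro continuous_intros)
  have b_cont: "continuous_on S b" for S
    unfolding b_def u'_def by (intro continuous_intros u_cont \<beta>_cont) (simp add: cosh_nz)
  have m_cont: "continuous_on S m" for S
    unfolding m_def by (intro continuous_intros \<beta>_cont) (simp add: cosh_nz)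
  have \<eta>_cont: "continuous_on S \<eta>" for S
    unfolding \<eta>_def using c_pos by (intro continuous_intros \<beta>_cont) (simp add: cosh_nz)
  have v_cont: "continuous_on S v" for S
    unfolding v_def by (intro min_field_continuous X_cont u_cont b_cont continuous_on_const)
  obtain \<phi> where \<phi>: "is_flow ev v \<phi>"
    using flow_exists[OF v_cont] by blast
  note L2 = continuous_L2_unit_interval[OF v_cont] continuous_L2_unit_interval[OF \<eta>_cont]
  interpret F: dirac_control ev K \<rho> d \<sigma> \<tau> \<gamma> r0 x0 u0 v \<eta> \<phi>
    by unfold_locales (fact \<gamma> r0 u0 L2 \<phi>)+
  have Fc: "F.c = c" by (simp add: F.c_def c)
  \<comment> \<open>The flow is known only to exist. Uniqueness identifies its orbit of
    \<open>x0\<close> with the straight line \<open>X\<close>, and its derivative applied to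
    \<open>u0\<close> with \<open>m t *\<^sub>R u t\<close>.\<close>
  have "primitive_on X (\<lambda>s. y1 - x0) 0 1"
  proof (rule primitive_on_C1)
    show "(X has_vector_derivative y1 - x0) (at t)" for t
      unfolding X_def by (auto intro!: derivative_eq_intros)
  qed (rule continuous_on_const)
  then have "primitive_on X (\<lambda>s. ev (v s) (X s)) 0 1"
    by (rule primitive_on_cong) (simp_all add: v_def ev_min_field[OF u_unit])
  from F.flow_unique[OF this] have \<phi>_X: "\<phi> t x0 = X t" if "t \<in> {0..1}" for t
    using that by (simp add: X_def)
  have "primitive_on (\<lambda>t. m t *\<^sub>R u t) (\<lambda>t. m t *\<^sub>R b t) 0 1"
  proof (rule primitive_on_C1)
    have du: "(u has_vector_derivative u' t) (at t)" for t
      unfolding u_def u'_def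
      by (auto intro!: derivative_eq_intros simp: algebra_simps)
    have "(m has_real_derivative m t * (2 * \<delta> * tanh (\<beta> t))) (at t)" for t
      unfolding m_def \<beta>_def using cosh_nz
      by (auto intro!: derivative_eq_intros simp: tanh_def power2_eq_square field_simps)
    then have "((\<lambda>t. m t *\<^sub>R u t) has_vector_derivative (m t *\<^sub>R u' t + (m t * (2 * \<delta> * tanh (\<beta> t))) *\<^sub>R u t)) (at t)" for t
      by (intro has_vector_derivative_scaleR du)
    then show "((\<lambda>t. m t *\<^sub>R u t) has_vector_derivative m t *\<^sub>R b t) (at t)" for t
      by (simp add: b_def scaleR_add_right)
    show "continuous_on {0..1} (\<lambda>t. m t *\<^sub>R b t)"
      by (intro continuous_on_scaleR m_cont b_cont)
  qed
  then have mu: "primitive_on (\<lambda>t. m t *\<^sub>R u t) (\<lambda>t. dev (v t) (\<phi> t x0) (m t *\<^sub>R u t)) 0 1"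
    by (rule primitive_on_cong)
      (simp_all add: \<phi>_X v_def linear_scale[OF dev_linear] dev_min_field[OF u_unit])
  have "m 0 *\<^sub>R u 0 = u0" using cosh_nz by (simp add: m_def u_def \<beta>_def)
  then have w: "F.w t = m t *\<^sub>R u t" if "t \<in> {0..1}" for t
    using F.linearized_unique[OF F.w_primitive mu _ that] by (simp add: F.w_0)
  have m_pos: "m t > 0" for t using cosh_nz by (simp add: m_def)
  have norm_w: "norm (F.w t) = m t" and sgn_w: "sgn (F.w t) = u t" if "t \<in> {0..1}" for t
    using w[OF that] m_pos[of t] by (simp_all add: u_unit sgn_div_norm)
  have "primitive_on z (\<lambda>t. \<eta> t / 2) 0 1"
  proof (rule primitive_on_C1)
    have "(z has_real_derivative (1 - (tanh (\<beta> t))\<^sup>2) * \<delta> * (cosh \<beta>0 / c)) (at t)" for t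
      unfolding z_def \<beta>_def using cosh_nz c_pos by (auto intro!: derivative_eq_intros)
    moreover have "(1 - (tanh (\<beta> t))\<^sup>2) * \<delta> * (cosh \<beta>0 / c) = \<eta> t / 2" for t
      unfolding sech by (simp add: \<eta>_def)
    ultimately have "(z has_real_derivative \<eta> t / 2) (at t)" for t
      by (simp only:)
    then show "(z has_vector_derivative \<eta> t / 2) (at t)" for t
      by (simp add: has_real_derivative_iff_has_vector_derivative)
    show "continuous_on {0..1} (\<lambda>t. \<eta> t / 2)"
      by (intro continuous_on_divide \<eta>_cont continuous_on_const) simp
  qed
  moreover have "z 0 = 1"
    using cosh_nz c_pos \<beta>0 by (simp add: z_def \<beta>_def tanh_def)
  ultimately have weight_z: "weight \<eta> t = z t" if "t \<in> {0..1}" for t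
    using primitive_on_eq[OF F.weight_primitive that] primitive_on_eq[of z _ 0 1 t] that
    by (simp add: F.weight_0)
  have z_nonneg: "0 \<le> z t" if "t \<in> {0..1}" for t
    using \<beta>_nonneg[OF that] c_pos unfolding z_def by (intro mult_nonneg_nonneg divide_nonneg_nonneg) auto
  have B1: "F.B 1 = \<beta>1"
  proof -
    have "sqrt (m 1) = cosh (\<beta> 1) / cosh \<beta>0" by (simp add: m_def)
    then have "c * z 1 * sqrt (m 1) = sinh \<beta>1"
      using c_pos cosh_nz by (simp add: z_def \<beta>_def \<delta>_def tanh_def)
    then show ?thesis
      by (simp add: F.B_def weight_z norm_w Fc arsinh_sinh_real)
  qed
  have "u 1 = w1" "X 1 = y1" using e by (simp_all add: u_def X_def)
  then have target: "varifold_path r0 x0 u0 \<eta> \<phi> 1 = dirac_varifold (r0 * (sinh \<beta>1 / c)\<^sup>2) y1 w1"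
    using F.varifold_path_eq[of 1] by (simp add: B1 Fc \<phi>_X sgn_w)
  let ?T = "(norm (y1 - x0))\<^sup>2 + \<tau> * \<theta>\<^sup>2 + 4 * \<tau> * \<delta>\<^sup>2"
  \<comment> \<open>The density is constant in time: the weight contributes a multiple of
    \<open>1 - (tanh (\<beta> t))\<^sup>2\<close>, the stretching the same multiple of
    \<open>(tanh (\<beta> t))\<^sup>2\<close>.\<close>
  have "F.E t = ?T" if t: "t \<in> {0..1}" for t
  proof -
    have "\<gamma> * (\<eta> t)\<^sup>2 * m t * r0 = (\<tau> * c\<^sup>2) * ((\<eta> t)\<^sup>2 * m t)"
      using F.c_squared by (simp add: Fc mult_ac)
    also have "\<dots> = 4 * \<tau> * \<delta>\<^sup>2 * (1 / (cosh (\<beta> t))\<^sup>2)"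
      using c_pos cosh_nz by (simp add: \<eta>_def m_def power_divide power_mult_distrib power2_eq_square field_simps)
    also note sech[symmetric]
    finally have "\<gamma> * (\<eta> t)\<^sup>2 * m t * r0 = 4 * \<tau> * \<delta>\<^sup>2 * (1 - (tanh (\<beta> t))\<^sup>2)" .
    then show ?thesis
      unfolding F.E_def norm_w[OF t]
      by (simp add: v_def norm_min_field[OF u_unit] norm_b power_mult_distrib algebra_simps)
  qed
  then have "integral {0..1} F.E = integral {0..1} (\<lambda>t::real. ?T)"
    by (intro integral_cong)
  then have "energy \<gamma> r0 x0 u0 (v, \<eta>, \<phi>) = 1/2 * ?T"
    by (simp add: F.energy_eq)
  moreover have "\<forall>t\<in>{0..1}. 0 \<le> weight \<eta> t"
    using weight_z z_nonneg by simp
  ultimately show ?thesis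
    using L2 \<phi> target unfolding \<theta>_def \<delta>_def \<beta>0_def by blast
qed

end

section \<open>The distance and its geodesics\<close>

lemma singleton_varifold_space:
  "norm (u::real^'n) = 1 \<Longrightarrow> {(x, u)} \<in> sets varifold_space"
  unfolding varifold_space_def sets_restrict_space by (rule image_eqI[of _ _ "{(x, u)}"]) auto

lemma space_varifold_space: "space (varifold_space :: ((real^'n) \<times> (real^'n)) measure) = UNIV \<times> sphere 0 1"
  by (simp add: varifold_space_def space_restrict_space)

lemma dirac_varifold_eqD:
  fixes x x' u u' :: "real^'n"
  assumes eq: "dirac_varifold r x u = dirac_varifold r' x' u'"
    and u: "norm u = 1" "norm u' = 1" and r: "0 \<le> r" "0 \<le> r'"
  shows "r = r'" "r' \<noteq> 0 \<Longrightarrow> x = x'" "r' \<noteq> 0 \<Longrightarrow> u = u'"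
proof -
  let ?M = "varifold_space :: ((real^'n) \<times> (real^'n)) measure"
  have em: "ennreal r * indicator A (x, u) = ennreal r' * indicator A (x', u')" if "A \<in> sets ?M" for A
    using arg_cong[OF eq, of "\<lambda>M. emeasure M A"] that by (simp add: dirac_varifold_def)
  have "ennreal r = ennreal r'"
    using em[OF sets.top] u by (simp add: space_varifold_space)
  then show rr: "r = r'" using r by simp
  assume "r' \<noteq> 0"
  have "(x, u) = (x', u')"
  proof (rule ccontr)
    assume "(x, u) \<noteq> (x', u')"
    then have "ennreal r' = 0"
      using em[OF singleton_varifold_space[OF u(2), of x']] by (auto simp: indicator_def)
    then show False using r \<open>r' \<noteq> 0\<close> by simp
  qed
  then show "x = x'" "u = u'" by auto
qed

lemma dirac_varifold_0: "dirac_varifold 0 x u = dirac_varifold 0 x' u'"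
proof (rule measure_eqI)
  show "sets (dirac_varifold 0 x u) = sets (dirac_varifold 0 x' u')"
    by (simp add: dirac_varifold_def)
qed (simp add: dirac_varifold_def)

text \<open>The exact excess of a path broken at time \<open>t\<close> over the straight one;
  rigidity of minimizers rests on the last term being an explicit square.\<close>

lemma split_norm_square:
  fixes p q :: "'a::real_inner"
  assumes "0 < t" "t < 1"
  shows "(norm p)\<^sup>2 / t + (norm q)\<^sup>2 / (1 - t) =
    (norm (p + q))\<^sup>2 + (norm ((1 - t) *\<^sub>R p - t *\<^sub>R q))\<^sup>2 / (t * (1 - t))"
proof -
  have "t * (1 - t) * ((norm p)\<^sup>2 / t + (norm q)\<^sup>2 / (1 - t)) = (1 - t) * (norm p)\<^sup>2 + t * (norm q)\<^sup>2"
    using assms by (simp add: field_simps)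
  also have "\<dots> = t * (1 - t) * (norm (p + q))\<^sup>2 + (norm ((1 - t) *\<^sub>R p - t *\<^sub>R q))\<^sup>2"
    unfolding power2_norm_eq_inner
    by (simp add: inner_add_left inner_add_right inner_diff_left inner_diff_right inner_commute[of q p] algebra_simps)
  also have "\<dots> = t * (1 - t) * ((norm (p + q))\<^sup>2 + (norm ((1 - t) *\<^sub>R p - t *\<^sub>R q))\<^sup>2 / (t * (1 - t)))"
    using assms by (simp add: distrib_left)
  finally show ?thesis using assms by (simp only: mult_cancel_left) auto
qed

lemma split_square:
  fixes p q t :: real
  assumes "0 < t" "t < 1"
  shows "p\<^sup>2 / t + q\<^sup>2 / (1 - t) = (p + q)\<^sup>2 + ((1 - t) * p - t * q)\<^sup>2 / (t * (1 - t))"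
  using split_norm_square[OF assms, of p q] by simp

text \<open>The claimed point is a unit vector whose inner product with \<open>U\<close> is 1, so
  the two coincide. Excluding antipodal ends keeps \<open>sin \<theta>\<close> away from 0 when
  \<theta> is not 0.\<close>

lemma great_circle_point:
  fixes u0 w1 U :: "'a::real_inner"
  assumes unit: "norm u0 = 1" "norm w1 = 1" "norm U = 1" and neq: "w1 \<noteq> - u0"
    and \<theta>: "\<theta> = arccos (u0 \<bullet> w1)"
    and ang: "arccos (u0 \<bullet> U) = t * \<theta>" "arccos (U \<bullet> w1) = (1 - t) * \<theta>"
  shows "U = (if \<theta> \<noteq> 0 then (sin ((1 - t) * \<theta>) *\<^sub>R u0 + sin (t * \<theta>) *\<^sub>R w1) /\<^sub>R sin \<theta> else u0)"
proof -
  have one: "u0 \<bullet> u0 = 1" "w1 \<bullet> w1 = 1" "U \<bullet> U = 1"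
    using unit by (simp_all add: dot_square_norm)
  have cos: "u0 \<bullet> U = cos (t * \<theta>)" "U \<bullet> w1 = cos ((1 - t) * \<theta>)" "u0 \<bullet> w1 = cos \<theta>"
    using cos_arccos_abs[OF abs_inner_unit_le[OF unit(1,3)]] cos_arccos_abs[OF abs_inner_unit_le[OF unit(3,2)]]
      cos_arccos_abs[OF abs_inner_unit_le[OF unit(1,2)]] ang \<theta> by simp_all
  have eqI: "x = y" if "x \<bullet> x = 1" "y \<bullet> y = 1" "x \<bullet> y = 1" for x y :: 'a
  proof -
    have "(x - y) \<bullet> (x - y) = 0"
      using that by (simp add: inner_diff_left inner_diff_right inner_commute)
    then show ?thesis by simp
  qed
  show ?thesis
  proof (cases "\<theta> = 0")
    case True
    then show ?thesis using eqI[of U u0] one cos by (simp add: inner_commute)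
  next
    case False
    have "\<theta> \<noteq> pi"
    proof
      assume "\<theta> = pi"
      then have "w1 = - u0" using eqI[of w1 "- u0"] one cos by (simp add: inner_commute)
      then show False using neq by contradiction
    qed
    moreover have "0 \<le> \<theta>" "\<theta> \<le> pi"
      using abs_inner_unit_le[OF unit(1,2)] by (auto simp: \<theta> intro: arccos_lbound arccos_ubound)
    ultimately have sin_pos: "sin \<theta> > 0" using False by (intro sin_gt_zero) auto
    define a where "a = (1 - t) * \<theta>"
    define b where "b = t * \<theta>"
    have ab: "\<theta> = a + b" by (simp add: a_def b_def algebra_simps)
    let ?S = "(sin a *\<^sub>R u0 + sin b *\<^sub>R w1) /\<^sub>R sin \<theta>"
    have "U \<bullet> (sin a *\<^sub>R u0 + sin b *\<^sub>R w1) = sin \<theta>"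
      using cos unfolding a_def[symmetric] b_def[symmetric]
      by (simp add: inner_add_right inner_commute[of U u0] ab sin_add)
    then have "U \<bullet> ?S = 1" using sin_pos by simp
    moreover have "?S \<bullet> ?S = 1"
    proof -
      have "(sin a *\<^sub>R u0 + sin b *\<^sub>R w1) \<bullet> (sin a *\<^sub>R u0 + sin b *\<^sub>R w1) =
          (sin a)\<^sup>2 + (sin b)\<^sup>2 + 2 * sin a * sin b * cos (a + b)"
        using one cos(3) unfolding ab
        by (simp add: inner_add_left inner_add_right inner_commute[of w1 u0] power2_eq_square algebra_simps)
      also have "\<dots> = (sin a)\<^sup>2 * (1 - (sin b)\<^sup>2) + (sin b)\<^sup>2 * (1 - (sin a)\<^sup>2) + 2 * sin a * sin b * cos a * cos b"
        by (simp add: cos_add power2_eq_square algebra_simps)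
      also have "\<dots> = (sin \<theta>)\<^sup>2"
        unfolding ab sin_add cos_squared_eq[symmetric] by (simp add: power2_eq_square algebra_simps)
      finally have sq: "(sin a *\<^sub>R u0 + sin b *\<^sub>R w1) \<bullet> (sin a *\<^sub>R u0 + sin b *\<^sub>R w1) = (sin \<theta>)\<^sup>2" .
      show ?thesis
        unfolding inner_scaleR_left inner_scaleR_right sq using sin_pos
        by (simp add: power2_eq_square field_simps)
    qed
    ultimately have "U = ?S" using eqI one by blast
    then show ?thesis using False by (simp add: a_def b_def)
  qed
qed

text \<open>The three formulas for \<open>\<nu>\<close> express, up to sign, the increment of \<open>arsinh\<close>.\<close>

lemma exp_arsinh:
  fixes c :: real
  assumes "0 < c"
  shows "exp (arsinh c) = c * (sqrt (1 + 1 / c\<^sup>2) + 1)" "exp (- arsinh c) = c * (sqrt (1 + 1 / c\<^sup>2) - 1)"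
proof -
  have "c\<^sup>2 + 1 = c\<^sup>2 * (1 + 1 / c\<^sup>2)" using assms by (simp add: distrib_left)
  then have "sqrt (c\<^sup>2 + 1) = c * sqrt (1 + 1 / c\<^sup>2)"
    using assms by (simp add: real_sqrt_mult)
  then have "cosh (arsinh c) = c * sqrt (1 + 1 / c\<^sup>2)" by (simp add: cosh_arsinh_real)
  moreover have "exp (arsinh c) = cosh (arsinh c) + sinh (arsinh c)"
    "exp (- arsinh c) = cosh (arsinh c) - sinh (arsinh c)"
    by (rule cosh_plus_sinh[symmetric], rule cosh_minus_sinh[symmetric])
  ultimately show "exp (arsinh c) = c * (sqrt (1 + 1 / c\<^sup>2) + 1)" "exp (- arsinh c) = c * (sqrt (1 + 1 / c\<^sup>2) - 1)"
    by (simp_all add: algebra_simps)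
qed

lemma nu_arsinh:
  fixes c r0 r1 \<nu> chi :: real
  assumes c: "0 < c" and r: "0 < r0" "0 \<le> r1" and chi: "chi = sqrt (1 + 1 / c\<^sup>2)"
    and \<nu>_zero: "r1 = 0 \<Longrightarrow> \<nu> = - 1/2 * ln ((chi - 1) / (chi + 1))"
    and \<nu>_le: "0 < r1 \<Longrightarrow> r1 \<le> r0 \<Longrightarrow>
      \<nu> = ln (- sqrt (r1 / r0) * ((1 - sqrt (1 + r0 / r1 * (chi\<^sup>2 - 1))) / (chi - 1)))"
    and \<nu>_ge: "0 < r0 \<Longrightarrow> r0 \<le> r1 \<Longrightarrow>
      \<nu> = ln (sqrt (r1 / r0) * ((1 + sqrt (1 + r0 / r1 * (chi\<^sup>2 - 1))) / (chi + 1)))"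
  shows "\<nu> = arsinh (c * sqrt (r1 / r0)) - arsinh c \<or> \<nu> = arsinh c - arsinh (c * sqrt (r1 / r0))"
proof -
  \<comment> \<open>In other words, \<open>chi\<close> is the hyperbolic cotangent of
    \<open>arsinh c\<close>.\<close>
  have e0: "exp (arsinh c) = c * (chi + 1)" "exp (- arsinh c) = c * (chi - 1)"
    unfolding chi by (rule exp_arsinh[OF c])+
  have chi1: "chi > 1" using e0(2) c by (metis exp_gt_zero zero_less_mult_pos diff_gt_0_iff_gt)
  show ?thesis
  proof (cases "r1 = 0")
    case True
    have "(chi - 1) / (chi + 1) = exp (- arsinh c) / exp (arsinh c)"
      unfolding e0 using c by simp
    also have "\<dots> = exp (- 2 * arsinh c)" by (simp flip: exp_diff)
    finally have "\<nu> = arsinh c" using \<nu>_zero[OF True] by simp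
    then show ?thesis using True by simp
  next
    case False
    then have r1: "r1 > 0" using r by simp
    define s where "s = sqrt (r1 / r0)"
    have s: "s > 0" using r1 r by (simp add: s_def)
    have "chi\<^sup>2 - 1 = 1 / c\<^sup>2" unfolding chi by (simp add: add_nonneg_nonneg)
    then have "1 + r0 / r1 * (chi\<^sup>2 - 1) = 1 + 1 / (c * s)\<^sup>2"
      using r1 r c by (simp add: s_def power_mult_distrib)
    then have S: "sqrt (1 + r0 / r1 * (chi\<^sup>2 - 1)) = sqrt (1 + 1 / (c * s)\<^sup>2)" by simp
    have e1: "exp (arsinh (c * s)) = c * s * (sqrt (1 + 1 / (c * s)\<^sup>2) + 1)"
      "exp (- arsinh (c * s)) = c * s * (sqrt (1 + 1 / (c * s)\<^sup>2) - 1)"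
      by (rule exp_arsinh; use c s in simp)+
    show ?thesis
    proof (cases "r1 \<le> r0")
      case True
      \<comment> \<open>For a target of smaller mass the formula yields minus the increment, so that
        \<nu> is nonnegative in every case.\<close>
      have "- s * ((1 - sqrt (1 + 1 / (c * s)\<^sup>2)) / (chi - 1)) = exp (- arsinh (c * s)) / exp (- arsinh c)"
        unfolding e0 e1 using c chi1 by (simp add: field_simps)
      also have "\<dots> = exp (arsinh c - arsinh (c * s))" by (simp flip: exp_diff)
      finally have "\<nu> = arsinh c - arsinh (c * s)"
        using \<nu>_le[OF r1 True] unfolding S s_def[symmetric] by simp
      then show ?thesis by (simp add: s_def)
    next
      case False
      have "s * ((1 + sqrt (1 + 1 / (c * s)\<^sup>2)) / (chi + 1)) = exp (arsinh (c * s)) / exp (arsinh c)"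
        unfolding e0 e1 using c by (simp add: mult.assoc add.commute)
      also have "\<dots> = exp (arsinh (c * s) - arsinh c)" by (simp flip: exp_diff)
      finally have "\<nu> = arsinh (c * s) - arsinh c"
        using \<nu>_ge[OF r(1)] False unfolding S s_def[symmetric] by simp
      then show ?thesis by (simp add: s_def)
    qed
  qed
qed

text \<open>Expresses \<open>sinh\<close> of an affine function through its two end values. This
  turns a half-plane coordinate that is affine in time into the stated formula for the mass.\<close>

lemma sinh_interpolation:
  fixes a \<delta> t :: real
  shows "sinh a * sinh ((1 - t) * \<delta>) + sinh (a + \<delta>) * sinh (\<delta> * t) = sinh \<delta> * sinh (a + t * \<delta>)"
proof -
  have "sinh ((1 - t) * \<delta>) = sinh (\<delta> - t * \<delta>)" by (simp add: algebra_simps)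
  then show ?thesis
    by (simp add: sinh_add sinh_diff cosh_add algebra_simps)
qed

section \<open>Rigidity of minimizers\<close>

context dirac_control
begin

lemma B_0: "B 0 = arsinh c"
  by (simp add: B_def weight_0 w_0 u0)

lemma sinh_B_nonneg: "0 \<le> weight \<eta> t \<Longrightarrow> 0 \<le> sinh (B t)"
  using c_pos by (simp add: B_def)

text \<open>If the energy does not exceed the bound, the quadratic excesses of the path broken at
  \<open>t\<close> and the excess in the triangle inequality for angles are nonnegative with a sum
  of at most 0, so each of them vanishes.\<close>

lemma energy_defect:
  fixes y1 w1 :: "real^'n"
  assumes end1: "\<phi> 1 x0 = y1" "sgn (w 1) = w1"
    and le: "integral {0..1} E \<le> (norm (y1 - x0))\<^sup>2 + \<tau> * (arccos (u0 \<bullet> w1))\<^sup>2 + 4 * \<tau> * (B 1 - arsinh c)\<^sup>2"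
    and t: "t \<in> {0..1}"
  shows "\<phi> t x0 = (1 - t) *\<^sub>R x0 + t *\<^sub>R y1"
    "arccos (u0 \<bullet> sgn (w t)) = t * arccos (u0 \<bullet> w1)"
    "arccos (sgn (w t) \<bullet> w1) = (1 - t) * arccos (u0 \<bullet> w1)"
    "B t = arsinh c + t * (B 1 - arsinh c)"
proof -
  let ?X = "\<phi> t x0" and ?U = "sgn (w t)" and ?\<theta> = "arccos (u0 \<bullet> w1)" and ?\<delta> = "B 1 - arsinh c"
  have sgn_u0: "sgn u0 = u0" using u0 by (simp add: sgn_div_norm)
  have w1: "norm w1 = 1" using norm_sgn_w[of 1] end1 by simp
  have self: "arccos (x \<bullet> x) = 0" if "norm x = 1" for x :: "real^'n"
    using that by (simp add: dot_square_norm)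
  \<comment> \<open>The excess terms carry the denominator \<open>t * (1 - t)\<close>, hence the
    separate end points.\<close>
  consider "t = 0" | "t = 1" | "0 < t" "t < 1" using t by fastforce
  then have "?X = (1 - t) *\<^sub>R x0 + t *\<^sub>R y1 \<and> arccos (u0 \<bullet> ?U) = t * ?\<theta> \<and>
      arccos (?U \<bullet> w1) = (1 - t) * ?\<theta> \<and> B t = arsinh c + t * ?\<delta>"
  proof cases
    case 1
    then show ?thesis by (simp add: start w_0 sgn_u0 self u0 B_0)
  next
    case 2
    then show ?thesis by (simp add: end1 self w1)
  next
    case 3
    let ?\<alpha> = "arccos (u0 \<bullet> ?U)" and ?\<alpha>' = "arccos (?U \<bullet> w1)"
    let ?D1 = "(norm (?X - ((1 - t) *\<^sub>R x0 + t *\<^sub>R y1)))\<^sup>2 / (t * (1 - t))"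
    let ?D2 = "((1 - t) * ?\<alpha> - t * ?\<alpha>')\<^sup>2 / (t * (1 - t))"
    let ?D3 = "(B t - (arsinh c + t * ?\<delta>))\<^sup>2 / (t * (1 - t))"
    have "integral {0..t} E + integral {t..1} E = integral {0..1} E"
      using 3 by (intro Henstock_Kurzweil_Integration.integral_combine E_integrable) auto
    moreover have "((norm (?X - x0))\<^sup>2 + \<tau> * ?\<alpha>\<^sup>2 + 4 * \<tau> * (B t - arsinh c)\<^sup>2) / t \<le> integral {0..t} E"
      using energy_lower_bound[of 0 t] 3 by (simp add: start w_0 sgn_u0 B_0)
    moreover have "((norm (y1 - ?X))\<^sup>2 + \<tau> * ?\<alpha>'\<^sup>2 + 4 * \<tau> * (B 1 - B t)\<^sup>2) / (1 - t) \<le> integral {t..1} E"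
      using energy_lower_bound[of t 1] 3 by (simp add: end1)
    ultimately have sum: "((norm (?X - x0))\<^sup>2 / t + (norm (y1 - ?X))\<^sup>2 / (1 - t)) + \<tau> * (?\<alpha>\<^sup>2 / t + ?\<alpha>'\<^sup>2 / (1 - t)) +
        4 * \<tau> * ((B t - arsinh c)\<^sup>2 / t + (B 1 - B t)\<^sup>2 / (1 - t)) \<le>
        (norm (y1 - x0))\<^sup>2 + \<tau> * ?\<theta>\<^sup>2 + 4 * \<tau> * ?\<delta>\<^sup>2"
      using le by (simp add: add_divide_distrib distrib_left)
    have "(1 - t) *\<^sub>R (?X - x0) - t *\<^sub>R (y1 - ?X) = ?X - ((1 - t) *\<^sub>R x0 + t *\<^sub>R y1)"
      by (simp add: algebra_simps)
    then have s1: "(norm (?X - x0))\<^sup>2 / t + (norm (y1 - ?X))\<^sup>2 / (1 - t) = (norm (y1 - x0))\<^sup>2 + ?D1"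
      using split_norm_square[OF 3, of "?X - x0" "y1 - ?X"] by simp
    have "(1 - t) * (B t - arsinh c) - t * (B 1 - B t) = B t - (arsinh c + t * ?\<delta>)"
      by (simp add: algebra_simps)
    then have s3: "(B t - arsinh c)\<^sup>2 / t + (B 1 - B t)\<^sup>2 / (1 - t) = ?\<delta>\<^sup>2 + ?D3"
      using split_square[OF 3, of "B t - arsinh c" "B 1 - B t"] by simp
    have U: "norm ?U = 1" using norm_sgn_w[OF t] .
    have tri: "?\<theta> \<le> ?\<alpha> + ?\<alpha>'"
      by (rule arccos_triangle[OF u0 U w1])
    have "0 \<le> ?\<theta>"
      using abs_inner_unit_le[OF u0 w1] by (intro arccos_lbound) auto
    then have ge2: "?\<theta>\<^sup>2 \<le> (?\<alpha> + ?\<alpha>')\<^sup>2" using tri by (intro power_mono)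
    have s2: "?\<alpha>\<^sup>2 / t + ?\<alpha>'\<^sup>2 / (1 - t) = (?\<alpha> + ?\<alpha>')\<^sup>2 + ?D2"
      by (rule split_square[OF 3])
    have "?D1 + \<tau> * ((?\<alpha> + ?\<alpha>')\<^sup>2 - ?\<theta>\<^sup>2) + \<tau> * ?D2 + 4 * \<tau> * ?D3 \<le> 0"
      using sum unfolding s1 s2 s3 by (simp add: distrib_left right_diff_distrib)
    moreover have "0 \<le> ?D1" "0 \<le> \<tau> * ?D2" "0 \<le> 4 * \<tau> * ?D3" "0 \<le> \<tau> * ((?\<alpha> + ?\<alpha>')\<^sup>2 - ?\<theta>\<^sup>2)"
      using 3 \<tau>_pos ge2 by (simp_all add: divide_nonneg_pos)
    moreover have "p = 0 \<and> q = 0 \<and> r = 0 \<and> s = 0"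
      if "p + q + r + s \<le> 0" "0 \<le> p" "0 \<le> r" "0 \<le> s" "0 \<le> q" for p q r s :: real
      using that by linarith
    ultimately have "?D1 = 0 \<and> \<tau> * ((?\<alpha> + ?\<alpha>')\<^sup>2 - ?\<theta>\<^sup>2) = 0 \<and> \<tau> * ?D2 = 0 \<and> 4 * \<tau> * ?D3 = 0"
      by blast
    then have zero: "?D1 = 0" "\<tau> * ((?\<alpha> + ?\<alpha>')\<^sup>2 - ?\<theta>\<^sup>2) = 0" "\<tau> * ?D2 = 0" "4 * \<tau> * ?D3 = 0"
      by blast+
    have nz: "t * (1 - t) \<noteq> 0" "\<tau> \<noteq> 0" using 3 \<tau>_pos by auto
    have z1: "?X = (1 - t) *\<^sub>R x0 + t *\<^sub>R y1"
      using zero(1) nz by (simp only: divide_eq_0_iff simp_thms power_eq_0_iff norm_eq_zero right_minus_eq)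
    have z2: "(1 - t) * ?\<alpha> - t * ?\<alpha>' = 0"
      using zero(3) nz by (simp only: divide_eq_0_iff simp_thms power_eq_0_iff mult_eq_0_iff)
    have z3: "B t = arsinh c + t * ?\<delta>"
      using zero(4) nz by (simp only: divide_eq_0_iff simp_thms power_eq_0_iff mult_eq_0_iff right_minus_eq) simp
    have z4: "(?\<alpha> + ?\<alpha>')\<^sup>2 = ?\<theta>\<^sup>2"
      using zero(2) nz by (simp only: simp_thms mult_eq_0_iff right_minus_eq)
    \<comment> \<open>The quadratic excess fixes the ratio of the two angles, the triangle
      inequality their sum.\<close>
    have "p = t * \<theta> \<and> q = (1 - t) * \<theta>" if "p + q = \<theta>" "(1 - t) * p - t * q = 0" for p q \<theta> :: real
      using that by (auto simp: algebra_simps)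
    moreover have "?\<alpha> + ?\<alpha>' = ?\<theta>"
      by (rule power2_eq_imp_eq[OF z4 order_trans[OF \<open>0 \<le> ?\<theta>\<close> tri] \<open>0 \<le> ?\<theta>\<close>])
    ultimately show ?thesis using z1 z2 z3 by blast
  qed
  then show "\<phi> t x0 = (1 - t) *\<^sub>R x0 + t *\<^sub>R y1"
    "arccos (u0 \<bullet> sgn (w t)) = t * arccos (u0 \<bullet> w1)"
    "arccos (sgn (w t) \<bullet> w1) = (1 - t) * arccos (u0 \<bullet> w1)"
    "B t = arsinh c + t * (B 1 - arsinh c)"
    by blast+
qed

end

(* For r1 = 0 the target is the zero varifold, which does not depend on x1 and u1.  The formulas
   then hold for its representative over the source point (x0, u0), hence y1 and w1. *)
theorem proposition3:
  fixes x0 x1 y1 u0 u1 w1 :: "real^'n"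
    and r0 r1 \<sigma> \<gamma> \<tau> chi \<nu> \<theta> :: real
    and \<rho> \<rho>' r :: "real \<Rightarrow> real"
    and x u :: "real \<Rightarrow> real^'n"
    and K :: "real^'n \<Rightarrow> real^'n \<Rightarrow> real^'n^'n"
    and ev :: "'v::{real_inner,complete_space} \<Rightarrow> real^'n \<Rightarrow> real^'n"
  assumes dim: "2 \<le> CARD('n)"
    and V: "vector_field_space ev" "reproducing_kernel ev K"
    and K: "\<And>x y. K x y = \<rho> ((norm (x - y))\<^sup>2 / \<sigma>\<^sup>2) *\<^sub>R mat 1"
    and \<sigma>: "0 < \<sigma>"
    and \<rho>_C1: "\<And>t. 0 \<le> t \<Longrightarrow> (\<rho> has_real_derivative \<rho>' t) (at t within {0..})"
      "continuous_on {0..} \<rho>'"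
    and \<rho>_0: "\<rho> 0 = 1" "\<rho>' 0 < 0"
    and \<gamma>: "0 < \<gamma>"
    and source: "0 < r0" "norm u0 = 1"
    and target: "0 \<le> r1" "norm u1 = 1"
    and y1: "y1 = (if r1 = 0 then x0 else x1)"
    and w1: "w1 = (if r1 = 0 then u0 else u1)"
    and \<tau>: "\<tau> = - \<sigma>\<^sup>2 / (2 * \<rho>' 0)"
    and chi: "chi = sqrt (1 + \<tau> / (\<gamma> * r0))"
    and \<nu>_zero: "r1 = 0 \<Longrightarrow> \<nu> = - 1/2 * ln ((chi - 1) / (chi + 1))"
    and \<nu>_le: "0 < r1 \<Longrightarrow> r1 \<le> r0 \<Longrightarrow>
      \<nu> = ln (- sqrt (r1 / r0) * ((1 - sqrt (1 + r0 / r1 * (chi\<^sup>2 - 1))) / (chi - 1)))"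
    and \<nu>_ge: "0 < r0 \<Longrightarrow> r0 \<le> r1 \<Longrightarrow>
      \<nu> = ln (sqrt (r1 / r0) * ((1 + sqrt (1 + r0 / r1 * (chi\<^sup>2 - 1))) / (chi + 1)))"
    and \<theta>: "\<theta> = arccos (u0 \<bullet> w1)"
    and x: "\<And>t. x t = (1 - t) *\<^sub>R x0 + t *\<^sub>R y1"
    and u: "\<And>t. u t = (if \<theta> \<noteq> 0
      then (sin ((1 - t) * \<theta>) *\<^sub>R u0 + sin (t * \<theta>) *\<^sub>R w1) /\<^sub>R sin \<theta> else u0)"
    and r: "\<And>t. r t = (if \<nu> = 0
      then ((1 - t) * sqrt r0 + t * sqrt r1)\<^sup>2
      else ((sqrt r0 * sinh ((1 - t) * \<nu>) + sqrt r1 * sinh (\<nu> * t)) / sinh \<nu>)\<^sup>2)"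
  shows "0 < \<tau> \<and>
    lddmm_fr_sqdist ev \<gamma> r0 x0 u0 (dirac_varifold r1 x1 u1) =
      ereal ((norm (y1 - x0))\<^sup>2 / 2 + \<tau> / 2 * (arccos (u0 \<bullet> w1))\<^sup>2 + 2 * \<tau> * \<nu>\<^sup>2) \<and>
    (w1 \<noteq> - u0 \<longrightarrow>
      (\<exists>\<mu>. lddmm_fr_geodesic ev \<gamma> r0 x0 u0 (dirac_varifold r1 x1 u1) \<mu>) \<and>
      (\<forall>\<mu>. lddmm_fr_geodesic ev \<gamma> r0 x0 u0 (dirac_varifold r1 x1 u1) \<mu> \<longrightarrow>
        (\<forall>t\<in>{0..1}. \<mu> t = dirac_varifold (r t) (x t) (u t))))"
proof -
  interpret radial_rkhs ev K \<rho> "\<rho>' 0" \<sigma> \<tau>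
    using V K \<sigma> \<rho>_C1(1)[of 0] \<rho>_0 \<tau> by unfold_locales auto
  define c where "c = sqrt (\<gamma> * r0 / \<tau>)"
  have c_pos: "c > 0" using \<gamma> source(1) \<tau>_pos by (simp add: c_def)
  define \<beta>1 where "\<beta>1 = arsinh (c * sqrt (r1 / r0))"
  define \<delta> where "\<delta> = \<beta>1 - arsinh c"
  have sinh_\<beta>1: "sinh \<beta>1 = c * sqrt (r1 / r0)" by (simp add: \<beta>1_def)
  then have \<beta>1_nonneg: "0 \<le> \<beta>1"
    using c_pos source(1) target(1) by (metis divide_nonneg_pos less_imp_le mult_nonneg_nonneg real_sqrt_ge_zero sinh_real_nonneg_iff)
  have mass_1: "r0 * (sinh \<beta>1 / c)\<^sup>2 = r1"
    using c_pos source(1) target(1) by (simp add: sinh_\<beta>1)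
  have "chi = sqrt (1 + 1 / c\<^sup>2)"
    using \<gamma> source(1) \<tau>_pos by (simp add: chi c_def)
  from nu_arsinh[OF c_pos source(1) target(1) this \<nu>_zero \<nu>_le \<nu>_ge]
  have \<nu>: "\<nu> = \<delta> \<or> \<nu> = - \<delta>"
    by (auto simp: \<delta>_def \<beta>1_def)
  then have \<nu>_sq: "\<nu>\<^sup>2 = \<delta>\<^sup>2" by auto
  have w1_unit: "norm w1 = 1" using w1 source(2) target(2) by auto
  let ?\<mu>1 = "dirac_varifold r1 x1 u1"
  let ?T = "(norm (y1 - x0))\<^sup>2 + \<tau> * \<theta>\<^sup>2 + 4 * \<tau> * \<delta>\<^sup>2"
  have \<mu>1_eq: "?\<mu>1 = dirac_varifold r1 y1 w1"
    by (auto simp: y1 w1 intro: dirac_varifold_0)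
  have "u0 \<bullet> u0 = 1" using source(2) by (simp add: dot_square_norm)
  then have \<theta>_0: "\<theta> = 0" if "r1 = 0" using that by (simp add: \<theta> w1)

  have control: "dirac_control ev K \<rho> (\<rho>' 0) \<sigma> \<tau> \<gamma> r0 u0 v \<eta> \<phi>"
    if "(v, \<eta>, \<phi>) \<in> admissible ev r0 x0 u0 ?\<mu>1" for v \<eta> \<phi>
    by unfold_locales (use that \<gamma> source in \<open>auto simp: admissible_def\<close>)
  have endpoint: "dirac_control.B \<tau> \<gamma> r0 x0 u0 \<eta> \<phi> 1 = \<beta>1 \<and>
      (r1 \<noteq> 0 \<longrightarrow> \<phi> 1 x0 = y1 \<and> sgn (dirac_control.w x0 u0 \<phi> 1) = w1)"
    if adm: "(v, \<eta>, \<phi>) \<in> admissible ev r0 x0 u0 ?\<mu>1" for v \<eta> \<phi>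
  proof -
    interpret F: dirac_control ev K \<rho> "\<rho>' 0" \<sigma> \<tau> \<gamma> r0 x0 u0 v \<eta> \<phi>
      by (rule control[OF adm])
    have "dirac_varifold (r0 * (sinh (F.B 1) / c)\<^sup>2) (\<phi> 1 x0) (sgn (F.w 1)) = dirac_varifold r1 y1 w1"
      using adm F.varifold_path_eq[of 1] by (simp add: admissible_def \<mu>1_eq F.c_def c_def)
    note D = dirac_varifold_eqD[OF this F.norm_sgn_w w1_unit _ target(1)]
    have mass: "r0 * (sinh (F.B 1) / c)\<^sup>2 = r0 * (sinh \<beta>1 / c)\<^sup>2"
      using D(1) source(1) by (simp add: mass_1)
    \<comment> \<open>The mass determines only the square of \<open>sinh (F.B 1)\<close>; the
      nonnegative weight selects the root.\<close>
    have "0 \<le> sinh (F.B 1)"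
      using adm by (intro F.sinh_B_nonneg) (simp add: admissible_def)
    then have "sinh (F.B 1) = sinh \<beta>1"
      using mass c_pos source(1) \<beta>1_nonneg by (auto simp: power_divide intro: power2_eq_imp_eq)
    then show ?thesis using D source(1) target(1) by simp
  qed
  have lower: "?T \<le> integral {0..1} (dirac_control.E \<gamma> r0 x0 u0 v \<eta> \<phi>) \<and>
      (integral {0..1} (dirac_control.E \<gamma> r0 x0 u0 v \<eta> \<phi>) \<le> ?T \<longrightarrow>
        \<phi> 1 x0 = y1 \<and> sgn (dirac_control.w x0 u0 \<phi> 1) = w1)"
    if adm: "(v, \<eta>, \<phi>) \<in> admissible ev r0 x0 u0 ?\<mu>1" for v \<eta> \<phi>
  proof -
    interpret F: dirac_control ev K \<rho> "\<rho>' 0" \<sigma> \<tau> \<gamma> r0 x0 u0 v \<eta> \<phi>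
      by (rule control[OF adm])
    let ?a = "arccos (u0 \<bullet> sgn (F.w 1))"
    have "sgn u0 = u0" using source(2) by (simp add: sgn_div_norm)
    then have le: "(norm (\<phi> 1 x0 - x0))\<^sup>2 + \<tau> * ?a\<^sup>2 + 4 * \<tau> * \<delta>\<^sup>2 \<le> integral {0..1} F.E"
      using F.energy_lower_bound[of 0 1] endpoint[OF adm]
      by (simp add: F.start F.w_0 F.B_0 F.c_def c_def \<delta>_def)
    show ?thesis
    proof (cases "r1 = 0")
      case False
      then show ?thesis using le endpoint[OF adm] by (simp add: \<theta>)
    next
      case True
      have nonneg: "0 \<le> (norm (\<phi> 1 x0 - x0))\<^sup>2" "0 \<le> \<tau> * ?a\<^sup>2" using \<tau>_pos by auto
      have T: "?T = 4 * \<tau> * \<delta>\<^sup>2" using True \<theta>_0 by (simp add: y1)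
      \<comment> \<open>Admissibility leaves the final position and direction free for a zero
        target; minimality pins them to those of the source, as any motion would cost extra
        energy.\<close>
      have "\<phi> 1 x0 = y1 \<and> sgn (F.w 1) = w1" if "integral {0..1} F.E \<le> ?T"
      proof -
        have "(norm (\<phi> 1 x0 - x0))\<^sup>2 = 0" "\<tau> * ?a\<^sup>2 = 0"
          using that le nonneg unfolding T by linarith+
        then have "\<phi> 1 x0 = x0" "?a = 0" using \<tau>_pos by auto
        moreover have "norm (sgn (F.w 1)) = 1" by (rule F.norm_sgn_w) simp
        ultimately have "u0 = sgn (F.w 1)"
          using arccos_inner_eq_0D[OF source(2)] by blast
        then show ?thesis using True \<open>\<phi> 1 x0 = x0\<close> by (simp add: y1 w1)
      qed
      moreover have "4 * \<tau> * \<delta>\<^sup>2 \<le> integral {0..1} F.E" using le nonneg by linarith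
      ultimately show ?thesis unfolding T by blast
    qed
  qed

  obtain v0 \<eta>0 \<phi>0 where opt: "(v0, \<eta>0, \<phi>0) \<in> admissible ev r0 x0 u0 ?\<mu>1"
      "energy \<gamma> r0 x0 u0 (v0, \<eta>0, \<phi>0) = 1/2 * ?T"
    using optimal_control_exists[OF dim \<gamma> source w1_unit c_def \<beta>1_nonneg, of x0 y1]
    unfolding mass_1 \<mu>1_eq[symmetric] \<theta>[symmetric] \<delta>_def[symmetric] admissible_def by blast
  have energy_ge: "1/2 * ?T \<le> energy \<gamma> r0 x0 u0 a" if "a \<in> admissible ev r0 x0 u0 ?\<mu>1" for a
  proof -
    obtain v \<eta> \<phi> where a: "a = (v, \<eta>, \<phi>)" by (cases a)
    then show ?thesis
      using lower that dirac_control.energy_eq[OF control] by auto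
  qed
  have dist: "lddmm_fr_sqdist ev \<gamma> r0 x0 u0 ?\<mu>1 = ereal (1/2 * ?T)"
    unfolding lddmm_fr_sqdist_def
  proof (rule antisym)
    show "(INF a\<in>admissible ev r0 x0 u0 ?\<mu>1. ereal (energy \<gamma> r0 x0 u0 a)) \<le> ereal (1/2 * ?T)"
      by (rule INF_lower2[OF opt(1)]) (simp add: opt(2))
    show "ereal (1/2 * ?T) \<le> (INF a\<in>admissible ev r0 x0 u0 ?\<mu>1. ereal (energy \<gamma> r0 x0 u0 a))"
      by (rule INF_greatest) (use energy_ge in simp)
  qed
  have "\<forall>a\<in>admissible ev r0 x0 u0 ?\<mu>1. energy \<gamma> r0 x0 u0 (v0, \<eta>0, \<phi>0) \<le> energy \<gamma> r0 x0 u0 a"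
    using energy_ge unfolding opt(2) by blast
  then have geodesic: "\<exists>\<mu>. lddmm_fr_geodesic ev \<gamma> r0 x0 u0 ?\<mu>1 \<mu>"
    unfolding lddmm_fr_geodesic_def using opt(1)
    by (intro exI[of _ "varifold_path r0 x0 u0 \<eta>0 \<phi>0"] exI[of _ v0] exI[of _ \<eta>0] exI[of _ \<phi>0] conjI) auto

  \<comment> \<open>The quotient defining \<open>r\<close> is even in \<nu>, so the undetermined
    sign of \<nu> is harmless; \<nu> vanishes only for equal masses, and then \<open>r\<close> is
    constant.\<close>
  have r_eq: "r0 * (sinh (arsinh c + t * \<delta>) / c)\<^sup>2 = r t" for t
  proof (cases "\<nu> = 0")
    case True
    then have \<delta>_0: "\<delta> = 0" using \<nu> by auto
    then have "sinh \<beta>1 = c" by (simp add: \<delta>_def)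
    then have "r1 = r0" using mass_1 c_pos by simp
    then have "(1 - t) * sqrt r0 + t * sqrt r1 = sqrt r0" by (simp add: algebra_simps)
    then have "r t = r0" using r[of t] True source(1) by simp
    then show ?thesis using c_pos by (simp add: \<delta>_0)
  next
    case False
    then have "sinh \<delta> \<noteq> 0" using \<nu> by auto
    have sqrt_r1: "sqrt r1 = sqrt r0 / c * sinh (arsinh c + \<delta>)"
      using c_pos source(1) by (simp add: \<delta>_def sinh_\<beta>1 real_sqrt_divide)
    have "sqrt r0 * sinh ((1 - t) * \<delta>) + sqrt r1 * sinh (\<delta> * t) =
        sqrt r0 / c * (sinh (arsinh c) * sinh ((1 - t) * \<delta>) + sinh (arsinh c + \<delta>) * sinh (\<delta> * t))"
      unfolding sqrt_r1 distrib_left using c_pos by simp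
    then have "(sqrt r0 * sinh ((1 - t) * \<delta>) + sqrt r1 * sinh (\<delta> * t)) / sinh \<delta> =
        sqrt r0 / c * ((sinh (arsinh c) * sinh ((1 - t) * \<delta>) + sinh (arsinh c + \<delta>) * sinh (\<delta> * t)) / sinh \<delta>)"
      by simp
    also have "\<dots> = sqrt r0 / c * sinh (arsinh c + t * \<delta>)"
      unfolding sinh_interpolation using \<open>sinh \<delta> \<noteq> 0\<close> by simp
    finally have "((sqrt r0 * sinh ((1 - t) * \<delta>) + sqrt r1 * sinh (\<delta> * t)) / sinh \<delta>)\<^sup>2 =
        r0 * (sinh (arsinh c + t * \<delta>) / c)\<^sup>2"
      using source(1) by (simp add: power_mult_distrib power_divide)
    moreover have "(sqrt r0 * sinh ((1 - t) * \<nu>) + sqrt r1 * sinh (\<nu> * t)) / sinh \<nu> =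
        (sqrt r0 * sinh ((1 - t) * \<delta>) + sqrt r1 * sinh (\<delta> * t)) / sinh \<delta>"
      using \<nu>
    proof
      assume eq: "\<nu> = - \<delta>"
      then have "sqrt r0 * sinh ((1 - t) * \<nu>) + sqrt r1 * sinh (\<nu> * t) =
          - (sqrt r0 * sinh ((1 - t) * \<delta>) + sqrt r1 * sinh (\<delta> * t))"
        by simp
      then show ?thesis
        by (rule ssubst) (simp only: eq sinh_minus minus_divide_divide)
    qed simp
    ultimately show ?thesis using r[of t] False by simp
  qed
  have unique: "\<mu> t = dirac_varifold (r t) (x t) (u t)"
    if neq: "w1 \<noteq> - u0" and geo: "lddmm_fr_geodesic ev \<gamma> r0 x0 u0 ?\<mu>1 \<mu>" and t: "t \<in> {0..1}" for \<mu> t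
  proof -
    obtain v \<eta> \<phi> where adm: "(v, \<eta>, \<phi>) \<in> admissible ev r0 x0 u0 ?\<mu>1"
        and min: "energy \<gamma> r0 x0 u0 (v, \<eta>, \<phi>) \<le> energy \<gamma> r0 x0 u0 (v0, \<eta>0, \<phi>0)"
        and \<mu>: "\<mu> t = varifold_path r0 x0 u0 \<eta> \<phi> t"
      using geo opt(1) t unfolding lddmm_fr_geodesic_def by blast
    interpret F: dirac_control ev K \<rho> "\<rho>' 0" \<sigma> \<tau> \<gamma> r0 x0 u0 v \<eta> \<phi>
      by (rule control[OF adm])
    have le: "integral {0..1} F.E \<le> ?T"
      using min by (simp add: F.energy_eq opt(2))
    then have end1: "\<phi> 1 x0 = y1" "sgn (F.w 1) = w1" using lower[OF adm] by auto
    have Fc: "F.c = c" by (simp add: F.c_def c_def)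
    have B1: "F.B 1 - arsinh F.c = \<delta>" using endpoint[OF adm] by (simp add: \<delta>_def Fc)
    have "integral {0..1} F.E \<le> (norm (y1 - x0))\<^sup>2 + \<tau> * (arccos (u0 \<bullet> w1))\<^sup>2 + 4 * \<tau> * (F.B 1 - arsinh F.c)\<^sup>2"
      using le unfolding B1 \<theta> .
    note D = F.energy_defect[OF end1 this t, unfolded B1, folded \<theta>]
    have "sgn (F.w t) = u t"
      unfolding u
      by (rule great_circle_point[OF source(2) w1_unit F.norm_sgn_w[OF t] neq \<theta> D(2,3)])
    then show ?thesis
      unfolding \<mu> F.varifold_path_eq[OF t] by (simp add: D(1,4) Fc r_eq x)
  qed
  have "1/2 * ?T = (norm (y1 - x0))\<^sup>2 / 2 + \<tau> / 2 * (arccos (u0 \<bullet> w1))\<^sup>2 + 2 * \<tau> * \<nu>\<^sup>2"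
    by (simp add: \<nu>_sq \<theta> field_simps)
  then show ?thesis
    using \<tau>_pos dist geodesic unique by auto
qed

end
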